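(* There is an absolute constant $K>0$ such that the following holds. Let $n\ge 1$, $\epsilon\ge 0$, and let $f\colon S_n\to\{0,1\}$ satisfy $\mathbb{E}[(f-\ell)^2]\le\epsilon$ for some linear function $\ell\colon S_n\to\mathbb{R}$, and $\mathbb{E}[f]\le 1/2$. Then there is a set $\mathcal{C}\subseteq[n]^2$ of cosets with $|\mathcal{C}|\le Kn$ and with at most $K\epsilon n^2$ unordered pairs of non-disjoint cosets in $\mathcal{C}$, such that $g=\max_{(i,j)\in\mathcal{C}}x_{i,j}$ (with $g=0$ if $\mathcal{C}=\emptyset$) satisfies $\Pr[f\neq g]\le K\epsilon$. Conversely, for every $A>0$ there is $B>0$ such that for all $n\ge1$, $\epsilon\ge0$, and every $\mathcal{C}\subseteq[n]^2$ with $|\mathcal{C}|\le An$ and at most $A\epsilon n^2$ unordered pairs of non-disjoint cosets, the function $g=\max_{(i,j)\in\mathcal{C}}x_{i,j}$ satisfies $\mathbb{E}[(g-\ell)^2]\le B\epsilon$ for some linear function $\ell\colon S_n\to\mathbb{R}$.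
   Context: $S_n$ is the symmetric group on $[n]=\{1,\dots,n\}$; expectations and probabilities are over a uniformly random $\pi\in S_n$. For $i,j\in[n]$, $x_{i,j}(\pi)=1$ if $\pi(i)=j$ and $0$ otherwise. A function $S_n\to\mathbb{R}$ is linear if it can be written as $\sum_{i,j}c_{i,j}x_{i,j}$ with real $c_{i,j}$. The coset $(i,j)$ is the set of permutations with $\pi(i)=j$. Two distinct cosets $(i,j),(k,\ell)$ are disjoint (as sets of permutations) iff $i=k$ or $j=\ell$; they are non-disjoint iff $i\neq k$ and $j\neq \ell$. *)

theory Defs
  imports "HOL-Probability.Probability" "HOL-Combinatorics.Permutations"
begin

abbreviation Sn :: "nat \<Rightarrow> (nat \<Rightarrow> nat) set" where
  "Sn n \<equiv> {\<pi>. \<pi> permutes {1..n}}"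

abbreviation unif_perm :: "nat \<Rightarrow> (nat \<Rightarrow> nat) pmf" where
  "unif_perm n \<equiv> pmf_of_set (Sn n)"

abbreviation expect_Sn :: "nat \<Rightarrow> ((nat \<Rightarrow> nat) \<Rightarrow> real) \<Rightarrow> real" where
  "expect_Sn n f \<equiv> measure_pmf.expectation (unif_perm n) f"

abbreviation prob_Sn :: "nat \<Rightarrow> (nat \<Rightarrow> nat) set \<Rightarrow> real" where
  "prob_Sn n E \<equiv> measure_pmf.prob (unif_perm n) E"

definition x_ind :: "nat \<Rightarrow> nat \<Rightarrow> (nat \<Rightarrow> nat) \<Rightarrow> real" where
  "x_ind i j \<pi> = (if \<pi> i = j then 1 else 0)"

(* Functions on the symmetric group are represented by total functions on nat \<Rightarrow> nat;
   only their values on Sn n matter. *)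
definition linear_on_Sn :: "nat \<Rightarrow> ((nat \<Rightarrow> nat) \<Rightarrow> real) \<Rightarrow> bool" where
  "linear_on_Sn n l \<longleftrightarrow>
     (\<exists>c :: nat \<Rightarrow> nat \<Rightarrow> real. \<forall>\<pi>\<in>Sn n.
        l \<pi> = (\<Sum>i\<in>{1..n}. \<Sum>j\<in>{1..n}. c i j * x_ind i j \<pi>))"

definition perm_coset :: "nat \<Rightarrow> nat \<times> nat \<Rightarrow> (nat \<Rightarrow> nat) set" where
  "perm_coset n a = {\<pi> \<in> Sn n. \<pi> (fst a) = snd a}"

(* Cosets are counted by their labels (i,j): for n = 2 different labels can denote the
   same set of permutations. An unordered pair is a two-element set of labels. *)
definition nondisjoint_pairs :: "nat \<Rightarrow> (nat \<times> nat) set \<Rightarrow> (nat \<times> nat) set set" where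
  "nondisjoint_pairs n C =
     {{a, b} | a b. a \<in> C \<and> b \<in> C \<and> a \<noteq> b \<and> perm_coset n a \<inter> perm_coset n b \<noteq> {}}"

definition coset_max :: "(nat \<times> nat) set \<Rightarrow> (nat \<Rightarrow> nat) \<Rightarrow> real" where
  "coset_max C \<pi> = (if C = {} then 0 else Max ((\<lambda>(i, j). x_ind i j \<pi>) ` C))"

lemma perm_coset_nondisjoint_iff:
  assumes "i \<in> {1..n}" "j \<in> {1..n}" "k \<in> {1..n}" "l \<in> {1..n}" "(i, j) \<noteq> (k, l)"
  shows "perm_coset n (i, j) \<inter> perm_coset n (k, l) \<noteq> {} \<longleftrightarrow> i \<noteq> k \<and> j \<noteq> l"
proof
  assume "perm_coset n (i, j) \<inter> perm_coset n (k, l) \<noteq> {}"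
  then obtain p where p: "p permutes {1..n}" "p i = j" "p k = l"
    by (auto simp: perm_coset_def)
  then show "i \<noteq> k \<and> j \<noteq> l"
    using assms(5) permutes_inj[OF p(1)] by (auto dest: injD)
next
  assume ne: "i \<noteq> k \<and> j \<noteq> l"
  define q where "q = Transposition.transpose i j"
  define p where "p = Transposition.transpose (q k) l \<circ> q"
  have q: "q permutes {1..n}"
    unfolding q_def using assms by (intro permutes_swap_id) auto
  have qk: "q k \<in> {1..n}"
    using permutes_in_image[OF q] assms(3) by blast
  have "q k \<noteq> q i"
    using ne permutes_inj[OF q] by (auto dest: injD)
  then have "q k \<noteq> j"
    by (simp add: q_def)
  then have "p i = j" "p k = l"
    using ne by (simp_all add: p_def q_def Transposition.transpose_def)
  moreover have "p permutes {1..n}"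
    unfolding p_def using qk assms(4) by (intro permutes_compose[OF q] permutes_swap_id) auto
  ultimately have "p \<in> perm_coset n (i, j) \<inter> perm_coset n (k, l)"
    by (simp add: perm_coset_def)
  then show "perm_coset n (i, j) \<inter> perm_coset n (k, l) \<noteq> {}"
    by blast
qed

end

theory Submission
  imports Defs "HOL-Combinatorics.Cycles"
begin

text \<open>
  Write $f \approx \sum c_{i,j} x_{i,j}$. Multiplying a random permutation by the members of a family of
  disjoint transpositions embeds a discrete cube on which $f$ is close to a linear form, whose
  coefficients are the mixed differences $c_{i,j} + c_{i',j'} - c_{i,j'} - c_{i',j}$. On the
  cube, splitting the form as $A + B$ with $A$, $B$ independent forces $\min(A^2, B^2)$ to be small on
  average; hence all coefficients but one are small, and that one is near $0$ or $\pm 1$. Averaging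
  over the embeddings, almost all mixed differences are near $0$ or $\pm 1$, so subtracting from $c$
  a typical row and column makes $c$ close to a matrix $d$ with entries in $\{-1, 0, 1\}$.

  Call a quadruple $(i, i', j, j')$ active if its mixed difference is not near $0$. Two active quadruples
  with disjoint rows and columns rarely coexist. If there are many active quadruples, a second moment
  argument gives a row (or column) involved in a constant fraction of them, then almost all involve it,
  and $f$ is close to a function of $\pi(r)$ (or $\pi^{-1}(s)$). If there are few, $d$ has at most
  $n / 20$ nonzero entries, the negative ones are negligible because hitting exactly one of them gives
  the value $-1$, and crossing pairs of positive ones are rare because hitting exactly such a pair gives
  the value $2$. For bounded $n$ and small
  $\epsilon$ the approximation by $d$ is exact, and potentials without negative cycles turn $d$ into a
  matrix with entries in $\{0, 1\}$.
\<close>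

subsection \<open>Near-linear Boolean functions on the discrete cube\<close>

text \<open>Adding row terms and column terms to \<open>c\<close> changes the linear form only by a
  constant on \<open>Sn n\<close>, and mixed differences are blind to such a change; so they are the
  right quantities to estimate, and \<open>c\<close> can be recovered only up to a chosen base row
  and column. The obstacle is that a cube may have one large coefficient. The function
  \<open>of_bool (\<pi> r \<in> J)\<close> is exactly linear, yet for \<open>J\<close> of about half
  the columns it has of the order of \<open>n ^ 3\<close> active quadruples, so no argument can make
  the activity itself small. What a cube does exclude is two active coordinates at once. All
  information is therefore about pairs of active quadruples, and the proof has to separate
  concentration on one line from genuine scarcity. The two outcomes give two shapes of
  \<open>C\<close>: a subset of one line, without crossing pairs, or the positive entries of a
  sparse integer matrix, where the crossing pairs have to be counted. The constant \<open>K\<close>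
  contains a factorial: below the size at which the counting works, an error under
  \<open>1 / n!\<close> is made to mean no error.\<close>

definition rad :: "'k set \<Rightarrow> ('k \<Rightarrow> real) \<Rightarrow> 'k set \<Rightarrow> real" where
  "rad T g X = (\<Sum>k\<in>T. if k \<in> X then g k else - g k)"

text \<open>Only the values -1, 0 and 1 are offered, since these are the possible jumps of a Boolean
  function. A nonzero result means that \<open>x\<close> has absolute value at least
  \<open>1/2\<close>.\<close>

definition nearest :: "real \<Rightarrow> int" where
  "nearest x = (if x \<ge> 1/2 then 1 else if x \<le> -1/2 then -1 else 0)"

section \<open>Moments of Rademacher sums\<close>

lemma sum_Pow_insert:
  fixes h :: "'k set \<Rightarrow> real"
  assumes "finite T" "k \<notin> T"
  shows "(\<Sum>X\<in>Pow (insert k T). h X) = (\<Sum>X\<in>Pow T. h X + h (insert k X))"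
proof -
  have "inj_on (insert k) (Pow T)"
    using assms(2) by (auto simp: inj_on_def)
  moreover have "Pow T \<inter> insert k ` Pow T = {}"
    using assms(2) by auto
  ultimately show ?thesis
    using assms(1) by (simp add: Pow_insert sum.union_disjoint sum.reindex sum.distrib)
qed

lemma rad_insert_notin:
  assumes "finite T" "k \<notin> T" "X \<subseteq> T"
  shows "rad (insert k T) g X = rad T g X - g k"
    "rad (insert k T) g (insert k X) = rad T g X + g k"
proof -
  have "k \<notin> X" using assms by auto
  then show "rad (insert k T) g X = rad T g X - g k"
    using assms by (simp add: rad_def)
  have "(\<Sum>j\<in>T. if j = k \<or> j \<in> X then g j else - g j) = (\<Sum>j\<in>T. if j \<in> X then g j else - g j)"
    using assms(2) by (intro sum.cong) auto
  then show "rad (insert k T) g (insert k X) = rad T g X + g k"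
    using assms by (simp add: rad_def)
qed

lemma rad_second_moment:
  assumes "finite T"
  shows "(\<Sum>X\<in>Pow T. (rad T g X)\<^sup>2) = 2 ^ card T * (\<Sum>k\<in>T. (g k)\<^sup>2)"
  using assms
proof (induction T)
  case empty
  then show ?case by (simp add: rad_def)
next
  case (insert k T)
  have "(\<Sum>X\<in>Pow (insert k T). (rad (insert k T) g X)\<^sup>2)
      = (\<Sum>X\<in>Pow T. 2 * (rad T g X)\<^sup>2 + 2 * (g k)\<^sup>2)"
    using insert.hyps
    by (subst sum_Pow_insert) (auto intro!: sum.cong simp: rad_insert_notin power2_eq_square algebra_simps)
  also have "\<dots> = 2 * (\<Sum>X\<in>Pow T. (rad T g X)\<^sup>2) + 2 ^ card T * (2 * (g k)\<^sup>2)"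
    using insert.hyps by (simp add: sum.distrib sum_distrib_left card_Pow)
  finally show ?case
    using insert by (simp add: algebra_simps)
qed

text \<open>Averaging over the sign of one new coefficient cancels the odd powers. The induction has
  room to spare: the step produces \<open>(g k) ^ 4\<close> once, while the square on the right
  offers it three times.\<close>

lemma rad_fourth_moment:
  assumes "finite T"
  shows "(\<Sum>X\<in>Pow T. (rad T g X) ^ 4) \<le> 2 ^ card T * (3 * (\<Sum>k\<in>T. (g k)\<^sup>2)\<^sup>2)"
  using assms
proof (induction T)
  case empty
  then show ?case by (simp add: rad_def)
next
  case (insert k T)
  let ?s = "\<Sum>k\<in>T. (g k)\<^sup>2"
  have eq: "(r - x) ^ 4 + (r + x) ^ 4 = 2 * r ^ 4 + 12 * x\<^sup>2 * r\<^sup>2 + 2 * x ^ 4" for r x :: real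
    by algebra
  have "(\<Sum>X\<in>Pow (insert k T). (rad (insert k T) g X) ^ 4)
      = (\<Sum>X\<in>Pow T. 2 * (rad T g X) ^ 4 + 12 * (g k)\<^sup>2 * (rad T g X)\<^sup>2 + 2 * (g k) ^ 4)"
    using insert.hyps
    by (subst sum_Pow_insert) (auto intro!: sum.cong simp: rad_insert_notin eq)
  also have "\<dots> = 2 * (\<Sum>X\<in>Pow T. (rad T g X) ^ 4) + 12 * (g k)\<^sup>2 * (2 ^ card T * ?s)
      + 2 ^ card T * (2 * (g k) ^ 4)"
    using insert.hyps
    by (simp add: sum.distrib card_Pow flip: sum_distrib_left rad_second_moment)
  also have "\<dots> \<le> 2 * (2 ^ card T * (3 * ?s\<^sup>2)) + 12 * (g k)\<^sup>2 * (2 ^ card T * ?s)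
      + 2 ^ card T * (2 * (g k) ^ 4)"
    using insert.IH by simp
  also have "\<dots> = 2 * 2 ^ card T * (3 * ?s\<^sup>2 + 6 * (g k)\<^sup>2 * ?s + (g k) ^ 4)"
    by (simp add: algebra_simps)
  also have "\<dots> \<le> 2 * 2 ^ card T * (3 * ((g k)\<^sup>2 + ?s)\<^sup>2)"
  proof (intro mult_left_mono)
    have "(g k) ^ 4 = ((g k)\<^sup>2)\<^sup>2" by (simp flip: power_mult)
    moreover have "((g k)\<^sup>2)\<^sup>2 \<ge> 0" by simp
    ultimately show "3 * ?s\<^sup>2 + 6 * (g k)\<^sup>2 * ?s + (g k) ^ 4 \<le> 3 * ((g k)\<^sup>2 + ?s)\<^sup>2"
      unfolding power2_sum by (simp add: algebra_simps)
  qed auto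
  finally show ?case
    using insert.hyps by (simp add: mult.assoc)
qed

text \<open>Bounded variables are needed to compare a minimum of two independent squares with their
  product. The fourth moment controls the tail, so the truncation loses at most a quarter of the
  second moment.\<close>

lemma rad_truncated_second_moment:
  fixes g :: "'k \<Rightarrow> real"
  assumes "finite T"
  defines "s \<equiv> \<Sum>k\<in>T. (g k)\<^sup>2"
  assumes "s > 0"
  shows "(\<Sum>X\<in>Pow T. min ((rad T g X)\<^sup>2) (3 * s)) \<ge> 2 ^ card T * (3 / 4 * s)"
proof -
  \<comment> \<open>The parabola has its maximum \<open>3 * s\<close> at \<open>u = 6 * s\<close>,
    so it lies below both arguments of the minimum. On average its quadratic term costs at most
    \<open>3 * s\<^sup>2 / (12 * s) = s / 4\<close>.\<close>
  have min_ge: "min u (3 * s) \<ge> u - u\<^sup>2 / (12 * s)" for u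
  proof -
    have "(u - 6 * s)\<^sup>2 \<ge> 0" by simp
    then have "u * (12 * s) - u\<^sup>2 \<le> 3 * s * (12 * s)"
      by (simp add: power2_eq_square algebra_simps)
    then have "u - u\<^sup>2 / (12 * s) \<le> 3 * s"
      using assms(3) by (simp add: divide_simps algebra_simps)
    moreover have "u\<^sup>2 / (12 * s) \<ge> 0"
      using assms(3) by simp
    ultimately show ?thesis
      by simp
  qed
  have "2 ^ card T * (3 / 4 * s) = 2 ^ card T * s - 2 ^ card T * (3 * s\<^sup>2) / (12 * s)"
    using assms(3) by (simp add: power2_eq_square field_simps)
  also have "\<dots> \<le> (\<Sum>X\<in>Pow T. (rad T g X)\<^sup>2) - (\<Sum>X\<in>Pow T. (rad T g X) ^ 4) / (12 * s)"
    using rad_second_moment[OF assms(1), of g] rad_fourth_moment[OF assms(1), of g] assms(3)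
    by (intro diff_mono divide_right_mono) (auto simp: s_def)
  also have "\<dots> = (\<Sum>X\<in>Pow T. (rad T g X)\<^sup>2 - ((rad T g X)\<^sup>2)\<^sup>2 / (12 * s))"
    by (simp add: sum_subtractf sum_divide_distrib flip: power_mult)
  also have "\<dots> \<le> (\<Sum>X\<in>Pow T. min ((rad T g X)\<^sup>2) (3 * s))"
    by (intro sum_mono min_ge)
  finally show ?thesis .
qed

lemma sum_Pow_Un_prod:
  fixes \<phi> \<psi> :: "real \<Rightarrow> real"
  assumes "finite T" "finite U" "T \<inter> U = {}"
  shows "(\<Sum>X\<in>Pow (T \<union> U). \<phi> (rad T g X) * \<psi> (rad U g X))
    = (\<Sum>X\<in>Pow T. \<phi> (rad T g X)) * (\<Sum>X\<in>Pow U. \<psi> (rad U g X))"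
proof -
  have rT: "rad T g (X \<union> Y) = rad T g X" if "X \<subseteq> T" "Y \<subseteq> U" for X Y
    using that assms(3) unfolding rad_def by (intro sum.cong) auto
  have rU: "rad U g (X \<union> Y) = rad U g Y" if "X \<subseteq> T" "Y \<subseteq> U" for X Y
    using that assms(3) unfolding rad_def by (intro sum.cong) auto
  have "(\<Sum>(X, Y)\<in>Pow T \<times> Pow U. \<phi> (rad T g X) * \<psi> (rad U g Y))
      = (\<Sum>(X, Y)\<in>Pow T \<times> Pow U. \<phi> (rad T g (X \<union> Y)) * \<psi> (rad U g (X \<union> Y)))"
    by (intro sum.cong) (auto simp: rT rU)
  also have "\<dots> = (\<Sum>X\<in>Pow (T \<union> U). \<phi> (rad T g X) * \<psi> (rad U g X))"
  proof (rule sum.reindex_bij_witness[where j = "\<lambda>(X, Y). X \<union> Y" and i = "\<lambda>X. (X \<inter> T, X \<inter> U)"])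
    fix p assume "p \<in> Pow T \<times> Pow U"
    then obtain X Y where p: "p = (X, Y)" "X \<subseteq> T" "Y \<subseteq> U" by auto
    then have "(X \<union> Y) \<inter> T = X" "(X \<union> Y) \<inter> U = Y" using assms(3) by auto
    with p show "(case case p of (X, Y) \<Rightarrow> X \<union> Y of X \<Rightarrow> (X \<inter> T, X \<inter> U)) = p" by simp
  qed auto
  finally have "(\<Sum>X\<in>Pow (T \<union> U). \<phi> (rad T g X) * \<psi> (rad U g X))
      = (\<Sum>(X, Y)\<in>Pow T \<times> Pow U. \<phi> (rad T g X) * \<psi> (rad U g Y))" ..
  then show ?thesis
    by (simp add: sum_product sum.cartesian_product)
qed

text \<open>Independence is used through a product. After truncation at \<open>3 * s\<close> and
  \<open>3 * t\<close> with \<open>s \<le> t\<close>, the product divided by \<open>3 * t\<close> is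
  below either square, and its average factorises over the two blocks. The constant is
  \<open>3/4 * 3/4 / 3\<close>.\<close>

lemma rad_min_lower_aux:
  assumes "finite T" "finite U" "T \<inter> U = {}"
    and "(\<Sum>k\<in>T. (g k)\<^sup>2) \<le> (\<Sum>k\<in>U. (g k)\<^sup>2)"
  shows "2 ^ card (T \<union> U) * (3 / 16 * (\<Sum>k\<in>T. (g k)\<^sup>2))
    \<le> (\<Sum>X\<in>Pow (T \<union> U). min ((rad T g X)\<^sup>2) ((rad U g X)\<^sup>2))"
proof -
  define s where "s = (\<Sum>k\<in>T. (g k)\<^sup>2)"
  define t where "t = (\<Sum>k\<in>U. (g k)\<^sup>2)"
  show ?thesis
  proof (cases "s > 0")
    case False
    moreover have "s \<ge> 0" unfolding s_def by (intro sum_nonneg) auto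
    ultimately have "s = 0" by simp
    then show ?thesis
      unfolding s_def by (auto intro!: sum_nonneg)
  next
    case True
    then have "t > 0" using assms(4) by (simp add: s_def t_def)
    have st: "s \<le> t" using assms(4) by (simp add: s_def t_def)
    have pt: "min u (3 * s) * min v (3 * t) / (3 * t) \<le> min u v" if "u \<ge> 0" "v \<ge> 0" for u v
    proof -
      have "min u (3 * s) * min v (3 * t) \<le> u * (3 * t)"
        using that True \<open>t > 0\<close> by (intro mult_mono) auto
      moreover have "min u (3 * s) * min v (3 * t) \<le> (3 * t) * v"
        using that True st \<open>t > 0\<close> by (intro mult_mono) auto
      ultimately show ?thesis
        using \<open>t > 0\<close> by (simp add: divide_simps algebra_simps)
    qed
    have "2 ^ card (T \<union> U) * (3 / 16 * s) = (2 ^ card T * (3/4 * s)) * (2 ^ card U * (3/4 * t)) / (3 * t)"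
      using \<open>t > 0\<close> assms by (simp add: card_Un_disjoint power_add field_simps)
    also have "\<dots> \<le> (\<Sum>X\<in>Pow T. min ((rad T g X)\<^sup>2) (3 * s)) * (\<Sum>X\<in>Pow U. min ((rad U g X)\<^sup>2) (3 * t)) / (3 * t)"
      using rad_truncated_second_moment[OF assms(1), of g] rad_truncated_second_moment[OF assms(2), of g] True \<open>t > 0\<close>
      unfolding s_def t_def by (intro divide_right_mono mult_mono) (auto intro!: sum_nonneg)
    also have "\<dots> = (\<Sum>X\<in>Pow (T \<union> U). min ((rad T g X)\<^sup>2) (3 * s) * min ((rad U g X)\<^sup>2) (3 * t) / (3 * t))"
      using sum_Pow_Un_prod[OF assms(1-3), of "\<lambda>x. min (x\<^sup>2) (3 * s)" g "\<lambda>x. min (x\<^sup>2) (3 * t)"]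
      by (simp only: sum_divide_distrib[symmetric])
    also have "\<dots> \<le> (\<Sum>X\<in>Pow (T \<union> U). min ((rad T g X)\<^sup>2) ((rad U g X)\<^sup>2))"
      by (intro sum_mono pt) auto
    finally show ?thesis by (simp add: s_def)
  qed
qed

lemma rad_min_lower:
  assumes "finite T" "finite U" "T \<inter> U = {}"
  shows "2 ^ card (T \<union> U) * (3 / 16 * min (\<Sum>k\<in>T. (g k)\<^sup>2) (\<Sum>k\<in>U. (g k)\<^sup>2))
    \<le> (\<Sum>X\<in>Pow (T \<union> U). min ((rad T g X)\<^sup>2) ((rad U g X)\<^sup>2))"
proof (cases "(\<Sum>k\<in>T. (g k)\<^sup>2) \<le> (\<Sum>k\<in>U. (g k)\<^sup>2)")
  case True
  then show ?thesis using rad_min_lower_aux[OF assms True] by (simp add: min_absorb1)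
next
  case False
  then have "(\<Sum>k\<in>U. (g k)\<^sup>2) \<le> (\<Sum>k\<in>T. (g k)\<^sup>2)" by simp
  from rad_min_lower_aux[OF assms(2,1) _ this] assms(3) this show ?thesis
    by (simp add: min.commute Un_commute Int_commute)
qed

section \<open>One dominant coefficient for a near-linear Boolean function on the cube\<close>

lemma sum_abs_sq_le:
  fixes a b c d :: real
  shows "(\<bar>a\<bar> + \<bar>b\<bar> + \<bar>c\<bar> + \<bar>d\<bar>)\<^sup>2 \<le> 4 * (a\<^sup>2 + b\<^sup>2 + c\<^sup>2 + d\<^sup>2)"
proof -
  have "(\<bar>a\<bar> - \<bar>b\<bar>)\<^sup>2 + (\<bar>a\<bar> - \<bar>c\<bar>)\<^sup>2 + (\<bar>a\<bar> - \<bar>d\<bar>)\<^sup>2 + (\<bar>b\<bar> - \<bar>c\<bar>)\<^sup>2 + (\<bar>b\<bar> - \<bar>d\<bar>)\<^sup>2 + (\<bar>c\<bar> - \<bar>d\<bar>)\<^sup>2 \<ge> 0"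
    by (intro add_nonneg_nonneg) auto
  then have "(\<bar>a\<bar> + \<bar>b\<bar> + \<bar>c\<bar> + \<bar>d\<bar>)\<^sup>2 \<le> 4 * (\<bar>a\<bar>\<^sup>2 + \<bar>b\<bar>\<^sup>2 + \<bar>c\<bar>\<^sup>2 + \<bar>d\<bar>\<^sup>2)"
    by (simp only: power2_eq_square) (simp add: algebra_simps)
  then show ?thesis by simp
qed

text \<open>If the Boolean values do not react to the sign of one block, that block is half a
  difference of two errors. Otherwise their alternating sum is a nonzero integer, while that of the
  affine form vanishes; then the errors add up to at least 1 and absorb every bounded
  quantity.\<close>

lemma four_point_bound:
  fixes a A B f1 f2 f3 f4 :: real
  assumes "f1 \<in> {0, 1}" "f2 \<in> {0, 1}" "f3 \<in> {0, 1}" "f4 \<in> {0, 1}"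
  shows "min (A\<^sup>2) (B\<^sup>2) \<le> 9 / 4 * ((f1 - (a + A + B))\<^sup>2 + (f2 - (a + A - B))\<^sup>2
    + (f3 - (a - A + B))\<^sup>2 + (f4 - (a - A - B))\<^sup>2)"
proof -
  define e1 where "e1 = f1 - (a + A + B)"
  define e2 where "e2 = f2 - (a + A - B)"
  define e3 where "e3 = f3 - (a - A + B)"
  define e4 where "e4 = f4 - (a - A - B)"
  have sq: "((x - y) / 2)\<^sup>2 \<le> (x\<^sup>2 + y\<^sup>2) / 2" for x y :: real
    using zero_le_power2[of "x + y"] by (simp add: power2_eq_square algebra_simps)
  have nn: "e1\<^sup>2 \<ge> 0" "e2\<^sup>2 \<ge> 0" "e3\<^sup>2 \<ge> 0" "e4\<^sup>2 \<ge> 0" by auto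
  have lin: "y \<le> 9 / 4 * (e1\<^sup>2 + e2\<^sup>2 + e3\<^sup>2 + e4\<^sup>2)"
    if "y \<le> (e2\<^sup>2 + e1\<^sup>2) / 2 \<or> y \<le> (e3\<^sup>2 + e1\<^sup>2) / 2" for y
  proof -
    have "y \<le> 9 / 4 * (p + q + r + s)" if "y \<le> (q + p) / 2 \<or> y \<le> (r + p) / 2"
      "p \<ge> 0" "q \<ge> 0" "r \<ge> 0" "s \<ge> 0" for p q r s :: real
      using that by (elim disjE) simp_all
    from this[OF that nn] show ?thesis .
  qed
  consider "f1 = f2 \<and> f3 = f4" | "f1 = f3 \<and> f2 = f4" | "\<bar>f1 - f2 - f3 + f4\<bar> \<ge> 1"
    using assms by auto
  then have "min (A\<^sup>2) (B\<^sup>2) \<le> 9 / 4 * (e1\<^sup>2 + e2\<^sup>2 + e3\<^sup>2 + e4\<^sup>2)"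
  proof cases
    case 1
    then have "B = (e2 - e1) / 2" by (simp add: e1_def e2_def)
    then have "B\<^sup>2 \<le> (e2\<^sup>2 + e1\<^sup>2) / 2" using sq[of e2 e1] by (simp only:)
    moreover have "min (A\<^sup>2) (B\<^sup>2) \<le> B\<^sup>2" by simp
    ultimately show ?thesis using nn lin order_trans by blast
  next
    case 2
    then have "A = (e3 - e1) / 2" by (simp add: e1_def e3_def)
    then have "A\<^sup>2 \<le> (e3\<^sup>2 + e1\<^sup>2) / 2" using sq[of e3 e1] by (simp only:)
    moreover have "min (A\<^sup>2) (B\<^sup>2) \<le> A\<^sup>2" by simp
    ultimately show ?thesis using nn lin order_trans by blast
  next
    case 3
    define s where "s = \<bar>e1\<bar> + \<bar>e2\<bar> + \<bar>e3\<bar> + \<bar>e4\<bar>"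
    have "f1 - f2 - f3 + f4 = e1 - e2 - e3 + e4"
      by (simp add: e1_def e2_def e3_def e4_def)
    with 3 have "s \<ge> 1" unfolding s_def by linarith
    have "4 * A = f1 + f2 - f3 - f4 - (e1 + e2 - e3 - e4)"
      by (simp add: e1_def e2_def e3_def e4_def)
    moreover have "\<bar>f1 + f2 - f3 - f4\<bar> \<le> 2" using assms by auto
    moreover have "\<bar>e1 + e2 - e3 - e4\<bar> \<le> s" unfolding s_def by linarith
    \<comment> \<open>The bounded part 2 is at most \<open>2 * s\<close> because \<open>s\<close> is
      at least 1.\<close>
    ultimately have "\<bar>4 * A\<bar> \<le> 3 * s" using \<open>s \<ge> 1\<close> by linarith
    then have "(4 * A)\<^sup>2 \<le> (3 * s)\<^sup>2" by (metis power2_abs power_mono abs_ge_zero)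
    then have "16 * A\<^sup>2 \<le> 9 * s\<^sup>2" by (simp add: power_mult_distrib)
    moreover have "s\<^sup>2 \<le> 4 * (e1\<^sup>2 + e2\<^sup>2 + e3\<^sup>2 + e4\<^sup>2)"
      unfolding s_def by (rule sum_abs_sq_le)
    ultimately have "A\<^sup>2 \<le> 9 / 4 * (e1\<^sup>2 + e2\<^sup>2 + e3\<^sup>2 + e4\<^sup>2)" by linarith
    then show ?thesis by (simp add: min.coboundedI1)
  qed
  then show ?thesis by (simp add: e1_def e2_def e3_def e4_def)
qed

lemma sum_Pow_sym_diff:
  fixes h :: "'k set \<Rightarrow> real"
  assumes "T \<subseteq> S"
  shows "(\<Sum>X\<in>Pow S. h (sym_diff X T)) = (\<Sum>X\<in>Pow S. h X)"
  using assms
  by (intro sum.reindex_bij_witness[where i = "\<lambda>X. sym_diff X T" and j = "\<lambda>X. sym_diff X T"]) auto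

lemma rad_sym_diff:
  "rad T g (sym_diff X T) = - rad T g X"
  "T \<inter> U = {} \<Longrightarrow> rad T g (sym_diff X U) = rad T g X"
  by (auto simp: rad_def simp flip: sum_negf intro!: sum.cong)

lemma rad_Un:
  assumes "finite T" "finite U" "T \<inter> U = {}"
  shows "rad (T \<union> U) g X = rad T g X + rad U g X"
  using assms by (simp add: rad_def sum.union_disjoint)

text \<open>Reversing all signs of a block is a bijection of the cube, so each of the four errors in
  \<open>four_point_bound\<close> has the same total. This gives \<open>9/4 * 4 = 9\<close>, and
  \<open>9 / (3/16) = 48\<close>.\<close>

lemma cube_split:
  fixes F :: "'k set \<Rightarrow> real"
  assumes "finite T" "finite U" "T \<inter> U = {}"
    and F: "\<And>X. X \<subseteq> T \<union> U \<Longrightarrow> F X \<in> {0, 1}"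
    and err: "(\<Sum>X\<in>Pow (T \<union> U). (F X - (a + rad (T \<union> U) g X))\<^sup>2) = 2 ^ card (T \<union> U) * E"
  shows "min (\<Sum>k\<in>T. (g k)\<^sup>2) (\<Sum>k\<in>U. (g k)\<^sup>2) \<le> 48 * E"
proof -
  let ?S = "T \<union> U"
  define e where "e X = (F X - (a + rad ?S g X))\<^sup>2" for X
  have rT: "rad ?S g X = rad T g X + rad U g X" for X
    using assms by (rule_tac rad_Un)
  have pt: "min ((rad T g X)\<^sup>2) ((rad U g X)\<^sup>2)
      \<le> 9 / 4 * (e X + e (sym_diff X U) + e (sym_diff X T) + e (sym_diff (sym_diff X T) U))" if "X \<in> Pow ?S" for X
  proof -
    have "F X \<in> {0, 1}" "F (sym_diff X U) \<in> {0, 1}" "F (sym_diff X T) \<in> {0, 1}"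
      "F (sym_diff (sym_diff X T) U) \<in> {0, 1}"
      using that by (intro F; auto)+
    note b = four_point_bound[OF this, of "rad T g X" "rad U g X" a]
    have "U \<inter> T = {}" using assms(3) by auto
    with b show ?thesis
      using assms(3) by (simp add: e_def rT rad_sym_diff algebra_simps)
  qed
  have "2 ^ card ?S * (3 / 16 * min (\<Sum>k\<in>T. (g k)\<^sup>2) (\<Sum>k\<in>U. (g k)\<^sup>2))
      \<le> (\<Sum>X\<in>Pow ?S. min ((rad T g X)\<^sup>2) ((rad U g X)\<^sup>2))"
    by (rule rad_min_lower[OF assms(1-3)])
  also have "\<dots> \<le> (\<Sum>X\<in>Pow ?S. 9 / 4 * (e X + e (sym_diff X U) + e (sym_diff X T) + e (sym_diff (sym_diff X T) U)))"
    by (intro sum_mono pt)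
  also have "\<dots> = 9 * (\<Sum>X\<in>Pow ?S. e X)"
    using sum_Pow_sym_diff[of U ?S e] sum_Pow_sym_diff[of T ?S e]
      sum_Pow_sym_diff[of T ?S "\<lambda>X. e (sym_diff X U)"]
    by (subst sum_distrib_left[symmetric]) (simp add: sum.distrib)
  also have "\<dots> = 2 ^ card ?S * (9 * E)"
    using err by (simp add: e_def)
  finally show ?thesis by simp
qed

lemma nearest_dist_le:
  "\<bar>x - of_int (nearest x)\<bar> \<le> \<bar>x\<bar>" "\<bar>x - of_int (nearest x)\<bar> \<le> \<bar>x - 1\<bar>"
  "\<bar>x - of_int (nearest x)\<bar> \<le> \<bar>x + 1\<bar>"
  by (auto simp: nearest_def)

text \<open>Every cut into an initial and a final segment has a light side. At the first initial
  segment that is heavy the final segment is light, and the initial segment shorter by one is light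
  by minimality; one index remains.\<close>

lemma cube_dominant:
  fixes F :: "nat set \<Rightarrow> real"
  assumes F: "\<And>X. X \<subseteq> {..<m} \<Longrightarrow> F X \<in> {0, 1}"
    and err: "(\<Sum>X\<in>Pow {..<m}. (F X - (a + rad {..<m} g X))\<^sup>2) = 2 ^ m * E"
  obtains k0 where "(\<Sum>k\<in>{..<m} - {k0}. (g k)\<^sup>2) \<le> 96 * E"
proof -
  have E: "E \<ge> 0"
  proof -
    have "0 \<le> 2 ^ m * E" unfolding err[symmetric] by (intro sum_nonneg) auto
    then show ?thesis by (metis zero_less_power zero_less_numeral mult_le_cancel_left_pos mult_zero_right)
  qed
  define V where "V t = (\<Sum>k<t. (g k)\<^sup>2)" for t :: nat
  have V: "min (V t) (\<Sum>k\<in>{t..<m}. (g k)\<^sup>2) \<le> 48 * E" if "t \<le> m" for t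
  proof -
    have un: "{..<t} \<union> {t..<m} = {..<m}" using that by auto
    show ?thesis
      unfolding V_def using assms by (intro cube_split[where F = F and a = a]) (auto simp: un)
  qed
  show ?thesis
  proof (cases "V m \<le> 48 * E")
    case True
    \<comment> \<open>All coefficients together are light. The index \<open>m\<close> lies outside
      the range, so nothing is removed.\<close>
    have "(\<Sum>k\<in>{..<m} - {m}. (g k)\<^sup>2) \<le> 96 * E"
      using True E by (simp add: V_def)
    then show ?thesis by (rule that)
  next
    case False
    define t where "t = (LEAST t. V t > 48 * E)"
    have t: "V t > 48 * E" "t \<le> m"
      unfolding t_def using False by (auto intro: LeastI[of _ m] Least_le)
    have "t \<noteq> 0" using t(1) E by (intro notI) (simp add: V_def)
    then obtain u where u: "t = Suc u" by (cases t) auto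
    have "\<not> V u > 48 * E"
      unfolding t_def using u t_def by (intro not_less_Least) auto
    moreover have "(\<Sum>k\<in>{t..<m}. (g k)\<^sup>2) \<le> 48 * E"
      using V[OF t(2)] t(1) by (auto simp: min_def split: if_splits)
    moreover have "(\<Sum>k\<in>{..<m} - {u}. (g k)\<^sup>2) = V u + (\<Sum>k\<in>{t..<m}. (g k)\<^sup>2)"
    proof -
      have "{..<m} - {u} = {..<u} \<union> {t..<m}" using u t(2) by auto
      then have "(\<Sum>k\<in>{..<m} - {u}. (g k)\<^sup>2) = (\<Sum>k\<in>{..<u} \<union> {t..<m}. (g k)\<^sup>2)" by (rule arg_cong)
      also have "\<dots> = V u + (\<Sum>k\<in>{t..<m}. (g k)\<^sup>2)"
        unfolding V_def by (rule sum.union_disjoint) (use u in auto)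
      finally show ?thesis .
    qed
    ultimately have "(\<Sum>k\<in>{..<m} - {u}. (g k)\<^sup>2) \<le> 96 * E" by linarith
    then show ?thesis by (rule that)
  qed
qed

text \<open>This covers the dominant coefficient, which need not be small: reversing one sign moves
  the form by \<open>2 * g k\<close> up to sign, and a Boolean function by -1, 0 or 1.\<close>

lemma cube_coefficient_near_integer:
  fixes F :: "nat set \<Rightarrow> real"
  assumes F: "\<And>X. X \<subseteq> {..<m} \<Longrightarrow> F X \<in> {0, 1}"
    and err: "(\<Sum>X\<in>Pow {..<m}. (F X - (a + rad {..<m} g X))\<^sup>2) = 2 ^ m * E"
    and "k < m"
  shows "(2 * g k - of_int (nearest (2 * g k)))\<^sup>2 \<le> 4 * E"
proof -
  define e where "e X = F X - (a + rad {..<m} g X)" for X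
  define r where "r = \<bar>2 * g k - of_int (nearest (2 * g k))\<bar>"
  have pt: "r\<^sup>2 \<le> 2 * ((e X)\<^sup>2 + (e (sym_diff X {k}))\<^sup>2)" if "X \<in> Pow {..<m}" for X
  proof -
    let ?Y = "sym_diff X {k}"
    have rad: "rad {..<m} g Z = rad ({..<m} - {k}) g Z + rad {k} g Z" for Z
    proof -
      have "({..<m} - {k}) \<union> {k} = {..<m}" using assms(3) by auto
      then show ?thesis using rad_Un[of "{..<m} - {k}" "{k}" g Z] by simp
    qed
    have "rad {..<m} g X - rad {..<m} g ?Y = 2 * rad {k} g X"
      using rad_sym_diff(1)[of "{k}" g X] rad_sym_diff(2)[of "{..<m} - {k}" "{k}" g X]
      by (simp only: rad) simp
    then have "2 * rad {k} g X = (F X - F ?Y) + (e ?Y - e X)" by (simp add: e_def)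
    moreover have "rad {k} g X = g k \<or> rad {k} g X = - g k" by (simp add: rad_def)
    moreover have "F X \<in> {0, 1}" "F ?Y \<in> {0, 1}" using that assms(3) by (intro F; auto)+
    ultimately have "r \<le> \<bar>e X\<bar> + \<bar>e ?Y\<bar>"
      using nearest_dist_le[of "2 * g k"] unfolding r_def by auto
    then have "r\<^sup>2 \<le> (\<bar>e X\<bar> + \<bar>e ?Y\<bar>)\<^sup>2" by (intro power_mono) (auto simp: r_def)
    also have "\<dots> \<le> 2 * (\<bar>e X\<bar>\<^sup>2 + \<bar>e ?Y\<bar>\<^sup>2)"
      using zero_le_power2[of "\<bar>e X\<bar> - \<bar>e ?Y\<bar>"] unfolding power2_eq_square by (simp only: algebra_simps)
    finally show ?thesis by simp
  qed
  have "2 ^ m * r\<^sup>2 = (\<Sum>X\<in>Pow {..<m}. r\<^sup>2)" by (simp add: card_Pow)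
  also have "\<dots> \<le> (\<Sum>X\<in>Pow {..<m}. 2 * ((e X)\<^sup>2 + (e (sym_diff X {k}))\<^sup>2))"
    by (intro sum_mono pt)
  also have "\<dots> = 4 * (\<Sum>X\<in>Pow {..<m}. (e X)\<^sup>2)"
    using sum_Pow_sym_diff[of "{k}" "{..<m}" "\<lambda>X. (e X)\<^sup>2"] assms(3)
    by (simp add: sum.distrib flip: sum_distrib_left)
  also have "\<dots> = 2 ^ m * (4 * E)" using err by (simp add: e_def)
  finally show ?thesis by (simp add: r_def)
qed

text \<open>The last claim has no additive 1, and this is what makes two active coordinates rare:
  once there are two, at least half of the active ones differ from the dominant index. Each of those
  has \<open>(g k)\<^sup>2 \<ge> 1/16\<close>, so there are at most
  \<open>16 * 96 * E = 1536 * E\<close> of them. The common constant 3100 is twice 1536, rounded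
  up.\<close>

lemma cube_FKN:
  fixes F :: "nat set \<Rightarrow> real"
  assumes F: "\<And>X. X \<subseteq> {..<m} \<Longrightarrow> F X \<in> {0, 1}"
    and err: "(\<Sum>X\<in>Pow {..<m}. (F X - (a + rad {..<m} g X))\<^sup>2) = 2 ^ m * E"
  defines "t \<equiv> card {k \<in> {..<m}. nearest (2 * g k) \<noteq> 0}"
  shows "(\<Sum>k<m. (2 * g k - of_int (nearest (2 * g k)))\<^sup>2) \<le> 3100 * E"
    and "real t \<le> 1 + 3100 * E"
    and "t \<ge> 2 \<Longrightarrow> real t \<le> 3100 * E"
proof -
  obtain k0 where k0: "(\<Sum>k\<in>{..<m} - {k0}. (g k)\<^sup>2) \<le> 96 * E"
    using cube_dominant[OF F err] by blast
  have E: "E \<ge> 0"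
  proof -
    have "0 \<le> 2 ^ m * E" unfolding err[symmetric] by (intro sum_nonneg) auto
    then show ?thesis by (metis zero_less_power zero_less_numeral mult_le_cancel_left_pos mult_zero_right)
  qed
  let ?d = "\<lambda>k. (2 * g k - of_int (nearest (2 * g k)))\<^sup>2"
  have d: "?d k \<le> 4 * (g k)\<^sup>2" for k
  proof -
    have "\<bar>2 * g k - of_int (nearest (2 * g k))\<bar>\<^sup>2 \<le> \<bar>2 * g k\<bar>\<^sup>2"
      using nearest_dist_le(1)[of "2 * g k"] by (intro power_mono) auto
    then show ?thesis by (simp add: power_mult_distrib)
  qed
  have "(\<Sum>k\<in>{..<m} - {k0}. ?d k) \<le> (\<Sum>k\<in>{..<m} - {k0}. 4 * (g k)\<^sup>2)"
    by (intro sum_mono d)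
  also have "\<dots> \<le> 384 * E" using k0 by (simp flip: sum_distrib_left)
  finally have rest: "(\<Sum>k\<in>{..<m} - {k0}. ?d k) \<le> 384 * E" .
  have "(\<Sum>k<m. ?d k) \<le> (\<Sum>k\<in>{..<m} - {k0}. ?d k) + 4 * E"
  proof (cases "k0 < m")
    case True
    then show ?thesis
      using cube_coefficient_near_integer[OF F err True] by (subst sum.remove[of _ k0]) auto
  next
    case False
    then show ?thesis using E by simp
  qed
  with rest E show "(\<Sum>k<m. ?d k) \<le> 3100 * E" by linarith
  let ?A = "{k \<in> {..<m}. nearest (2 * g k) \<noteq> 0}"
  have sq: "(g k)\<^sup>2 \<ge> 1 / 16" if "nearest (2 * g k) \<noteq> 0" for k
  proof -
    have "\<bar>g k\<bar> \<ge> 1 / 4" using that by (auto simp: nearest_def split: if_splits)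
    then have "\<bar>g k\<bar>\<^sup>2 \<ge> (1/4)\<^sup>2" by (intro power_mono) auto
    then show ?thesis by (simp add: power2_eq_square)
  qed
  have "real (card (?A - {k0})) / 16 = (\<Sum>k\<in>?A - {k0}. 1 / 16)" by simp
  also have "\<dots> \<le> (\<Sum>k\<in>?A - {k0}. (g k)\<^sup>2)" by (intro sum_mono sq) auto
  also have "\<dots> \<le> (\<Sum>k\<in>{..<m} - {k0}. (g k)\<^sup>2)" by (intro sum_mono2) auto
  finally have c: "real (card (?A - {k0})) \<le> 1536 * E" using k0 by linarith
  have "t \<le> 1 + card (?A - {k0})"
    unfolding t_def by (cases "k0 \<in> ?A") (simp_all add: card_Diff_singleton)
  with c have t: "real t \<le> 1 + 1536 * E" by linarith
  with E show "real t \<le> 1 + 3100 * E" by linarith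
  show "real t \<le> 3100 * E" if "t \<ge> 2"
  proof -
    have "real t \<ge> 2" using that by simp
    with t E show ?thesis by linarith
  qed
qed

subsection \<open>Sums over permutations\<close>

text \<open>Extend \<open>h\<close> to one permutation \<open>\<sigma>\<close>; all solutions are
  then \<open>\<sigma> \<circ> \<rho>\<close> with \<open>\<rho>\<close> fixing \<open>A\<close>
  pointwise.\<close>

lemma card_permutes_prescribed:
  assumes "A \<subseteq> {1..n}" "inj_on h A" "h ` A \<subseteq> {1..n}"
  shows "card {\<pi> \<in> Sn n. \<forall>a\<in>A. \<pi> a = h a} = fact (n - card A)"
proof -
  have fin: "finite A" using assms(1) finite_subset by blast
  have "card ({1..n} - A) = card ({1..n} - h ` A)"
    using assms fin by (simp add: card_Diff_subset card_image)
  then obtain g where g: "bij_betw g ({1..n} - A) ({1..n} - h ` A)"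
    using finite_same_card_bij by (metis finite_Diff finite_atLeastAtMost)
  define \<sigma> where "\<sigma> i = (if i \<in> A then h i else if i \<in> {1..n} then g i else i)" for i
  have "bij_betw \<sigma> A (h ` A)"
    using assms(2) by (auto simp: bij_betw_def inj_on_def \<sigma>_def image_def)
  moreover have "bij_betw \<sigma> ({1..n} - A) ({1..n} - h ` A)"
    using g by (subst bij_betw_cong[of _ _ g]) (auto simp: \<sigma>_def)
  ultimately have "bij_betw \<sigma> (A \<union> ({1..n} - A)) (h ` A \<union> ({1..n} - h ` A))"
    by (rule bij_betw_combine) auto
  moreover have "A \<union> ({1..n} - A) = {1..n}" "h ` A \<union> ({1..n} - h ` A) = {1..n}"
    using assms by auto
  ultimately have \<sigma>: "\<sigma> permutes {1..n}"
    using assms(1) by (intro bij_imp_permutes) (auto simp: \<sigma>_def)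
  have "{\<pi> \<in> Sn n. \<forall>a\<in>A. \<pi> a = h a} = (\<circ>) \<sigma> ` {\<rho>. \<rho> permutes ({1..n} - A)}"
  proof (intro equalityI subsetI)
    fix \<pi> assume \<pi>: "\<pi> \<in> {\<pi> \<in> Sn n. \<forall>a\<in>A. \<pi> a = h a}"
    have "inv \<sigma> \<circ> \<pi> permutes {1..n}"
      using \<pi> \<sigma> by (intro permutes_compose permutes_inv) auto
    moreover have "(inv \<sigma> \<circ> \<pi>) a = a" if "a \<in> A" for a
      using \<pi> \<sigma> that by (auto simp: \<sigma>_def permutes_inverses(2) permutes_inv_eq)
    ultimately have "inv \<sigma> \<circ> \<pi> permutes ({1..n} - A)"
      by (rule permutes_superset) auto
    moreover have "\<pi> = \<sigma> \<circ> (inv \<sigma> \<circ> \<pi>)"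
      using permutes_inverses(1)[OF \<sigma>] by (auto simp: fun_eq_iff)
    ultimately show "\<pi> \<in> (\<circ>) \<sigma> ` {\<rho>. \<rho> permutes ({1..n} - A)}" by blast
  next
    fix \<pi> assume "\<pi> \<in> (\<circ>) \<sigma> ` {\<rho>. \<rho> permutes ({1..n} - A)}"
    then obtain \<rho> where \<rho>: "\<rho> permutes ({1..n} - A)" "\<pi> = \<sigma> \<circ> \<rho>" by auto
    have "\<rho> permutes {1..n}" using \<rho>(1) by (rule permutes_subset) auto
    then have "\<pi> permutes {1..n}" using \<sigma> \<rho>(2) permutes_compose by blast
    moreover have "\<pi> a = h a" if "a \<in> A" for a
      using \<rho> that by (simp add: permutes_not_in \<sigma>_def)
    ultimately show "\<pi> \<in> {\<pi> \<in> Sn n. \<forall>a\<in>A. \<pi> a = h a}" by auto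
  qed
  moreover have "inj_on ((\<circ>) \<sigma>) {\<rho>. \<rho> permutes ({1..n} - A)}"
  proof (rule inj_onI)
    fix \<rho> \<rho>' assume "\<sigma> \<circ> \<rho> = \<sigma> \<circ> \<rho>'"
    then show "\<rho> = \<rho>'" using fun.inj_map_strong[of \<rho> \<rho>' \<sigma> \<sigma>] permutes_inj[OF \<sigma>]
      by (metis comp_assoc inv_o_cancel id_o)
  qed
  ultimately have "card {\<pi> \<in> Sn n. \<forall>a\<in>A. \<pi> a = h a} = card {\<rho>. \<rho> permutes ({1..n} - A)}"
    by (simp only: card_image)
  also have "\<dots> = fact (n - card A)"
    using assms(1) fin by (intro card_permutations) (simp_all add: card_Diff_subset)
  finally show ?thesis .
qed

lemma finite_Sn [simp]: "finite (Sn n)"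
  by (rule finite_permutations) simp

lemma card_Sn [simp]: "card (Sn n) = fact n"
  by (rule card_permutations) auto

lemma Sn_nonempty [simp]: "Sn n \<noteq> {}"
  using permutes_id by blast

declare finite_Sn [unfolded One_nat_def, simp] card_Sn [unfolded One_nat_def, simp]

lemma sum_Sn_compose_right:
  assumes "\<sigma> permutes {1..n}"
  shows "(\<Sum>\<pi>\<in>Sn n. h (\<pi> \<circ> \<sigma>)) = (\<Sum>\<pi>\<in>Sn n. h \<pi>)"
  using sum_permutations_compose_right[OF assms, of h] by simp

text \<open>Injective \<open>s\<close>-tuples. For a uniform permutation and fixed distinct
  positions, the tuple of images is uniform among them, which turns averages over permutations into
  sums over tuples.\<close>

definition dlists :: "nat \<Rightarrow> nat \<Rightarrow> nat list set" where
  "dlists n s = {xs. length xs = s \<and> distinct xs \<and> set xs \<subseteq> {1..n}}"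

lemma finite_dlists [simp]: "finite (dlists n s)"
  by (rule finite_subset[OF _ finite_lists_length_eq[of "{1..n}" s]]) (auto simp: dlists_def)

lemma dlists_0 [simp]: "dlists n 0 = {[]}"
  by (auto simp: dlists_def)

lemma sum_dlists_Suc:
  fixes g :: "nat list \<Rightarrow> real"
  shows "(\<Sum>xs\<in>dlists n (Suc s). g xs)
    = (\<Sum>i\<in>{1..n}. \<Sum>xs\<in>dlists n s. if i \<in> set xs then 0 else g (i # xs))"
proof -
  have "(\<Sum>i\<in>{1..n}. \<Sum>xs\<in>dlists n s. if i \<in> set xs then 0 else g (i # xs))
      = (\<Sum>p\<in>{1..n} \<times> dlists n s. if fst p \<in> set (snd p) then 0 else g (fst p # snd p))"
    by (simp add: sum.cartesian_product case_prod_beta)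
  also have "\<dots> = (\<Sum>p\<in>{p \<in> {1..n} \<times> dlists n s. fst p \<notin> set (snd p)}. g (fst p # snd p))"
    by (rule sum.mono_neutral_cong_right) auto
  also have "\<dots> = (\<Sum>xs\<in>dlists n (Suc s). g xs)"
    by (rule sum.reindex_bij_witness[where j = "\<lambda>p. fst p # snd p" and i = "\<lambda>xs. (hd xs, tl xs)"])
       (auto simp: dlists_def length_Suc_conv)
  finally show ?thesis ..
qed

lemma sum_Sn_map:
  fixes g :: "nat list \<Rightarrow> real"
  assumes "distinct ps" "set ps \<subseteq> {1..n}"
  shows "(\<Sum>\<pi>\<in>Sn n. g (map \<pi> ps)) = fact (n - length ps) * (\<Sum>xs\<in>dlists n (length ps). g xs)"
proof -
  have "(\<Sum>\<pi>\<in>Sn n. g (map \<pi> ps))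
      = (\<Sum>xs\<in>dlists n (length ps). \<Sum>\<pi>\<in>{\<pi> \<in> Sn n. map \<pi> ps = xs}. g (map \<pi> ps))"
  proof (rule sum.group[symmetric])
    show "(\<lambda>\<pi>. map \<pi> ps) ` Sn n \<subseteq> dlists n (length ps)"
    proof (intro image_subsetI)
      fix \<pi> assume \<pi>: "\<pi> \<in> Sn n"
      then have "inj \<pi>" using permutes_inj by auto
      then have "distinct (map \<pi> ps)" using assms(1) by (simp add: distinct_map inj_on_def)
      moreover have "set (map \<pi> ps) \<subseteq> {1..n}"
        using \<pi> assms(2) permutes_in_image[of \<pi> "{1..n}"] by auto
      ultimately show "map \<pi> ps \<in> dlists n (length ps)" by (simp add: dlists_def)
    qed
  qed auto
  also have "\<dots> = (\<Sum>xs\<in>dlists n (length ps). fact (n - length ps) * g xs)"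
  proof (rule sum.cong)
    fix xs assume xs: "xs \<in> dlists n (length ps)"
    define h where "h a = the (map_of (zip ps xs) a)" for a
    have len: "length ps = length xs" using xs by (simp add: dlists_def)
    have h: "h (ps ! k) = xs ! k" if "k < length ps" for k
      using that len assms(1) map_of_zip_nth[of ps xs k] by (simp add: h_def)
    have hmap: "map h ps = xs" using h len by (intro nth_equalityI) auto
    have "{\<pi> \<in> Sn n. map \<pi> ps = xs} = {\<pi> \<in> Sn n. \<forall>a\<in>set ps. \<pi> a = h a}"
      using hmap by (auto simp flip: map_eq_conv)
    moreover have "inj_on h (set ps)"
      using xs hmap assms(1) by (metis (mono_tags, lifting) distinct_map dlists_def mem_Collect_eq)
    moreover have "h ` set ps \<subseteq> {1..n}"
      using xs hmap by (auto simp: dlists_def simp flip: set_map)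
    ultimately have "card {\<pi> \<in> Sn n. map \<pi> ps = xs} = fact (n - card (set ps))"
      using assms(2) card_permutes_prescribed by presburger
    then have "real (card {\<pi> \<in> Sn n. map \<pi> ps = xs}) = fact (n - length ps)"
      using assms(1) by (simp add: distinct_card)
    then show "(\<Sum>\<pi>\<in>{\<pi> \<in> Sn n. map \<pi> ps = xs}. g (map \<pi> ps)) = fact (n - length ps) * g xs"
      by simp
  qed simp
  finally show ?thesis by (simp add: sum_distrib_left)
qed

section \<open>Subcubes generated by disjoint transpositions\<close>

definition mixed_diff :: "(nat \<Rightarrow> nat \<Rightarrow> real) \<Rightarrow> nat \<Rightarrow> nat \<Rightarrow> nat \<Rightarrow> nat \<Rightarrow> real" where
  "mixed_diff c i i' j j' = c i j + c i' j' - c i j' - c i' j"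

lemma nearest_minus [simp]: "nearest (- x) = - nearest x"
  by (auto simp: nearest_def)

lemma nearest_0 [simp]: "nearest 0 = 0"
  by (simp add: nearest_def)

text \<open>The vertex \<open>X\<close> of the cube: the product of the transpositions of
  \<open>2 * k + 1\<close> and \<open>2 * k + 2\<close> for \<open>k \<in> X\<close>. Positions
  start at 1 and pair indices at 0, hence \<open>(i - 1) div 2\<close>.\<close>

definition pair_swap :: "nat \<Rightarrow> nat set \<Rightarrow> nat \<Rightarrow> nat" where
  "pair_swap m X i =
     (if i \<in> {1..2 * m} \<and> (i - 1) div 2 \<in> X then if odd i then i + 1 else i - 1 else i)"

lemma pair_swap_simps:
  "k < m \<Longrightarrow> pair_swap m X (2 * k + 1) = (if k \<in> X then 2 * k + 2 else 2 * k + 1)"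
  "k < m \<Longrightarrow> pair_swap m X (2 * k + 2) = (if k \<in> X then 2 * k + 1 else 2 * k + 2)"
  "i > 2 * m \<Longrightarrow> pair_swap m X i = i"
  by (auto simp: pair_swap_def)

lemma pair_swap_involution: "pair_swap m X (pair_swap m X i) = i"
proof (cases "i \<in> {1..2 * m}")
  case True
  then have "\<exists>k<m. i = 2 * k + 1 \<or> i = 2 * k + 2"
    by (intro exI[of _ "(i - 1) div 2"]) (auto; presburger)
  then obtain k where "k < m" "i = 2 * k + 1 \<or> i = 2 * k + 2" by auto
  then show ?thesis using pair_swap_simps(1,2)[of k m X] by (cases "k \<in> X") auto
next
  case False
  then show ?thesis by (auto simp: pair_swap_def)
qed

lemma pair_swap_permutes:
  assumes "2 * m \<le> n"
  shows "pair_swap m X permutes {1..n}"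
proof (rule bij_imp_permutes)
  have sub: "pair_swap m X i \<in> {1..n}" if "i \<in> {1..n}" for i
    using that assms by (auto simp: pair_swap_def; presburger)
  show "bij_betw (pair_swap m X) {1..n} {1..n}"
    by (rule bij_betw_byWitness[where f' = "pair_swap m X"])
       (use sub in \<open>auto simp: pair_swap_involution\<close>)
next
  fix i assume "i \<notin> {1..n}"
  then show "pair_swap m X i = i" using assms by (auto simp: pair_swap_def)
qed

lemma sum_pairs:
  fixes \<phi> :: "nat \<Rightarrow> real"
  shows "(\<Sum>i\<in>{1..2 * m}. \<phi> i) = (\<Sum>k<m. \<phi> (2 * k + 1) + \<phi> (2 * k + 2))"
proof (induction m)
  case (Suc m)
  have "{1..2 * Suc m} = insert (2 * m + 2) (insert (2 * m + 1) {1..2 * m})" by auto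
  then show ?case using Suc by simp
qed simp

definition pair_diff :: "(nat \<Rightarrow> nat \<Rightarrow> real) \<Rightarrow> (nat \<Rightarrow> nat) \<Rightarrow> (nat \<Rightarrow> nat) \<Rightarrow> nat \<Rightarrow> real" where
  "pair_diff c \<tau> \<pi> k = mixed_diff c (\<tau> (2 * k + 1)) (\<tau> (2 * k + 2)) (\<pi> (2 * k + 1)) (\<pi> (2 * k + 2))"

text \<open>A swap replaces the two diagonal entries of a \<open>2 x 2\<close> minor by the two
  others, so a pair contributes their mean plus or minus half the mixed difference. The minus sign
  appears because membership in \<open>X\<close> means that the swap is carried out.\<close>

lemma linear_on_cube:
  assumes "2 * m \<le> n"
  shows "\<exists>a. \<forall>X. (\<Sum>i\<in>{1..n}. c i ((\<pi> \<circ> pair_swap m X) i))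
    = a + rad {..<m} (\<lambda>k. - (pair_diff c id \<pi> k / 2)) X"
proof -
  define a where "a = (\<Sum>i\<in>{2 * m + 1..n}. c i (\<pi> i))
    + (\<Sum>k<m. (c (2 * k + 1) (\<pi> (2 * k + 1)) + c (2 * k + 2) (\<pi> (2 * k + 2))
        + c (2 * k + 1) (\<pi> (2 * k + 2)) + c (2 * k + 2) (\<pi> (2 * k + 1))) / 2)"
  have "(\<Sum>i\<in>{1..n}. c i ((\<pi> \<circ> pair_swap m X) i))
    = a + rad {..<m} (\<lambda>k. - (pair_diff c id \<pi> k / 2)) X" for X
  proof -
    let ?\<phi> = "\<lambda>i. c i ((\<pi> \<circ> pair_swap m X) i)"
    have "{1..n} = {1..2 * m} \<union> {2 * m + 1..n}" using assms by auto
    then have "(\<Sum>i\<in>{1..n}. ?\<phi> i) = (\<Sum>i\<in>{1..2 * m}. ?\<phi> i) + (\<Sum>i\<in>{2 * m + 1..n}. ?\<phi> i)"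
      by (simp only:) (rule sum.union_disjoint; auto)
    also have "(\<Sum>i\<in>{2 * m + 1..n}. ?\<phi> i) = (\<Sum>i\<in>{2 * m + 1..n}. c i (\<pi> i))"
      by (intro sum.cong) (auto simp: pair_swap_simps)
    also have "(\<Sum>i\<in>{1..2 * m}. ?\<phi> i) = (\<Sum>k<m. ?\<phi> (2 * k + 1) + ?\<phi> (2 * k + 2))"
      by (rule sum_pairs)
    also have "\<dots> = (\<Sum>k<m. (c (2 * k + 1) (\<pi> (2 * k + 1)) + c (2 * k + 2) (\<pi> (2 * k + 2))
        + c (2 * k + 1) (\<pi> (2 * k + 2)) + c (2 * k + 2) (\<pi> (2 * k + 1))) / 2
        + (if k \<in> X then - (pair_diff c id \<pi> k / 2) else - (- (pair_diff c id \<pi> k / 2))))"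
    proof (rule sum.cong)
      fix k assume "k \<in> {..<m}"
      then have "k < m" by simp
      show "?\<phi> (2 * k + 1) + ?\<phi> (2 * k + 2) =
        (c (2 * k + 1) (\<pi> (2 * k + 1)) + c (2 * k + 2) (\<pi> (2 * k + 2))
        + c (2 * k + 1) (\<pi> (2 * k + 2)) + c (2 * k + 2) (\<pi> (2 * k + 1))) / 2
        + (if k \<in> X then - (pair_diff c id \<pi> k / 2) else - (- (pair_diff c id \<pi> k / 2)))"
        unfolding comp_def pair_swap_simps(1,2)[OF \<open>k < m\<close>]
        by (simp add: pair_diff_def mixed_diff_def field_simps)
    qed simp
    finally show ?thesis by (simp add: a_def rad_def sum.distrib)
  qed
  then show ?thesis by blast
qed

text \<open>\<open>E \<pi>\<close> is the mean square error on the cube through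
  \<open>\<pi>\<close>. Right composition with a fixed permutation is a bijection of
  \<open>Sn n\<close>, so the cubes cover \<open>Sn n\<close> evenly and \<open>E\<close> has the
  same mean as the error itself.\<close>

lemma cube_average:
  fixes f :: "(nat \<Rightarrow> nat) \<Rightarrow> real"
  assumes f: "\<And>\<pi>. \<pi> \<in> Sn n \<Longrightarrow> f \<pi> \<in> {0, 1}"
    and err: "(\<Sum>\<pi>\<in>Sn n. (f \<pi> - (\<Sum>i\<in>{1..n}. c i (\<pi> i)))\<^sup>2) \<le> \<epsilon> * fact n"
    and m: "2 * m \<le> n"
  obtains E :: "(nat \<Rightarrow> nat) \<Rightarrow> real" where "(\<Sum>\<pi>\<in>Sn n. E \<pi>) \<le> \<epsilon> * fact n"
    and "\<And>\<pi>. \<pi> \<in> Sn n \<Longrightarrow>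
      (\<Sum>k<m. (pair_diff c id \<pi> k - of_int (nearest (pair_diff c id \<pi> k)))\<^sup>2) \<le> 3100 * E \<pi>"
    and "\<And>\<pi>. \<pi> \<in> Sn n \<Longrightarrow>
      (\<Sum>k<m. of_bool (nearest (pair_diff c id \<pi> k) \<noteq> 0)) \<le> 1 + 3100 * E \<pi>"
    and "\<And>\<pi>. \<pi> \<in> Sn n \<Longrightarrow> (\<Sum>k<m. of_bool (nearest (pair_diff c id \<pi> k) \<noteq> 0)) \<ge> (2 :: real) \<Longrightarrow>
      (\<Sum>k<m. of_bool (nearest (pair_diff c id \<pi> k) \<noteq> 0)) \<le> 3100 * E \<pi>"
proof -
  define e where "e \<pi> = (f \<pi> - (\<Sum>i\<in>{1..n}. c i (\<pi> i)))\<^sup>2" for \<pi>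
  define E where "E \<pi> = (\<Sum>X\<in>Pow {..<m}. e (\<pi> \<circ> pair_swap m X)) / 2 ^ m" for \<pi>
  have "(\<Sum>\<pi>\<in>Sn n. E \<pi>) = (\<Sum>X\<in>Pow {..<m}. \<Sum>\<pi>\<in>Sn n. e (\<pi> \<circ> pair_swap m X)) / 2 ^ m"
    unfolding E_def sum_divide_distrib[symmetric] by (subst sum.swap) simp
  also have "\<dots> = (\<Sum>X\<in>Pow {..<m}. \<Sum>\<pi>\<in>Sn n. e \<pi>) / 2 ^ m"
    using sum_Sn_compose_right[OF pair_swap_permutes[OF m], of e] by simp
  also have "\<dots> = (\<Sum>\<pi>\<in>Sn n. e \<pi>)" by (simp add: card_Pow)
  finally have 1: "(\<Sum>\<pi>\<in>Sn n. E \<pi>) \<le> \<epsilon> * fact n" using err by (simp add: e_def)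
  {
    fix \<pi> assume \<pi>: "\<pi> \<in> Sn n"
    obtain a where a: "\<And>X. (\<Sum>i\<in>{1..n}. c i ((\<pi> \<circ> pair_swap m X) i))
      = a + rad {..<m} (\<lambda>k. - (pair_diff c id \<pi> k / 2)) X"
      using linear_on_cube[OF m] by blast
    have F: "f (\<pi> \<circ> pair_swap m X) \<in> {0, 1}" for X
      using \<pi> pair_swap_permutes[OF m] by (intro f) (auto intro: permutes_compose)
    have "(\<Sum>X\<in>Pow {..<m}. (f (\<pi> \<circ> pair_swap m X)
        - (a + rad {..<m} (\<lambda>k. - (pair_diff c id \<pi> k / 2)) X))\<^sup>2) = 2 ^ m * E \<pi>"
      by (simp only: E_def e_def a) simp
    note cube_FKN[where F = "\<lambda>X. f (\<pi> \<circ> pair_swap m X)", OF F this]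
  } note * = this
  have sq: "(real_of_int y - x)\<^sup>2 = (x - real_of_int y)\<^sup>2" for x y
    by (rule power2_commute)
  have card: "(\<Sum>k<m. of_bool (P k)) = real (card {k \<in> {..<m}. P k})" for P
    by (simp add: of_bool_def sum.If_cases Int_def)
  show ?thesis
    using * by (intro that[OF 1]) (simp_all add: sq[of "nearest _"] card)
qed

lemma sum_Sn_relabel:
  assumes "\<tau> permutes {1..n}"
  shows "(\<Sum>i\<in>{1..n}. c (\<tau> i) (\<pi> i)) = (\<Sum>i\<in>{1..n}. c i ((\<pi> \<circ> inv \<tau>) i))"
  using sum.permute[OF assms, of "\<lambda>i. c i ((\<pi> \<circ> inv \<tau>) i)"]
  by (simp add: comp_def permutes_inverses(2)[OF assms])

text \<open>In \<open>cube_average\<close> the row pairs are the fixed pairs of consecutive numbers.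
  The relabelling \<open>\<tau>\<close> makes them arbitrary, so that a later average over
  \<open>\<tau>\<close> randomises the rows as \<open>\<pi>\<close> randomises the columns.\<close>

lemma cube_average_relabelled:
  fixes f :: "(nat \<Rightarrow> nat) \<Rightarrow> real"
  assumes f: "\<And>\<pi>. \<pi> \<in> Sn n \<Longrightarrow> f \<pi> \<in> {0, 1}"
    and err: "(\<Sum>\<pi>\<in>Sn n. (f \<pi> - (\<Sum>i\<in>{1..n}. c i (\<pi> i)))\<^sup>2) \<le> \<epsilon> * fact n"
    and m: "2 * m \<le> n" and \<tau>: "\<tau> permutes {1..n}"
  defines "t \<equiv> \<lambda>\<pi>. \<Sum>k<m. of_bool (nearest (pair_diff c \<tau> \<pi> k) \<noteq> 0) :: real"
  shows "(\<Sum>\<pi>\<in>Sn n. \<Sum>k<m. (pair_diff c \<tau> \<pi> k - of_int (nearest (pair_diff c \<tau> \<pi> k)))\<^sup>2)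
      \<le> 3100 * \<epsilon> * fact n"
    and "(\<Sum>\<pi>\<in>Sn n. t \<pi>) \<le> (1 + 3100 * \<epsilon>) * fact n"
    and "(\<Sum>\<pi>\<in>Sn n. if t \<pi> \<ge> 2 then t \<pi> else 0) \<le> 3100 * \<epsilon> * fact n"
proof -
  let ?f = "\<lambda>\<pi>. f (\<pi> \<circ> inv \<tau>)" and ?c = "\<lambda>i. c (\<tau> i)"
  have inv: "inv \<tau> permutes {1..n}" using \<tau> by (rule permutes_inv)
  have "?f \<pi> \<in> {0, 1}" if "\<pi> \<in> Sn n" for \<pi>
    using that inv by (intro f) (auto intro: permutes_compose)
  moreover have "(\<Sum>\<pi>\<in>Sn n. (?f \<pi> - (\<Sum>i\<in>{1..n}. ?c i (\<pi> i)))\<^sup>2) \<le> \<epsilon> * fact n"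
    using err sum_Sn_compose_right[OF inv, of "\<lambda>\<pi>. (f \<pi> - (\<Sum>i\<in>{1..n}. c i (\<pi> i)))\<^sup>2"]
    by (simp only: sum_Sn_relabel[OF \<tau>])
  ultimately obtain E where E: "(\<Sum>\<pi>\<in>Sn n. E \<pi>) \<le> \<epsilon> * fact n"
    and 1: "\<And>\<pi>. \<pi> \<in> Sn n \<Longrightarrow>
      (\<Sum>k<m. (pair_diff c \<tau> \<pi> k - of_int (nearest (pair_diff c \<tau> \<pi> k)))\<^sup>2) \<le> 3100 * E \<pi>"
    and 2: "\<And>\<pi>. \<pi> \<in> Sn n \<Longrightarrow> t \<pi> \<le> 1 + 3100 * E \<pi>"
    and 3: "\<And>\<pi>. \<pi> \<in> Sn n \<Longrightarrow> t \<pi> \<ge> 2 \<Longrightarrow> t \<pi> \<le> 3100 * E \<pi>"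
  proof (rule cube_average[where m = m, OF _ _ m])
  qed (auto simp: pair_diff_def mixed_diff_def t_def)
  have E0: "E \<pi> \<ge> 0" if "\<pi> \<in> Sn n" for \<pi>
    using order_trans[OF _ 1[OF that], of 0] by (simp add: sum_nonneg)
  show "(\<Sum>\<pi>\<in>Sn n. \<Sum>k<m. (pair_diff c \<tau> \<pi> k - of_int (nearest (pair_diff c \<tau> \<pi> k)))\<^sup>2)
      \<le> 3100 * \<epsilon> * fact n"
  proof -
    have "(\<Sum>\<pi>\<in>Sn n. \<Sum>k<m. (pair_diff c \<tau> \<pi> k - of_int (nearest (pair_diff c \<tau> \<pi> k)))\<^sup>2)
        \<le> (\<Sum>\<pi>\<in>Sn n. 3100 * E \<pi>)"
      by (intro sum_mono 1)
    then show ?thesis using E by (simp flip: sum_distrib_left)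
  qed
  show "(\<Sum>\<pi>\<in>Sn n. t \<pi>) \<le> (1 + 3100 * \<epsilon>) * fact n"
  proof -
    have "(\<Sum>\<pi>\<in>Sn n. t \<pi>) \<le> (\<Sum>\<pi>\<in>Sn n. 1 + 3100 * E \<pi>)"
      by (intro sum_mono 2)
    also have "\<dots> = fact n + 3100 * (\<Sum>\<pi>\<in>Sn n. E \<pi>)"
      by (simp add: sum.distrib sum_distrib_left)
    finally show ?thesis using E by (simp add: algebra_simps)
  qed
  have "(\<Sum>\<pi>\<in>Sn n. if t \<pi> \<ge> 2 then t \<pi> else 0) \<le> (\<Sum>\<pi>\<in>Sn n. 3100 * E \<pi>)"
    using 3 E0 by (intro sum_mono) auto
  then show "(\<Sum>\<pi>\<in>Sn n. if t \<pi> \<ge> 2 then t \<pi> else 0) \<le> 3100 * \<epsilon> * fact n"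
    using E by (simp flip: sum_distrib_left)
qed

subsection \<open>Active rectangles\<close>

abbreviation (input) grid :: "nat \<Rightarrow> (nat \<times> nat) set" where
  "grid n \<equiv> {1..n} \<times> {1..n}"

definition apart :: "nat \<times> nat \<Rightarrow> nat \<times> nat \<Rightarrow> bool" where
  "apart p q \<longleftrightarrow> distinct [fst p, snd p, fst q, snd q]"

text \<open>Rows are listed in \<open>p\<close> and columns in \<open>q\<close>. A rectangle with a
  repeated row or column has mixed difference 0 and is never active, which lets sums run over the
  whole grid.\<close>

definition act :: "(nat \<Rightarrow> nat \<Rightarrow> real) \<Rightarrow> nat \<times> nat \<Rightarrow> nat \<times> nat \<Rightarrow> real" where
  "act c p q = of_bool (nearest (mixed_diff c (fst p) (snd p) (fst q) (snd q)) \<noteq> 0)"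

definition pair_at :: "(nat \<Rightarrow> nat) \<Rightarrow> nat \<Rightarrow> nat \<times> nat" where
  "pair_at \<pi> k = (\<pi> (2 * k + 1), \<pi> (2 * k + 2))"

lemma of_bool_nonneg: "0 \<le> (of_bool b :: real)"
  by simp

lemma sum_over_pairs:
  fixes \<phi> :: "nat \<times> nat \<Rightarrow> real"
  shows "(\<Sum>p\<in>A \<times> B. \<phi> p) = (\<Sum>i\<in>A. \<Sum>j\<in>B. \<phi> (i, j))"
  by (simp add: sum.cartesian_product)

lemma sum_Sn_one_pair:
  fixes h :: "nat \<times> nat \<Rightarrow> real"
  assumes "k < m" "2 * m \<le> n"
  shows "(\<Sum>\<pi>\<in>Sn n. h (pair_at \<pi> k))
    = fact (n - 2) * (\<Sum>p\<in>grid n. if fst p = snd p then 0 else h p)"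
proof -
  have "(\<Sum>\<pi>\<in>Sn n. h (pair_at \<pi> k)) = (\<Sum>\<pi>\<in>Sn n. (\<lambda>xs. h (xs ! 0, xs ! 1)) (map \<pi> [2 * k + 1, 2 * k + 2]))"
    by (simp add: pair_at_def)
  also have "\<dots> = fact (n - 2) * (\<Sum>xs\<in>dlists n (Suc (Suc 0)). h (xs ! 0, xs ! 1))"
    using sum_Sn_map[of "[2 * k + 1, 2 * k + 2]" n "\<lambda>xs. h (xs ! 0, xs ! 1)"] assms
    by (simp add: numeral_2_eq_2)
  also have "(\<Sum>xs\<in>dlists n (Suc (Suc 0)). h (xs ! 0, xs ! 1))
      = (\<Sum>i\<in>{1..n}. \<Sum>j\<in>{1..n}. if i = j then 0 else h (i, j))"
    by (simp only: sum_dlists_Suc) (auto intro!: sum.cong)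
  finally show ?thesis
    by (simp only: sum_over_pairs fst_conv snd_conv)
qed

lemma sum_Sn_two_pairs:
  fixes h :: "nat \<times> nat \<Rightarrow> nat \<times> nat \<Rightarrow> real"
  assumes "k < m" "l < m" "k \<noteq> l" "2 * m \<le> n"
  shows "(\<Sum>\<pi>\<in>Sn n. h (pair_at \<pi> k) (pair_at \<pi> l))
    = fact (n - 4) * (\<Sum>p\<in>grid n. \<Sum>q\<in>grid n. if apart p q then h p q else 0)"
proof -
  let ?g = "\<lambda>xs. h (xs ! 0, xs ! 1) (xs ! 2, xs ! 3)"
  have "(\<Sum>\<pi>\<in>Sn n. h (pair_at \<pi> k) (pair_at \<pi> l))
      = (\<Sum>\<pi>\<in>Sn n. ?g (map \<pi> [2 * k + 1, 2 * k + 2, 2 * l + 1, 2 * l + 2]))"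
    by (simp add: pair_at_def)
  also have "\<dots> = fact (n - 4) * (\<Sum>xs\<in>dlists n (Suc (Suc (Suc (Suc 0)))). ?g xs)"
  proof -
    have "distinct [2 * k + 1, 2 * k + 2, 2 * l + 1, 2 * l + 2]"
      using assms(3) by (simp; presburger)
    moreover have "set [2 * k + 1, 2 * k + 2, 2 * l + 1, 2 * l + 2] \<subseteq> {1..n}"
      using assms by auto
    ultimately have "(\<Sum>\<pi>\<in>Sn n. ?g (map \<pi> [2 * k + 1, 2 * k + 2, 2 * l + 1, 2 * l + 2]))
      = fact (n - length [2 * k + 1, 2 * k + 2, 2 * l + 1, 2 * l + 2])
        * (\<Sum>xs\<in>dlists n (length [2 * k + 1, 2 * k + 2, 2 * l + 1, 2 * l + 2]). ?g xs)"
      by (rule sum_Sn_map)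
    moreover have "length [2 * k + 1, 2 * k + 2, 2 * l + 1, 2 * l + 2] = Suc (Suc (Suc (Suc 0)))"
      "fact (n - Suc (Suc (Suc (Suc 0)))) = (fact (n - 4) :: real)"
      by (simp_all add: numeral_eq_Suc)
    ultimately show ?thesis by presburger
  qed
  also have "(\<Sum>xs\<in>dlists n (Suc (Suc (Suc (Suc 0)))). ?g xs)
      = (\<Sum>i\<in>{1..n}. \<Sum>j\<in>{1..n}. \<Sum>i'\<in>{1..n}. \<Sum>j'\<in>{1..n}.
          if distinct [i, j, i', j'] then h (i, j) (i', j') else 0)"
    by (simp only: sum_dlists_Suc)
       (auto intro!: sum.cong simp: numeral_eq_Suc if_distrib[of "sum _"] cong: if_cong)
  finally show ?thesis
    by (simp only: sum_over_pairs fst_conv snd_conv apart_def)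
qed

lemma sum_dlists_Suc_le:
  fixes g :: "nat list \<Rightarrow> real"
  assumes "\<And>xs. g xs \<ge> 0"
  shows "(\<Sum>xs\<in>dlists n (Suc s). g xs) \<le> (\<Sum>i\<in>{1..n}. \<Sum>xs\<in>dlists n s. g (i # xs))"
  unfolding sum_dlists_Suc using assms by (intro sum_mono) auto

lemma sum_dlists_Suc_Suc_le:
  fixes g :: "nat list \<Rightarrow> real"
  assumes "\<And>xs. g xs \<ge> 0"
  shows "(\<Sum>xs\<in>dlists n (Suc (Suc s)). g xs)
    \<le> (\<Sum>p\<in>grid n. \<Sum>xs\<in>dlists n s. g (fst p # snd p # xs))"
proof -
  have "(\<Sum>xs\<in>dlists n (Suc (Suc s)). g xs)
      \<le> (\<Sum>i\<in>{1..n}. \<Sum>xs\<in>dlists n (Suc s). g (i # xs))"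
    using assms by (rule sum_dlists_Suc_le)
  also have "\<dots> \<le> (\<Sum>i\<in>{1..n}. \<Sum>j\<in>{1..n}. \<Sum>xs\<in>dlists n s. g (i # j # xs))"
    using assms by (intro sum_mono sum_dlists_Suc_le)
  finally show ?thesis
    by (simp only: sum_over_pairs fst_conv snd_conv)
qed

text \<open>Forgetting that the six entries are distinct only increases a nonnegative sum, and the
  full sum over three grids factorises when \<open>h\<close> is a product.\<close>

lemma sum_Sn_three_pairs_le:
  fixes h :: "nat \<times> nat \<Rightarrow> nat \<times> nat \<Rightarrow> nat \<times> nat \<Rightarrow> real"
  assumes "k < m" "l < m" "q < m" "k \<noteq> l" "k \<noteq> q" "l \<noteq> q" "2 * m \<le> n"
    and h: "\<And>x y z. h x y z \<ge> 0"
  shows "(\<Sum>\<pi>\<in>Sn n. h (pair_at \<pi> k) (pair_at \<pi> l) (pair_at \<pi> q))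
    \<le> fact (n - 6) * (\<Sum>x\<in>grid n. \<Sum>y\<in>grid n. \<Sum>z\<in>grid n. h x y z)"
proof -
  let ?g = "\<lambda>xs. h (xs ! 0, xs ! 1) (xs ! 2, xs ! 3) (xs ! 4, xs ! 5)"
  let ?ps = "[2 * k + 1, 2 * k + 2, 2 * l + 1, 2 * l + 2, 2 * q + 1, 2 * q + 2]"
  have "distinct ?ps"
    using assms(4-6) by (simp; presburger)
  moreover have "set ?ps \<subseteq> {1..n}"
    using assms(1-3,7) by auto
  ultimately have "(\<Sum>\<pi>\<in>Sn n. ?g (map \<pi> ?ps))
      = fact (n - length ?ps) * (\<Sum>xs\<in>dlists n (length ?ps). ?g xs)"
    by (rule sum_Sn_map)
  moreover have "length ?ps = Suc (Suc (Suc (Suc (Suc (Suc 0)))))"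
    "fact (n - Suc (Suc (Suc (Suc (Suc (Suc 0)))))) = (fact (n - 6) :: real)"
    by (simp_all add: numeral_eq_Suc)
  ultimately have eq: "(\<Sum>\<pi>\<in>Sn n. ?g (map \<pi> ?ps))
      = fact (n - 6) * (\<Sum>xs\<in>dlists n (Suc (Suc (Suc (Suc (Suc (Suc 0)))))). ?g xs)"
    by presburger
  have "(\<Sum>xs\<in>dlists n (Suc (Suc (Suc (Suc (Suc (Suc 0)))))). ?g xs)
      \<le> (\<Sum>x\<in>grid n. \<Sum>xs\<in>dlists n (Suc (Suc (Suc (Suc 0)))). ?g (fst x # snd x # xs))"
    using h by (intro sum_dlists_Suc_Suc_le) auto
  also have "\<dots> \<le> (\<Sum>x\<in>grid n. \<Sum>y\<in>grid n.
      \<Sum>xs\<in>dlists n (Suc (Suc 0)). ?g (fst x # snd x # fst y # snd y # xs))"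
    using h by (intro sum_mono sum_dlists_Suc_Suc_le) auto
  also have "\<dots> \<le> (\<Sum>x\<in>grid n. \<Sum>y\<in>grid n. \<Sum>z\<in>grid n.
      \<Sum>xs\<in>dlists n 0. ?g (fst x # snd x # fst y # snd y # fst z # snd z # xs))"
    using h by (intro sum_mono sum_dlists_Suc_Suc_le) auto
  also have "\<dots> = (\<Sum>x\<in>grid n. \<Sum>y\<in>grid n. \<Sum>z\<in>grid n. h x y z)"
    by (simp add: numeral_eq_Suc)
  finally have "(\<Sum>\<pi>\<in>Sn n. ?g (map \<pi> ?ps))
      \<le> fact (n - 6) * (\<Sum>x\<in>grid n. \<Sum>y\<in>grid n. \<Sum>z\<in>grid n. h x y z)"
    unfolding eq by (intro mult_left_mono) auto
  then show ?thesis by (simp add: pair_at_def)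
qed

lemma act_cases: "act c p q = 0 \<or> act c p q = 1"
  by (simp add: act_def)

lemma act_nonneg [simp]: "act c p q \<ge> 0" and act_le_1 [simp]: "act c p q \<le> 1"
  using act_cases[of c p q] by auto

lemma act_degenerate [simp]:
  "fst p = snd p \<Longrightarrow> act c p q = 0" "fst q = snd q \<Longrightarrow> act c p q = 0"
  by (simp_all add: act_def mixed_diff_def)

lemma act_swap: "act c (prod.swap p) q = act c p q" "act c p (prod.swap q) = act c p q"
proof -
  have "mixed_diff c (snd p) (fst p) (fst q) (snd q) = - mixed_diff c (fst p) (snd p) (fst q) (snd q)"
    "mixed_diff c (fst p) (snd p) (snd q) (fst q) = - mixed_diff c (fst p) (snd p) (fst q) (snd q)"
    by (simp_all add: mixed_diff_def)
  then show "act c (prod.swap p) q = act c p q" "act c p (prod.swap q) = act c p q"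
    by (simp_all add: act_def)
qed

lemma act_transpose: "act (\<lambda>i j. c j i) p q = act c q p"
  by (simp add: act_def mixed_diff_def algebra_simps)

definition total_act :: "nat \<Rightarrow> (nat \<Rightarrow> nat \<Rightarrow> real) \<Rightarrow> real" where
  "total_act n c = (\<Sum>p\<in>grid n. \<Sum>q\<in>grid n. act c p q)"

text \<open>By the symmetry of \<open>act\<close> under exchanging the two rows, this is half of the
  activity that involves row \<open>r\<close>. Columns are treated by applying it to the transposed
  matrix.\<close>

definition row_act :: "nat \<Rightarrow> (nat \<Rightarrow> nat \<Rightarrow> real) \<Rightarrow> nat \<Rightarrow> real" where
  "row_act n c r = (\<Sum>p\<in>grid n. \<Sum>q\<in>grid n. of_bool (fst p = r) * act c p q)"

text \<open>Weight 1 serves the search for an influential line; the weight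
  \<open>of_bool (fst p = r)\<close> serves the estimate of what happens away from a row already
  found.\<close>

definition apart_act :: "nat \<Rightarrow> (nat \<Rightarrow> nat \<Rightarrow> real) \<Rightarrow> (nat \<times> nat \<Rightarrow> real) \<Rightarrow> real" where
  "apart_act n c w = (\<Sum>p\<in>grid n. \<Sum>p'\<in>grid n. \<Sum>q\<in>grid n. \<Sum>q'\<in>grid n.
     if apart p p' \<and> apart q q' then w p * act c p q * act c p' q' else 0)"

lemma row_act_snd: "row_act n c r = (\<Sum>p\<in>grid n. \<Sum>q\<in>grid n. of_bool (snd p = r) * act c p q)"
  unfolding row_act_def
  by (rule sum.reindex_bij_witness[where i = prod.swap and j = prod.swap]) (auto simp: act_swap)

lemma col_act:
  "row_act n (\<lambda>i j. c j i) s = (\<Sum>p\<in>grid n. \<Sum>q\<in>grid n. of_bool (fst q = s) * act c p q)"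
  "row_act n (\<lambda>i j. c j i) s = (\<Sum>p\<in>grid n. \<Sum>q\<in>grid n. of_bool (snd q = s) * act c p q)"
proof -
  show "row_act n (\<lambda>i j. c j i) s = (\<Sum>p\<in>grid n. \<Sum>q\<in>grid n. of_bool (fst q = s) * act c p q)"
    unfolding row_act_def act_transpose[of c] by (rule sum.swap)
  show "row_act n (\<lambda>i j. c j i) s = (\<Sum>p\<in>grid n. \<Sum>q\<in>grid n. of_bool (snd q = s) * act c p q)"
    unfolding row_act_snd act_transpose[of c] by (rule sum.swap)
qed

lemma one_le_of_bool_sum:
  assumes "a1 \<or> a2 \<or> a3 \<or> a4 \<or> a5 \<or> a6 \<or> a7 \<or> a8"
  shows "(1 :: real) \<le> of_bool a1 + of_bool a2 + of_bool a3 + of_bool a4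
    + of_bool a5 + of_bool a6 + of_bool a7 + of_bool a8"
proof -
  have "1 \<le> x1 + x2 + x3 + x4 + x5 + x6 + x7 + x8"
    if "x1 = 1 \<or> x2 = 1 \<or> x3 = 1 \<or> x4 = 1 \<or> x5 = 1 \<or> x6 = 1 \<or> x7 = 1 \<or> x8 = 1"
      "0 \<le> x1" "0 \<le> x2" "0 \<le> x3" "0 \<le> x4" "0 \<le> x5" "0 \<le> x6" "0 \<le> x7" "0 \<le> x8"
    for x1 x2 x3 x4 x5 x6 x7 x8 :: real
    using that by (elim disjE) linarith+
  from this[OF _ of_bool_nonneg of_bool_nonneg of_bool_nonneg of_bool_nonneg
      of_bool_nonneg of_bool_nonneg of_bool_nonneg of_bool_nonneg]
  show ?thesis using assms unfolding of_bool_eq_1_iff by this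
qed

lemma one_le_if_add: "0 \<le> s \<Longrightarrow> (\<not> A \<Longrightarrow> 1 \<le> s) \<Longrightarrow> 1 \<le> (if A then 1 else 0) + (s :: real)"
  by simp

text \<open>The factor 8 counts the ways in which two rectangles can share a row or a column.\<close>
lemma total_act_sq_le:
  assumes row: "\<And>r. r \<in> {1..n} \<Longrightarrow> row_act n c r \<le> \<rho>"
    and col: "\<And>s. s \<in> {1..n} \<Longrightarrow> row_act n (\<lambda>i j. c j i) s \<le> \<rho>"
  shows "(total_act n c)\<^sup>2 \<le> apart_act n c (\<lambda>_. 1) + 8 * \<rho> * total_act n c"
proof -
  define V where "V p q = (\<Sum>p'\<in>grid n. \<Sum>q'\<in>grid n.
     if apart p p' \<and> apart q q' then act c p' q' else 0)" for p q
  have *: "act c p q * total_act n c \<le> act c p q * (V p q + 8 * \<rho>)"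
    if pq: "p \<in> grid n" "q \<in> grid n" for p q
  proof (cases "act c p q = 0")
    case False
    then have ne: "fst p \<noteq> snd p" "fst q \<noteq> snd q" using act_degenerate by blast+
    let ?t = "\<lambda>p' q'. of_bool (fst p' = fst p) * act c p' q' + of_bool (snd p' = fst p) * act c p' q'
      + of_bool (fst p' = snd p) * act c p' q' + of_bool (snd p' = snd p) * act c p' q'
      + of_bool (fst q' = fst q) * act c p' q' + of_bool (snd q' = fst q) * act c p' q'
      + of_bool (fst q' = snd q) * act c p' q' + of_bool (snd q' = snd q) * act c p' q'"
    have pt: "act c p' q' \<le> (if apart p p' \<and> apart q q' then act c p' q' else 0)
      + ?t p' q'" for p' q'
    proof (cases "act c p' q' = 0")
      case False
      then have one: "act c p' q' = 1" using act_cases by blast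
      have ne': "fst p' \<noteq> snd p'" "fst q' \<noteq> snd q'" using False act_degenerate by blast+
      let ?o = "of_bool (fst p' = fst p) + of_bool (snd p' = fst p)
          + of_bool (fst p' = snd p) + of_bool (snd p' = snd p)
          + of_bool (fst q' = fst q) + of_bool (snd q' = fst q)
          + of_bool (fst q' = snd q) + of_bool (snd q' = snd q) :: real"
      have nn: "0 \<le> ?o"
        by (intro add_nonneg_nonneg of_bool_nonneg)
      have ge: "1 \<le> ?o" if "\<not> (apart p p' \<and> apart q q')"
        using that ne ne' by (intro one_le_of_bool_sum) (simp add: apart_def; argo)
      show ?thesis
        unfolding one mult_1_right using nn ge by (rule one_le_if_add)
    qed simp
    let ?r = "row_act n c (fst p) + row_act n c (fst p) + row_act n c (snd p) + row_act n c (snd p)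
      + row_act n (\<lambda>i j. c j i) (fst q) + row_act n (\<lambda>i j. c j i) (fst q)
      + row_act n (\<lambda>i j. c j i) (snd q) + row_act n (\<lambda>i j. c j i) (snd q)"
    have "total_act n c \<le> V p q + ?r"
    proof -
      have "total_act n c \<le> (\<Sum>p'\<in>grid n. \<Sum>q'\<in>grid n.
        (if apart p p' \<and> apart q q' then act c p' q' else 0)
        + ?t p' q')"
        unfolding total_act_def by (intro sum_mono pt)
      also have "\<dots> = V p q
        + ?r"
        unfolding sum.distrib V_def
        by (simp only: row_act_def[of n c, symmetric] row_act_snd[of n c, symmetric] col_act[symmetric])
      finally show ?thesis .
    qed
    also have "\<dots> \<le> V p q + 8 * \<rho>"
      using row[of "fst p"] row[of "snd p"] col[of "fst q"] col[of "snd q"] pq by auto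
    finally show ?thesis by (intro mult_left_mono) auto
  qed simp
  have "(total_act n c)\<^sup>2 = (\<Sum>p\<in>grid n. \<Sum>q\<in>grid n. act c p q * total_act n c)"
    by (simp only: power2_eq_square sum_distrib_right[symmetric] total_act_def[symmetric])
  also have "\<dots> \<le> (\<Sum>p\<in>grid n. \<Sum>q\<in>grid n. act c p q * (V p q + 8 * \<rho>))"
    by (intro sum_mono *)
  also have "\<dots> = (\<Sum>p\<in>grid n. \<Sum>q\<in>grid n. act c p q * V p q) + 8 * \<rho> * total_act n c"
    by (simp only: distrib_left sum.distrib sum_distrib_right[symmetric] total_act_def[symmetric]) simp
  also have "(\<Sum>p\<in>grid n. \<Sum>q\<in>grid n. act c p q * V p q) = apart_act n c (\<lambda>_. 1)"
  proof -
    have "(\<Sum>p\<in>grid n. \<Sum>q\<in>grid n. act c p q * V p q)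
      = (\<Sum>p\<in>grid n. \<Sum>q\<in>grid n. \<Sum>p'\<in>grid n. \<Sum>q'\<in>grid n.
          if apart p p' \<and> apart q q' then 1 * act c p q * act c p' q' else 0)"
      unfolding V_def sum_distrib_left by (intro sum.cong) auto
    also have "\<dots> = apart_act n c (\<lambda>_. 1)"
      unfolding apart_act_def by (rule sum.cong[OF refl], rule sum.swap)
    finally show ?thesis .
  qed
  finally show ?thesis by simp
qed

definition outside_act :: "nat \<Rightarrow> (nat \<Rightarrow> nat \<Rightarrow> real) \<Rightarrow> nat \<Rightarrow> real" where
  "outside_act n c r = (\<Sum>p\<in>grid n. \<Sum>q\<in>grid n.
     of_bool (fst p \<noteq> r \<and> snd p \<noteq> r) * act c p q)"

lemma sum_of_bool_eq_le:
  assumes "finite S"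
  shows "(\<Sum>x\<in>S. of_bool (x = a) :: real) \<le> 1"
  using assms by (simp add: of_bool_def)

text \<open>An active rectangle avoiding row \<open>r\<close> is apart from an active one with first
  row \<open>r\<close> unless the second row of the latter or one of its columns is taken. Each of
  the two row coincidences leaves \<open>n\<^sup>2\<close> choices of columns; each of the four
  column coincidences leaves \<open>n\<close> second rows and \<open>n\<close> choices of the other
  column. This explains \<open>6 * n\<^sup>2\<close>.\<close>

lemma outside_act_le:
  assumes r: "r \<in> {1..n}"
  shows "outside_act n c r * (row_act n c r - 6 * (real n)\<^sup>2) \<le> apart_act n c (\<lambda>p. of_bool (fst p = r))"
proof -
  define V where "V p' q' = (\<Sum>p\<in>grid n. \<Sum>q\<in>grid n.
     if apart p p' \<and> apart q q' then of_bool (fst p = r) * act c p q else 0)" for p' q'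
  have V0: "V p' q' \<ge> 0" for p' q'
    unfolding V_def by (intro sum_nonneg) auto
  have *: "(of_bool (fst p' \<noteq> r \<and> snd p' \<noteq> r) * act c p' q') * (row_act n c r - 6 * (real n)\<^sup>2)
      \<le> act c p' q' * V p' q'" if "p' \<in> grid n" "q' \<in> grid n" for p' q'
  proof (cases "act c p' q' = 0 \<or> fst p' = r \<or> snd p' = r")
    case True
    then show ?thesis using V0 by auto
  next
    case False
    then have one: "act c p' q' = 1" using act_cases by blast
    have ne: "fst p' \<noteq> snd p'" "fst q' \<noteq> snd q'" using False act_degenerate by blast+
    let ?b = "\<lambda>p q. (of_bool (p = (r, fst p')) + of_bool (p = (r, snd p'))
      + of_bool (fst p = r) * of_bool (fst q = fst q') + of_bool (fst p = r) * of_bool (fst q = snd q')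
      + of_bool (fst p = r) * of_bool (snd q = fst q') + of_bool (fst p = r) * of_bool (snd q = snd q')) :: real"
    have pt: "of_bool (fst p = r) * act c p q
      \<le> (if apart p p' \<and> apart q q' then of_bool (fst p = r) * act c p q else 0) + ?b p q" for p q
    proof (cases "act c p q = 0 \<or> fst p \<noteq> r")
      case True
      then have "of_bool (fst p = r) * act c p q = 0" by auto
      moreover have "0 \<le> ?b p q"
        by (intro add_nonneg_nonneg mult_nonneg_nonneg of_bool_nonneg)
      ultimately show ?thesis by (simp only: if_cancel add_0_left)
    next
      case F: False
      then have one': "act c p q = 1" using act_cases by blast
      have ne': "fst p \<noteq> snd p" "fst q \<noteq> snd q" using F act_degenerate by blast+
      have ge: "1 \<le> (of_bool (p = (r, fst p')) + of_bool (p = (r, snd p'))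
        + of_bool (fst q = fst q') + of_bool (fst q = snd q')
        + of_bool (snd q = fst q') + of_bool (snd q = snd q') + of_bool False + of_bool False :: real)"
        if "\<not> (apart p p' \<and> apart q q')"
        using that ne False F ne'
        by (intro one_le_of_bool_sum) (simp add: apart_def prod_eq_iff; argo)
      have r1: "of_bool (fst p = r) = (1 :: real)" using F by simp
      have nn: "0 \<le> (of_bool (p = (r, fst p')) + of_bool (p = (r, snd p'))
        + of_bool (fst q = fst q') + of_bool (fst q = snd q')
        + of_bool (snd q = fst q') + of_bool (snd q = snd q') :: real)"
        by (intro add_nonneg_nonneg of_bool_nonneg)
      show ?thesis
        unfolding one' r1 mult_1_right mult_1_left
        using nn ge unfolding of_bool_eq add_0_right by (rule one_le_if_add)
    qed
    have eq1: "(\<Sum>p\<in>grid n. \<Sum>q\<in>grid n. of_bool (p = a) :: real) \<le> (real n)\<^sup>2" for a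
    proof -
      have "(\<Sum>p\<in>grid n. \<Sum>q\<in>grid n. of_bool (p = a) :: real)
        = (\<Sum>p\<in>grid n. of_bool (p = a)) * (real n)\<^sup>2"
        by (simp add: sum_distrib_right power2_eq_square mult.commute)
      also have "\<dots> \<le> 1 * (real n)\<^sup>2" by (intro mult_right_mono sum_of_bool_eq_le) auto
      finally show ?thesis by simp
    qed
    have half: "(\<Sum>p\<in>grid n. of_bool (fst p = a) :: real) \<le> real n"
      "(\<Sum>p\<in>grid n. of_bool (snd p = a) :: real) \<le> real n" for a
    proof -
      have "(\<Sum>p\<in>grid n. of_bool (fst p = a) :: real)
        = (\<Sum>i\<in>{1..n}. \<Sum>j\<in>{1..n}. of_bool (i = a))"
        by (simp only: sum_over_pairs fst_conv)
      also have "\<dots> = (\<Sum>i\<in>{1..n}. of_bool (i = a)) * real n"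
        by (simp add: sum_distrib_right mult.commute)
      also have "\<dots> \<le> 1 * real n" by (intro mult_right_mono sum_of_bool_eq_le) auto
      finally show 1: "(\<Sum>p\<in>grid n. of_bool (fst p = a) :: real) \<le> real n" by simp
      have "(\<Sum>p\<in>grid n. of_bool (snd p = a) :: real) = (\<Sum>p\<in>grid n. of_bool (fst p = a))"
        by (rule sum.reindex_bij_witness[where i = prod.swap and j = prod.swap]) auto
      with 1 show "(\<Sum>p\<in>grid n. of_bool (snd p = a) :: real) \<le> real n" by simp
    qed
    have eq2: "(\<Sum>p\<in>grid n. \<Sum>q\<in>grid n. of_bool (fst p = r) * of_bool (fst q = a) :: real) \<le> (real n)\<^sup>2"
      "(\<Sum>p\<in>grid n. \<Sum>q\<in>grid n. of_bool (fst p = r) * of_bool (snd q = a) :: real) \<le> (real n)\<^sup>2" for a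
      unfolding sum_product[symmetric] power2_eq_square
      by (intro mult_mono half; simp add: sum_nonneg)+
    have "row_act n c r \<le> (\<Sum>p\<in>grid n. \<Sum>q\<in>grid n.
        (if apart p p' \<and> apart q q' then of_bool (fst p = r) * act c p q else 0) + ?b p q)"
      unfolding row_act_def by (intro sum_mono pt)
    also have "\<dots> \<le> V p' q' + ((real n)\<^sup>2 + (real n)\<^sup>2 + (real n)\<^sup>2 + (real n)\<^sup>2 + (real n)\<^sup>2 + (real n)\<^sup>2)"
      unfolding V_def sum.distrib by (intro add_mono order_refl eq1 eq2)
    finally show ?thesis using False one by simp
  qed
  have "outside_act n c r * (row_act n c r - 6 * (real n)\<^sup>2)
    = (\<Sum>p'\<in>grid n. \<Sum>q'\<in>grid n.
      (of_bool (fst p' \<noteq> r \<and> snd p' \<noteq> r) * act c p' q') * (row_act n c r - 6 * (real n)\<^sup>2))"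
    by (simp only: outside_act_def sum_distrib_right)
  also have "\<dots> \<le> (\<Sum>p'\<in>grid n. \<Sum>q'\<in>grid n. act c p' q' * V p' q')"
    by (intro sum_mono *)
  also have "\<dots> = (\<Sum>p'\<in>grid n. \<Sum>q'\<in>grid n. \<Sum>p\<in>grid n. \<Sum>q\<in>grid n.
     if apart p p' \<and> apart q q' then of_bool (fst p = r) * act c p q * act c p' q' else 0)"
    unfolding V_def sum_distrib_left by (intro sum.cong) auto
  also have "\<dots> = (\<Sum>p'\<in>grid n. \<Sum>p\<in>grid n. \<Sum>q\<in>grid n. \<Sum>q'\<in>grid n.
     if apart p p' \<and> apart q q' then of_bool (fst p = r) * act c p q * act c p' q' else 0)"
    by (rule sum.cong[OF refl], subst sum.swap, rule sum.cong[OF refl], rule sum.swap)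
  also have "\<dots> = apart_act n c (\<lambda>p. of_bool (fst p = r))"
    unfolding apart_act_def by (rule sum.swap)
  finally show ?thesis .
qed

subsection \<open>Averaging over random subcubes\<close>

definition rerr :: "(nat \<Rightarrow> nat \<Rightarrow> real) \<Rightarrow> nat \<times> nat \<Rightarrow> nat \<times> nat \<Rightarrow> real" where
  "rerr c p q = (let x = mixed_diff c (fst p) (snd p) (fst q) (snd q) in (x - of_int (nearest x))\<^sup>2)"

lemma rerr_nonneg [simp]: "rerr c p q \<ge> 0"
  by (simp add: rerr_def Let_def)

lemma rerr_degenerate [simp]:
  "fst p = snd p \<Longrightarrow> rerr c p q = 0" "fst q = snd q \<Longrightarrow> rerr c p q = 0"
  by (simp_all add: rerr_def Let_def mixed_diff_def)

lemma pair_diff_act: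
  "of_bool (nearest (pair_diff c \<tau> \<pi> k) \<noteq> 0) = act c (pair_at \<tau> k) (pair_at \<pi> k)"
  "(pair_diff c \<tau> \<pi> k - of_int (nearest (pair_diff c \<tau> \<pi> k)))\<^sup>2 = rerr c (pair_at \<tau> k) (pair_at \<pi> k)"
  by (simp_all add: act_def rerr_def Let_def pair_diff_def pair_at_def)

lemma fact_le_power_mult_fact: "k \<le> n \<Longrightarrow> (fact n :: real) \<le> real n ^ k * fact (n - k)"
proof (induction k)
  case (Suc k)
  have "n - k = Suc (n - Suc k)" using Suc.prems by simp
  then have "(fact (n - k) :: real) = real (n - k) * fact (n - Suc k)"
    by (metis fact_Suc of_nat_fact of_nat_mult)
  also have "\<dots> \<le> real n * fact (n - Suc k)" by (intro mult_right_mono) auto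
  finally have "real n ^ k * fact (n - k) \<le> real n ^ k * (real n * fact (n - Suc k))"
    by (intro mult_left_mono) auto
  moreover have "(fact n :: real) \<le> real n ^ k * fact (n - k)" using Suc by simp
  ultimately show ?case by (simp add: algebra_simps)
qed simp

lemma sum_Sn_Sn_one_pair:
  assumes "k < m" "2 * m \<le> n"
    and "\<And>p q. fst p = snd p \<Longrightarrow> \<phi> p q = 0" "\<And>p q. fst q = snd q \<Longrightarrow> \<phi> p q = (0 :: real)"
  shows "(\<Sum>\<tau>\<in>Sn n. \<Sum>\<pi>\<in>Sn n. \<phi> (pair_at \<tau> k) (pair_at \<pi> k))
    = (fact (n - 2))\<^sup>2 * (\<Sum>p\<in>grid n. \<Sum>q\<in>grid n. \<phi> p q)"
proof -
  have off_diag: "(\<Sum>p\<in>grid n. if fst p = snd p then 0 else K p) = (\<Sum>p\<in>grid n. K p)"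
    if "\<And>p. fst p = snd p \<Longrightarrow> K p = 0" for K :: "nat \<times> nat \<Rightarrow> real"
    using that by (intro sum.cong) auto
  have "(\<Sum>\<pi>\<in>Sn n. \<phi> p (pair_at \<pi> k)) = fact (n - 2) * (\<Sum>q\<in>grid n. \<phi> p q)" for p
    using sum_Sn_one_pair[OF assms(1,2), of "\<phi> p"] off_diag[of "\<phi> p", OF assms(4)] by simp
  then have "(\<Sum>\<tau>\<in>Sn n. \<Sum>\<pi>\<in>Sn n. \<phi> (pair_at \<tau> k) (pair_at \<pi> k))
    = fact (n - 2) * (\<Sum>\<tau>\<in>Sn n. \<Sum>q\<in>grid n. \<phi> (pair_at \<tau> k) q)"
    by (simp only: sum_distrib_left)
  also have "(\<Sum>\<tau>\<in>Sn n. \<Sum>q\<in>grid n. \<phi> (pair_at \<tau> k) q)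
      = fact (n - 2) * (\<Sum>p\<in>grid n. \<Sum>q\<in>grid n. \<phi> p q)"
    using sum_Sn_one_pair[OF assms(1,2), of "\<lambda>p. \<Sum>q\<in>grid n. \<phi> p q"]
      off_diag[of "\<lambda>p. \<Sum>q\<in>grid n. \<phi> p q", OF sum.neutral] assms(3) by simp
  finally show ?thesis by (simp add: power2_eq_square)
qed

lemma sum_Sn_Sn_two_pairs:
  fixes \<psi> :: "nat \<times> nat \<Rightarrow> nat \<times> nat \<Rightarrow> nat \<times> nat \<Rightarrow> nat \<times> nat \<Rightarrow> real"
  assumes kl: "k < m" "l < m" "k \<noteq> l" "2 * m \<le> n"
  shows "(\<Sum>\<tau>\<in>Sn n. \<Sum>\<pi>\<in>Sn n. \<psi> (pair_at \<tau> k) (pair_at \<tau> l) (pair_at \<pi> k) (pair_at \<pi> l))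
    = (fact (n - 4))\<^sup>2 * (\<Sum>p\<in>grid n. \<Sum>p'\<in>grid n. \<Sum>q\<in>grid n. \<Sum>q'\<in>grid n.
        if apart p p' \<and> apart q q' then \<psi> p p' q q' else 0)"
proof -
  let ?V = "\<lambda>p p'. \<Sum>q\<in>grid n. \<Sum>q'\<in>grid n. if apart q q' then \<psi> p p' q q' else 0"
  have "(\<Sum>\<pi>\<in>Sn n. \<psi> p p' (pair_at \<pi> k) (pair_at \<pi> l)) = fact (n - 4) * ?V p p'" for p p'
    by (rule sum_Sn_two_pairs[OF kl])
  then have "(\<Sum>\<tau>\<in>Sn n. \<Sum>\<pi>\<in>Sn n. \<psi> (pair_at \<tau> k) (pair_at \<tau> l) (pair_at \<pi> k) (pair_at \<pi> l))
    = fact (n - 4) * (\<Sum>\<tau>\<in>Sn n. ?V (pair_at \<tau> k) (pair_at \<tau> l))"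
    by (simp only: sum_distrib_left)
  also have "(\<Sum>\<tau>\<in>Sn n. ?V (pair_at \<tau> k) (pair_at \<tau> l))
      = fact (n - 4) * (\<Sum>p\<in>grid n. \<Sum>p'\<in>grid n. if apart p p' then ?V p p' else 0)"
    by (rule sum_Sn_two_pairs[OF kl])
  also have "(\<Sum>p\<in>grid n. \<Sum>p'\<in>grid n. if apart p p' then ?V p p' else 0)
    = (\<Sum>p\<in>grid n. \<Sum>p'\<in>grid n. \<Sum>q\<in>grid n. \<Sum>q'\<in>grid n.
        if apart p p' \<and> apart q q' then \<psi> p p' q q' else 0)"
    by (intro sum.cong refl) simp
  finally show ?thesis by (simp add: power2_eq_square)
qed

lemma sum_Sn_Sn_three_acts_le:
  assumes klq: "k < m" "l < m" "q < m" "k \<noteq> l" "k \<noteq> q" "l \<noteq> q" "2 * m \<le> n"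
  shows "(\<Sum>\<tau>\<in>Sn n. \<Sum>\<pi>\<in>Sn n. act c (pair_at \<tau> k) (pair_at \<pi> k)
      * act c (pair_at \<tau> l) (pair_at \<pi> l) * act c (pair_at \<tau> q) (pair_at \<pi> q))
    \<le> (fact (n - 6))\<^sup>2 * (total_act n c) ^ 3"
proof -
  let ?R = "\<lambda>p. \<Sum>q\<in>grid n. act c p q"
  have prod3: "(\<Sum>x\<in>S. \<Sum>y\<in>S. \<Sum>z\<in>S. a x * b y * d z) = (\<Sum>x\<in>S. a x) * (\<Sum>y\<in>S. b y) * (\<Sum>z\<in>S. d z)"
    for S :: "(nat \<times> nat) set" and a b d :: "nat \<times> nat \<Rightarrow> real"
    by (simp only: sum_distrib_left[symmetric] sum_distrib_right[symmetric])
  have "(\<Sum>\<pi>\<in>Sn n. act c x (pair_at \<pi> k) * act c y (pair_at \<pi> l) * act c z (pair_at \<pi> q))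
      \<le> fact (n - 6) * (?R x * ?R y * ?R z)" for x y z
    using sum_Sn_three_pairs_le[OF klq, of "\<lambda>x' y' z'. act c x x' * act c y y' * act c z z'"]
    by (simp only: prod3) simp
  then have "(\<Sum>\<tau>\<in>Sn n. \<Sum>\<pi>\<in>Sn n. act c (pair_at \<tau> k) (pair_at \<pi> k)
      * act c (pair_at \<tau> l) (pair_at \<pi> l) * act c (pair_at \<tau> q) (pair_at \<pi> q))
    \<le> (\<Sum>\<tau>\<in>Sn n. fact (n - 6) * (?R (pair_at \<tau> k) * ?R (pair_at \<tau> l) * ?R (pair_at \<tau> q)))"
    by (intro sum_mono)
  also have "\<dots> = fact (n - 6) * (\<Sum>\<tau>\<in>Sn n. ?R (pair_at \<tau> k) * ?R (pair_at \<tau> l) * ?R (pair_at \<tau> q))"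
    by (simp only: sum_distrib_left)
  also have "\<dots> \<le> fact (n - 6) * (fact (n - 6) * (total_act n c) ^ 3)"
  proof (intro mult_left_mono)
    have "(\<Sum>\<tau>\<in>Sn n. ?R (pair_at \<tau> k) * ?R (pair_at \<tau> l) * ?R (pair_at \<tau> q))
      \<le> fact (n - 6) * (\<Sum>x\<in>grid n. \<Sum>y\<in>grid n. \<Sum>z\<in>grid n. ?R x * ?R y * ?R z)"
      by (rule sum_Sn_three_pairs_le[OF klq]) (simp add: sum_nonneg)
    then show "(\<Sum>\<tau>\<in>Sn n. ?R (pair_at \<tau> k) * ?R (pair_at \<tau> l) * ?R (pair_at \<tau> q))
      \<le> fact (n - 6) * (total_act n c) ^ 3"
      by (simp only: prod3 total_act_def power3_eq_cube)
  qed simp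
  finally show ?thesis by (simp add: power2_eq_square mult.assoc)
qed

lemma sum_act_eq_card:
  assumes "finite K"
  shows "(\<Sum>k\<in>K. act c (p k) (q k)) = real (card {k \<in> K. act c (p k) (q k) = 1})"
proof -
  have "act c (p k) (q k) = (if act c (p k) (q k) = 1 then 1 else 0)" for k
    using act_cases[of c "p k" "q k"] by auto
  then have "(\<Sum>k\<in>K. act c (p k) (q k)) = (\<Sum>k\<in>K. if act c (p k) (q k) = 1 then 1 else 0)"
    by presburger
  then show ?thesis using assms by (simp add: sum.If_cases Int_def)
qed

text \<open>Second and third factorial moments of the count \<open>t\<close> of indicators equal to
  1.\<close>

lemma indicator_pair_sum:
  fixes Z :: "'k \<Rightarrow> real"
  assumes "finite K" and Z: "\<And>k. k \<in> K \<Longrightarrow> Z k = 0 \<or> Z k = 1"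
  defines "t \<equiv> \<Sum>k\<in>K. Z k"
  shows "(\<Sum>k\<in>K. \<Sum>l\<in>K - {k}. Z k * Z l) = t * (t - 1)"
    and "(\<Sum>k\<in>K. \<Sum>l\<in>K - {k}. \<Sum>q\<in>K - {k, l}. Z k * Z l * Z q) = t * (t - 1) * (t - 2)"
proof -
  have s1: "(\<Sum>l\<in>K - {k}. Z l) = t - Z k" if "k \<in> K" for k
    using that assms(1) unfolding t_def by (simp add: sum_diff1)
  have s2: "(\<Sum>q\<in>K - {k, l}. Z q) = t - Z k - Z l" if "k \<in> K" "l \<in> K - {k}" for k l
  proof -
    have "K - {k, l} = (K - {k}) - {l}" by auto
    then show ?thesis using that assms(1) s1[OF that(1)] by (simp add: sum_diff1)
  qed
  have "(\<Sum>k\<in>K. \<Sum>l\<in>K - {k}. Z k * Z l) = (\<Sum>k\<in>K. Z k * (t - 1))"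
  proof (rule sum.cong)
    fix k assume k: "k \<in> K"
    have "(\<Sum>l\<in>K - {k}. Z k * Z l) = Z k * (t - Z k)"
      by (simp add: s1[OF k] flip: sum_distrib_left)
    then show "(\<Sum>l\<in>K - {k}. Z k * Z l) = Z k * (t - 1)" using Z[OF k] by auto
  qed simp
  then show 1: "(\<Sum>k\<in>K. \<Sum>l\<in>K - {k}. Z k * Z l) = t * (t - 1)"
    by (simp add: t_def sum_distrib_right)
  have "(\<Sum>k\<in>K. \<Sum>l\<in>K - {k}. \<Sum>q\<in>K - {k, l}. Z k * Z l * Z q)
      = (\<Sum>k\<in>K. \<Sum>l\<in>K - {k}. Z k * Z l * (t - 2))"
  proof (intro sum.cong refl)
    fix k l assume kl: "k \<in> K" "l \<in> K - {k}"
    have "(\<Sum>q\<in>K - {k, l}. Z k * Z l * Z q) = Z k * Z l * (t - Z k - Z l)"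
      by (simp add: s2[OF kl] flip: sum_distrib_left)
    then show "(\<Sum>q\<in>K - {k, l}. Z k * Z l * Z q) = Z k * Z l * (t - 2)"
      using Z[of k] Z[of l] kl by auto
  qed
  also have "\<dots> = t * (t - 1) * (t - 2)"
    by (simp only: sum_distrib_right[symmetric] 1)
  finally show "(\<Sum>k\<in>K. \<Sum>l\<in>K - {k}. \<Sum>q\<in>K - {k, l}. Z k * Z l * Z q) = t * (t - 1) * (t - 2)" .
qed

section \<open>Activity estimates for a fixed near-linear Boolean function\<close>

locale near_linear =
  fixes n :: nat and f :: "(nat \<Rightarrow> nat) \<Rightarrow> real" and c :: "nat \<Rightarrow> nat \<Rightarrow> real" and \<epsilon> :: real
  assumes boolean: "\<And>\<pi>. \<pi> \<in> Sn n \<Longrightarrow> f \<pi> \<in> {0, 1}"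
    and err: "(\<Sum>\<pi>\<in>Sn n. (f \<pi> - (\<Sum>i\<in>{1..n}. c i (\<pi> i)))\<^sup>2) \<le> \<epsilon> * fact n"
    and n2: "2 \<le> n"
begin

definition m :: nat where "m = n div 2"

lemma m: "2 * m \<le> n" "real n \<le> 3 * real m" "real m \<le> real n / 2" "m \<ge> 1"
proof -
  have "n \<le> 3 * m" using n2 unfolding m_def by presburger
  then show "real n \<le> 3 * real m" by linarith
  show "2 * m \<le> n" unfolding m_def by simp
  then show "real m \<le> real n / 2" by linarith
  show "m \<ge> 1" using n2 unfolding m_def by presburger
qed

lemma eps_nonneg: "\<epsilon> \<ge> 0"
proof -
  have "0 \<le> \<epsilon> * fact n" using err by (meson order_trans sum_nonneg zero_le_power2)
  then show ?thesis by (metis fact_gt_zero mult_le_cancel_right_pos mult_zero_left)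
qed

definition hits :: "(nat \<Rightarrow> nat) \<Rightarrow> (nat \<Rightarrow> nat) \<Rightarrow> real" where
  "hits \<tau> \<pi> = (\<Sum>k<m. act c (pair_at \<tau> k) (pair_at \<pi> k))"

lemma hits_nonneg: "hits \<tau> \<pi> \<ge> 0"
  unfolding hits_def by (intro sum_nonneg) auto

lemma average:
  assumes "\<tau> \<in> Sn n"
  shows "(\<Sum>\<pi>\<in>Sn n. \<Sum>k<m. rerr c (pair_at \<tau> k) (pair_at \<pi> k)) \<le> 3100 * \<epsilon> * fact n"
    and "(\<Sum>\<pi>\<in>Sn n. hits \<tau> \<pi>) \<le> (1 + 3100 * \<epsilon>) * fact n"
    and "(\<Sum>\<pi>\<in>Sn n. if hits \<tau> \<pi> \<ge> 2 then hits \<tau> \<pi> else 0) \<le> 3100 * \<epsilon> * fact n"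
  using cube_average_relabelled[OF boolean err m(1), of \<tau>] assms
  unfolding pair_diff_act hits_def by auto

lemma fact_sq_le: "k \<le> n \<Longrightarrow> (fact n :: real)\<^sup>2 \<le> real n ^ (2 * k) * (fact (n - k))\<^sup>2"
proof -
  assume "k \<le> n"
  then have "(fact n :: real)\<^sup>2 \<le> (real n ^ k * fact (n - k))\<^sup>2"
    by (intro power_mono fact_le_power_mult_fact) auto
  then show ?thesis by (simp add: power_mult_distrib flip: power_mult) (simp add: mult.commute)
qed

text \<open>For random \<open>\<tau>\<close> and \<open>\<pi>\<close> each position \<open>k\<close>
  shows a uniformly random nondegenerate rectangle, of which there are about \<open>n ^ 4\<close>.
  The \<open>m\<close> positions share the bound \<open>B\<close>, and \<open>n \<le> 3 * m\<close>
  reduces the exponent to 3 at the price of the factor 3.\<close>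

lemma sum_one_pair_bound:
  assumes "\<And>p q. fst p = snd p \<Longrightarrow> \<phi> p q = 0" "\<And>p q. fst q = snd q \<Longrightarrow> \<phi> p q = (0 :: real)"
    and "\<And>p q. \<phi> p q \<ge> 0"
    and le: "\<And>\<tau>. \<tau> \<in> Sn n \<Longrightarrow> (\<Sum>\<pi>\<in>Sn n. \<Sum>k<m. \<phi> (pair_at \<tau> k) (pair_at \<pi> k)) \<le> B * fact n"
    and B: "B \<ge> 0"
  shows "(\<Sum>p\<in>grid n. \<Sum>q\<in>grid n. \<phi> p q) \<le> 3 * B * real n ^ 3"
proof -
  define S where "S = (\<Sum>p\<in>grid n. \<Sum>q\<in>grid n. \<phi> p q)"
  have S0: "S \<ge> 0" unfolding S_def by (intro sum_nonneg) (rule assms(3))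
  have "(\<Sum>\<tau>\<in>Sn n. \<Sum>\<pi>\<in>Sn n. \<Sum>k<m. \<phi> (pair_at \<tau> k) (pair_at \<pi> k))
      = (\<Sum>\<tau>\<in>Sn n. \<Sum>k<m. \<Sum>\<pi>\<in>Sn n. \<phi> (pair_at \<tau> k) (pair_at \<pi> k))"
    by (rule sum.cong[OF refl], rule sum.swap)
  also have "\<dots> = (\<Sum>k<m. \<Sum>\<tau>\<in>Sn n. \<Sum>\<pi>\<in>Sn n. \<phi> (pair_at \<tau> k) (pair_at \<pi> k))"
    by (rule sum.swap)
  also have "\<dots> = (\<Sum>k<m. (fact (n - 2))\<^sup>2 * S)"
    unfolding S_def using m(1) assms(1,2) by (intro sum.cong sum_Sn_Sn_one_pair) auto
  finally have "real m * ((fact (n - 2))\<^sup>2 * S)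
      = (\<Sum>\<tau>\<in>Sn n. \<Sum>\<pi>\<in>Sn n. \<Sum>k<m. \<phi> (pair_at \<tau> k) (pair_at \<pi> k))" by simp
  also have "\<dots> \<le> (\<Sum>\<tau>\<in>Sn n. B * fact n)" by (intro sum_mono le)
  also have "\<dots> = B * (fact n)\<^sup>2" by (simp add: power2_eq_square)
  also have "\<dots> \<le> B * (real n ^ (2 * 2) * (fact (n - 2))\<^sup>2)"
    using B n2 by (intro mult_left_mono fact_sq_le) auto
  finally have "(fact (n - 2))\<^sup>2 * (real m * S) \<le> (fact (n - 2))\<^sup>2 * (B * real n ^ 4)"
    by (simp add: algebra_simps)
  then have 1: "real m * S \<le> B * real n ^ 4" by simp
  have "real n * S \<le> 3 * real m * S" using m(2) S0 by (intro mult_right_mono) auto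
  also have "\<dots> \<le> real n * (3 * B * real n ^ 3)" using 1 by (simp add: power_eq_if algebra_simps)
  finally show ?thesis unfolding S_def[symmetric] using n2 by simp
qed

lemma sum_rerr: "(\<Sum>p\<in>grid n. \<Sum>q\<in>grid n. rerr c p q) \<le> 9300 * \<epsilon> * real n ^ 3"
  using sum_one_pair_bound[of "rerr c" "3100 * \<epsilon>"] average(1) eps_nonneg by simp

lemma total_act_le: "total_act n c \<le> 3 * (1 + 3100 * \<epsilon>) * real n ^ 3"
  unfolding total_act_def
  using sum_one_pair_bound[of "act c" "1 + 3100 * \<epsilon>"] average(2) eps_nonneg
  by (simp add: hits_def)

text \<open>Only relabellings with \<open>\<tau> 1 = r\<close> are used. They are a fraction
  \<open>1 / n\<close> of all, and the bound of \<open>average\<close> holds for every single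
  \<open>\<tau>\<close>, so fixing the row keeps the error proportional to
  \<open>\<epsilon>\<close>. The first rectangle sits at position 0 and the second at one of the
  other \<open>m - 1\<close> positions.\<close>

lemma apart_act_row_le:
  assumes n4: "n \<ge> 4" and r: "r \<in> {1..n}"
  shows "apart_act n c (\<lambda>p. of_bool (fst p = r)) \<le> 15500 * \<epsilon> * real n ^ 6"
proof -
  define W where "W = apart_act n c (\<lambda>p. of_bool (fst p = r))"
  let ?Z = "\<lambda>\<tau> \<pi> k. act c (pair_at \<tau> k) (pair_at \<pi> k)"
  let ?R = "\<lambda>\<tau>. of_bool (fst (pair_at \<tau> 0) = r) :: real"
  have W0: "W \<ge> 0" unfolding W_def apart_act_def by (intro sum_nonneg) auto
  have m2: "m \<ge> 2" using n4 unfolding m_def by presburger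
  have Wk: "(\<Sum>\<tau>\<in>Sn n. \<Sum>\<pi>\<in>Sn n. ?R \<tau> * ?Z \<tau> \<pi> 0 * ?Z \<tau> \<pi> k) = (fact (n - 4))\<^sup>2 * W"
    if "k \<in> {1..<m}" for k
    unfolding W_def apart_act_def
    using that m(1) by (intro sum_Sn_Sn_two_pairs[where \<psi> = "\<lambda>p p' q q'. of_bool (fst p = r) * act c p q * act c p' q'"]) auto
  \<comment> \<open>With one rectangle pinned to position 0, the number of partners is at most
    \<open>hits\<close>, not quadratic in it, so the mean of \<open>hits\<close> on the event of two
    hits is enough.\<close>
  have pt: "(\<Sum>k\<in>{1..<m}. ?R \<tau> * ?Z \<tau> \<pi> 0 * ?Z \<tau> \<pi> k)
      \<le> ?R \<tau> * (if hits \<tau> \<pi> \<ge> 2 then hits \<tau> \<pi> else 0)" for \<tau> \<pi>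
  proof -
    define s where "s = (\<Sum>k\<in>{1..<m}. ?Z \<tau> \<pi> k)"
    have "{..<m} = insert 0 {1..<m}" using m2 by auto
    then have h: "hits \<tau> \<pi> = ?Z \<tau> \<pi> 0 + s" unfolding hits_def s_def by simp
    have "s = real (card {k \<in> {1..<m}. ?Z \<tau> \<pi> k = 1})"
      unfolding s_def by (rule sum_act_eq_card) simp
    then consider "s = 0" | "s \<ge> 1" by (cases "card {k \<in> {1..<m}. ?Z \<tau> \<pi> k = 1}") auto
    then have "?Z \<tau> \<pi> 0 * s \<le> (if hits \<tau> \<pi> \<ge> 2 then hits \<tau> \<pi> else 0)"
      using act_cases[of c "pair_at \<tau> 0" "pair_at \<pi> 0"] h by cases auto
    then have "?R \<tau> * (?Z \<tau> \<pi> 0 * s) \<le> ?R \<tau> * (if hits \<tau> \<pi> \<ge> 2 then hits \<tau> \<pi> else 0)"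
      by (intro mult_left_mono) auto
    then show ?thesis by (simp add: s_def sum_distrib_left mult.assoc)
  qed
  have cnt: "(\<Sum>\<tau>\<in>Sn n. ?R \<tau>) = fact (n - 1)"
  proof -
    have "card {\<tau> \<in> Sn n. \<forall>a\<in>{1}. \<tau> a = r} = fact (n - card {1 :: nat})"
      by (rule card_permutes_prescribed) (use n2 r in auto)
    then show ?thesis by (simp add: pair_at_def of_bool_def sum.If_cases Int_def)
  qed
  have "real (m - 1) * ((fact (n - 4))\<^sup>2 * W)
      = (\<Sum>k\<in>{1..<m}. \<Sum>\<tau>\<in>Sn n. \<Sum>\<pi>\<in>Sn n. ?R \<tau> * ?Z \<tau> \<pi> 0 * ?Z \<tau> \<pi> k)"
    using Wk by simp
  also have "\<dots> = (\<Sum>\<tau>\<in>Sn n. \<Sum>k\<in>{1..<m}. \<Sum>\<pi>\<in>Sn n. ?R \<tau> * ?Z \<tau> \<pi> 0 * ?Z \<tau> \<pi> k)"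
    by (rule sum.swap)
  also have "\<dots> = (\<Sum>\<tau>\<in>Sn n. \<Sum>\<pi>\<in>Sn n. \<Sum>k\<in>{1..<m}. ?R \<tau> * ?Z \<tau> \<pi> 0 * ?Z \<tau> \<pi> k)"
    by (rule sum.cong[OF refl], rule sum.swap)
  also have "\<dots> \<le> (\<Sum>\<tau>\<in>Sn n. \<Sum>\<pi>\<in>Sn n. ?R \<tau> * (if hits \<tau> \<pi> \<ge> 2 then hits \<tau> \<pi> else 0))"
    by (intro sum_mono pt)
  also have "\<dots> = (\<Sum>\<tau>\<in>Sn n. ?R \<tau> * (\<Sum>\<pi>\<in>Sn n. if hits \<tau> \<pi> \<ge> 2 then hits \<tau> \<pi> else 0))"
    by (simp only: sum_distrib_left)
  also have "\<dots> \<le> (\<Sum>\<tau>\<in>Sn n. ?R \<tau> * (3100 * \<epsilon> * fact n))"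
    by (intro sum_mono mult_left_mono average(3)) auto
  also have "\<dots> = fact (n - 1) * (3100 * \<epsilon> * fact n)"
    by (simp only: sum_distrib_right[symmetric] cnt)
  also have "\<dots> \<le> (real n ^ 3 * fact (n - 4)) * (3100 * \<epsilon> * (real n ^ 4 * fact (n - 4)))"
  proof (intro mult_mono)
    have "(fact (n - 1) :: real) \<le> real (n - 1) ^ 3 * fact (n - 1 - 3)"
      using n4 by (intro fact_le_power_mult_fact) auto
    also have "\<dots> \<le> real n ^ 3 * fact (n - 1 - 3)" by (intro mult_right_mono power_mono) auto
    finally show "(fact (n - 1) :: real) \<le> real n ^ 3 * fact (n - 4)" by (simp add: eval_nat_numeral)
    show "(fact n :: real) \<le> real n ^ 4 * fact (n - 4)" using n4 by (rule fact_le_power_mult_fact)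
  qed (use eps_nonneg in auto)
  also have "\<dots> = (fact (n - 4))\<^sup>2 * (3100 * \<epsilon> * (real n ^ 3 * real n ^ 4))"
    by (simp add: power2_eq_square)
  also have "real n ^ 3 * real n ^ 4 = real n ^ 7"
    by (simp flip: power_add)
  finally have "(fact (n - 4))\<^sup>2 * (real (m - 1) * W) \<le> (fact (n - 4))\<^sup>2 * (3100 * \<epsilon> * real n ^ 7)"
    by (simp only: mult.left_commute)
  then have 1: "real (m - 1) * W \<le> 3100 * \<epsilon> * real n ^ 7" by simp
  have "n \<le> 2 * m + 1" unfolding m_def by linarith
  then have "n \<le> 5 * (m - 1)" using m2 by linarith
  then have "real n * W \<le> (5 * real (m - 1)) * W"
    using W0 by (intro mult_right_mono) linarith+
  also have "\<dots> \<le> 5 * (3100 * \<epsilon> * real n ^ 7)" using 1 by (simp only: mult.assoc)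
  also have "real n ^ 7 = real n * real n ^ 6" by (simp flip: power_Suc)
  also have "5 * (3100 * \<epsilon> * (real n * real n ^ 6)) = real n * (15500 * \<epsilon> * real n ^ 6)" by simp
  finally show ?thesis unfolding W_def[symmetric] using n2 by simp
qed

text \<open>The cube estimate controls only the mean of the number of hits on the event that it is at least 2,
  not the mean number of pairs of hits; the third moment takes care of the tail.\<close>
lemma pair_sum_le:
  assumes M: "M > (0 :: real)"
  shows "(\<Sum>k<m. \<Sum>l\<in>{..<m} - {k}. act c (pair_at \<tau> k) (pair_at \<pi> k) * act c (pair_at \<tau> l) (pair_at \<pi> l))
    \<le> (M + 2) * (if hits \<tau> \<pi> \<ge> 2 then hits \<tau> \<pi> else 0)
      + (\<Sum>k<m. \<Sum>l\<in>{..<m} - {k}. \<Sum>q\<in>{..<m} - {k, l}. act c (pair_at \<tau> k) (pair_at \<pi> k)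
          * act c (pair_at \<tau> l) (pair_at \<pi> l) * act c (pair_at \<tau> q) (pair_at \<pi> q)) / M"
proof -
  let ?Z = "\<lambda>k. act c (pair_at \<tau> k) (pair_at \<pi> k)"
  define t where "t = hits \<tau> \<pi>"
  have t: "t = real (card {k \<in> {..<m}. ?Z k = 1})"
    unfolding t_def hits_def by (rule sum_act_eq_card) simp
  consider "t = 0" | "t = 1" | "t \<ge> 2"
  proof -
    define N where "N = card {k \<in> {..<m}. ?Z k = 1}"
    have "N = 0 \<or> N = 1 \<or> N \<ge> 2" by auto
    then have "t = 0 \<or> t = 1 \<or> t \<ge> 2" using t by (auto simp: N_def)
    then show ?thesis using that by blast
  qed
  then have "t * (t - 1) \<le> (M + 2) * (if t \<ge> 2 then t else 0) + t * (t - 1) * (t - 2) / M"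
  proof cases
    case 3
    show ?thesis
    proof (cases "t - 2 \<le> M")
      case True
      then have "t * (t - 1) \<le> t * (M + 2)" using 3 by (intro mult_left_mono) auto
      moreover have "t * (t - 1) * (t - 2) / M \<ge> 0" using 3 M by simp
      ultimately show ?thesis using 3 by (simp add: algebra_simps)
    next
      case False
      then have "t * (t - 1) * M \<le> t * (t - 1) * (t - 2)" using 3 by (intro mult_left_mono) auto
      then have "t * (t - 1) \<le> t * (t - 1) * (t - 2) / M" using M by (simp add: field_simps)
      moreover have "(M + 2) * t \<ge> 0" using M 3 by simp
      ultimately show ?thesis using 3 by simp
    qed
  qed auto
  then show ?thesis
    using indicator_pair_sum[of "{..<m}" ?Z] act_cases unfolding t_def hits_def by simp
qed

text \<open>Summing \<open>pair_sum_le\<close> over \<open>\<tau>\<close> and \<open>\<pi>\<close>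
  leaves a term controlled by \<open>average\<close> and a third moment controlled by
  \<open>total_act_le\<close>, where smallness of \<open>\<epsilon>\<close> gives total activity at
  most \<open>6 * n ^ 3\<close>. The number 432 is \<open>6 ^ 3 * 4 ^ 2 / 2 ^ 3\<close>; the 16 in
  front comes from \<open>m * (m - 1) \<ge> n\<^sup>2 / 16\<close>. A large \<open>M\<close> and
  then a small \<open>\<epsilon>\<close> make the bound a small multiple of
  \<open>n ^ 6\<close>.\<close>

lemma apart_act_le:
  assumes n10: "n \<ge> 10" and M: "M > (0 :: real)" and small: "3100 * \<epsilon> \<le> 1"
  shows "apart_act n c (\<lambda>_. 1) \<le> 16 * real n ^ 6 * (3100 * \<epsilon> * (M + 2) + 432 / M)"
proof -
  define W where "W = apart_act n c (\<lambda>_. 1)"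
  let ?Z = "\<lambda>\<tau> \<pi> k. act c (pair_at \<tau> k) (pair_at \<pi> k)"
  let ?F = "fact (n - 4) :: real"
  have W0: "W \<ge> 0" unfolding W_def apart_act_def by (intro sum_nonneg) auto
  have W2: "(\<Sum>\<tau>\<in>Sn n. \<Sum>\<pi>\<in>Sn n. ?Z \<tau> \<pi> k * ?Z \<tau> \<pi> l) = ?F\<^sup>2 * W"
    if "k < m" "l \<in> {..<m} - {k}" for k l
    using sum_Sn_Sn_two_pairs[of k m l n "\<lambda>p p' q q'. 1 * act c p q * act c p' q'"] that m(1)
    unfolding W_def apart_act_def by auto
  have swap3: "(\<Sum>\<tau>\<in>Sn n. \<Sum>\<pi>\<in>Sn n. \<Sum>k\<in>A. h \<tau> \<pi> k) = (\<Sum>k\<in>A. \<Sum>\<tau>\<in>Sn n. \<Sum>\<pi>\<in>Sn n. h \<tau> \<pi> k)"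
    for A :: "nat set" and h :: "_ \<Rightarrow> _ \<Rightarrow> _ \<Rightarrow> real"
  proof -
    have "(\<Sum>\<tau>\<in>Sn n. \<Sum>\<pi>\<in>Sn n. \<Sum>k\<in>A. h \<tau> \<pi> k) = (\<Sum>\<tau>\<in>Sn n. \<Sum>k\<in>A. \<Sum>\<pi>\<in>Sn n. h \<tau> \<pi> k)"
      by (rule sum.cong[OF refl], rule sum.swap)
    also have "\<dots> = (\<Sum>k\<in>A. \<Sum>\<tau>\<in>Sn n. \<Sum>\<pi>\<in>Sn n. h \<tau> \<pi> k)" by (rule sum.swap)
    finally show ?thesis .
  qed
  have "(\<Sum>\<tau>\<in>Sn n. \<Sum>\<pi>\<in>Sn n. \<Sum>k<m. \<Sum>l\<in>{..<m} - {k}. ?Z \<tau> \<pi> k * ?Z \<tau> \<pi> l)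
      = (\<Sum>k<m. \<Sum>l\<in>{..<m} - {k}. ?F\<^sup>2 * W)"
    unfolding swap3 by (intro sum.cong refl W2) auto
  also have "\<dots> = ?F\<^sup>2 * (real m * real (m - 1) * W)"
    using m(4) by (simp add: of_nat_diff)
  finally have lhs: "(\<Sum>\<tau>\<in>Sn n. \<Sum>\<pi>\<in>Sn n. \<Sum>k<m. \<Sum>l\<in>{..<m} - {k}. ?Z \<tau> \<pi> k * ?Z \<tau> \<pi> l)
      = ?F\<^sup>2 * (real m * real (m - 1) * W)" .
  let ?T = "\<Sum>\<tau>\<in>Sn n. \<Sum>\<pi>\<in>Sn n. \<Sum>k<m. \<Sum>l\<in>{..<m} - {k}. \<Sum>q\<in>{..<m} - {k, l}.
      ?Z \<tau> \<pi> k * ?Z \<tau> \<pi> l * ?Z \<tau> \<pi> q"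
  let ?N = "total_act n c"
  have N0: "?N \<ge> 0" unfolding total_act_def by (intro sum_nonneg) auto
  have N6: "?N \<le> 6 * real n ^ 3"
  proof -
    have "3 * (1 + 3100 * \<epsilon>) * real n ^ 3 \<le> 6 * real n ^ 3"
      using small by (intro mult_right_mono) auto
    then show ?thesis using total_act_le by simp
  qed
  have "?T \<le> (\<Sum>k<m. \<Sum>l\<in>{..<m} - {k}. \<Sum>q\<in>{..<m} - {k, l}. (fact (n - 6))\<^sup>2 * ?N ^ 3)"
    unfolding swap3 using m(1) by (intro sum_mono sum_Sn_Sn_three_acts_le) auto
  also have "\<dots> \<le> (\<Sum>k<m. \<Sum>l<m. \<Sum>q<m. (fact (n - 6))\<^sup>2 * ?N ^ 3)"
    using N0 by (intro sum_mono order_trans[OF sum_mono2 sum_mono] sum_mono2) (auto intro!: sum_nonneg)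
  also have "\<dots> = real m ^ 3 * ((fact (n - 6))\<^sup>2 * ?N ^ 3)" by (simp add: power3_eq_cube)
  also have "\<dots> \<le> (real n / 2) ^ 3 * ((4 / (real n)\<^sup>2 * ?F)\<^sup>2 * (6 * real n ^ 3) ^ 3)"
  proof (intro mult_mono power_mono)
    have "n - 4 = Suc (Suc (n - 6))" using n10 by simp
    then have "?F = real (n - 4) * (real (n - 5) * fact (n - 6))"
      by (simp add: algebra_simps)
    \<comment> \<open>From \<open>n \<ge> 10\<close> on, already \<open>n - 5\<close> is at least
      \<open>n / 2\<close>.\<close>
    moreover have "real (n - 4) * real (n - 5) \<ge> (real n)\<^sup>2 / 4"
    proof -
      have "(real n / 2) * (real n / 2) \<le> real (n - 4) * real (n - 5)"
        using n10 by (intro mult_mono) (auto simp: of_nat_diff)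
      then show ?thesis by (simp add: power2_eq_square)
    qed
    ultimately have "(real n)\<^sup>2 / 4 * fact (n - 6) \<le> ?F"
      by (simp add: mult.assoc[symmetric] mult_right_mono del: mult.assoc)
    then show "(fact (n - 6) :: real) \<le> 4 / (real n)\<^sup>2 * ?F"
      using n10 by (simp add: field_simps)
  qed (use m(3) N6 N0 in auto)
  also have "\<dots> = ?F\<^sup>2 * (432 * real n ^ 8)"
    using n10 by (simp add: field_simps power_mult_distrib power_divide flip: power_mult power_add)
  finally have T: "?T \<le> ?F\<^sup>2 * (432 * real n ^ 8)" .
  have "?F\<^sup>2 * (real m * real (m - 1) * W)
      \<le> (\<Sum>\<tau>\<in>Sn n. \<Sum>\<pi>\<in>Sn n. (M + 2) * (if hits \<tau> \<pi> \<ge> 2 then hits \<tau> \<pi> else 0)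
        + (\<Sum>k<m. \<Sum>l\<in>{..<m} - {k}. \<Sum>q\<in>{..<m} - {k, l}. ?Z \<tau> \<pi> k * ?Z \<tau> \<pi> l * ?Z \<tau> \<pi> q) / M)"
    unfolding lhs[symmetric] by (intro sum_mono pair_sum_le M)
  also have "\<dots> = (M + 2) * (\<Sum>\<tau>\<in>Sn n. \<Sum>\<pi>\<in>Sn n. if hits \<tau> \<pi> \<ge> 2 then hits \<tau> \<pi> else 0) + ?T / M"
    by (simp only: sum.distrib sum_distrib_left[symmetric] sum_divide_distrib[symmetric])
  also have "\<dots> \<le> (M + 2) * (\<Sum>\<tau>\<in>Sn n. 3100 * \<epsilon> * fact n) + (?F\<^sup>2 * (432 * real n ^ 8)) / M"
    using M T by (intro add_mono mult_left_mono sum_mono average(3) divide_right_mono) auto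
  also have "\<dots> = (M + 2) * (3100 * \<epsilon> * (fact n)\<^sup>2) + (?F\<^sup>2 * (432 * real n ^ 8)) / M"
    by (simp add: power2_eq_square)
  also have "\<dots> \<le> (M + 2) * (3100 * \<epsilon> * (real n ^ (2 * 4) * ?F\<^sup>2)) + (?F\<^sup>2 * (432 * real n ^ 8)) / M"
    using M eps_nonneg n10 by (intro add_mono mult_left_mono fact_sq_le) auto
  also have "\<dots> = ?F\<^sup>2 * (real n ^ 8 * (3100 * \<epsilon> * (M + 2) + 432 / M))"
    by (simp add: algebra_simps)
  finally have 1: "real m * real (m - 1) * W \<le> real n ^ 8 * (3100 * \<epsilon> * (M + 2) + 432 / M)"
    by simp
  have "real n / 4 \<le> real (m - 1)"
  proof -
    have "n \<le> 4 * (m - 1)" using n10 unfolding m_def by linarith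
    then show ?thesis by linarith
  qed
  moreover have "real n / 4 \<le> real m" using m(2) n10 by linarith
  ultimately have "(real n / 4) * (real n / 4) \<le> real m * real (m - 1)" by (intro mult_mono) auto
  then have "(real n / 4) * (real n / 4) * W \<le> real m * real (m - 1) * W"
    using W0 by (intro mult_right_mono) auto
  also note 1
  finally have "(real n)\<^sup>2 * W \<le> 16 * (real n ^ 8 * (3100 * \<epsilon> * (M + 2) + 432 / M))"
    by (simp add: power2_eq_square mult.commute)
  also have "\<dots> = (real n)\<^sup>2 * (16 * real n ^ 6 * (3100 * \<epsilon> * (M + 2) + 432 / M))"
    by (simp add: algebra_simps flip: power_add)
  finally have "(real n)\<^sup>2 * W \<le> (real n)\<^sup>2 * (16 * real n ^ 6 * (3100 * \<epsilon> * (M + 2) + 432 / M))" .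
  then show ?thesis unfolding W_def[symmetric] using n10 by simp
qed

end

subsection \<open>Rounding to an integer matrix\<close>

lemma sum_Sn_one_point:
  fixes h :: "nat \<Rightarrow> real"
  assumes "i \<in> {1..n}"
  shows "(\<Sum>\<pi>\<in>Sn n. h (\<pi> i)) = fact (n - 1) * (\<Sum>j\<in>{1..n}. h j)"
proof -
  have "(\<Sum>xs\<in>dlists n (Suc 0). h (xs ! 0)) = (\<Sum>j\<in>{1..n}. h j)"
    by (simp only: sum_dlists_Suc) simp
  then show ?thesis
    using sum_Sn_map[of "[i]" n "\<lambda>xs. h (xs ! 0)"] assms by simp
qed

lemma sum_Sn_two_points:
  fixes h g :: "nat \<Rightarrow> real"
  assumes "i \<in> {1..n}" "k \<in> {1..n}" "i \<noteq> k"
  shows "(\<Sum>\<pi>\<in>Sn n. h (\<pi> i) * g (\<pi> k))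
    = fact (n - 2) * ((\<Sum>j\<in>{1..n}. h j) * (\<Sum>j\<in>{1..n}. g j) - (\<Sum>j\<in>{1..n}. h j * g j))"
proof -
  have "(\<Sum>xs\<in>dlists n (Suc (Suc 0)). h (xs ! 0) * g (xs ! 1))
      = (\<Sum>j\<in>{1..n}. \<Sum>l\<in>{1..n}. if j = l then 0 else h j * g l)"
    by (simp only: sum_dlists_Suc) (auto intro!: sum.cong)
  also have "\<dots> = (\<Sum>j\<in>{1..n}. (\<Sum>l\<in>{1..n}. h j * g l) - h j * g j)"
  proof (rule sum.cong[OF refl])
    fix j assume j: "j \<in> {1..n}"
    have "(\<Sum>l\<in>{1..n}. if j = l then 0 else h j * g l)
      = (\<Sum>l\<in>{1..n}. h j * g l - (if j = l then h j * g j else 0))"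
      by (intro sum.cong) auto
    also have "\<dots> = (\<Sum>l\<in>{1..n}. h j * g l) - h j * g j"
      using j by (simp add: sum_subtractf)
    finally show "(\<Sum>l\<in>{1..n}. if j = l then 0 else h j * g l) = (\<Sum>l\<in>{1..n}. h j * g l) - h j * g j" .
  qed
  also have "\<dots> = (\<Sum>j\<in>{1..n}. h j) * (\<Sum>j\<in>{1..n}. g j) - (\<Sum>j\<in>{1..n}. h j * g j)"
    by (simp add: sum_subtractf sum_product)
  finally show ?thesis
    using sum_Sn_map[of "[i, k]" n "\<lambda>xs. h (xs ! 0) * g (xs ! 1)"] assms
    by (simp add: numeral_2_eq_2)
qed

text \<open>By inclusion and exclusion, \<open>T\<^sup>2 - R - C + S\<close> is the sum of
  \<open>u i j * u k l\<close> over pairs of entries that share neither row nor column; these are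
  the pairs of different entries that a permutation can use together. The diagonal pairs give the
  first \<open>S\<close>.\<close>

lemma linear_second_moment:
  fixes u :: "nat \<Rightarrow> nat \<Rightarrow> real" and n :: nat
  defines "T \<equiv> \<Sum>i\<in>{1..n}. \<Sum>j\<in>{1..n}. u i j"
    and "S \<equiv> \<Sum>i\<in>{1..n}. \<Sum>j\<in>{1..n}. (u i j)\<^sup>2"
    and "R \<equiv> \<Sum>i\<in>{1..n}. (\<Sum>j\<in>{1..n}. u i j)\<^sup>2"
    and "C \<equiv> \<Sum>j\<in>{1..n}. (\<Sum>i\<in>{1..n}. u i j)\<^sup>2"
  shows "(\<Sum>\<pi>\<in>Sn n. (\<Sum>i\<in>{1..n}. u i (\<pi> i))\<^sup>2)
    = fact (n - 1) * S + fact (n - 2) * (T\<^sup>2 - R - C + S)"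
proof -
  let ?I = "{1..n}"
  have "(\<Sum>\<pi>\<in>Sn n. (\<Sum>i\<in>?I. u i (\<pi> i))\<^sup>2) = (\<Sum>\<pi>\<in>Sn n. \<Sum>i\<in>?I. \<Sum>k\<in>?I. u i (\<pi> i) * u k (\<pi> k))"
    by (simp only: power2_eq_square sum_product)
  also have "\<dots> = (\<Sum>i\<in>?I. \<Sum>\<pi>\<in>Sn n. \<Sum>k\<in>?I. u i (\<pi> i) * u k (\<pi> k))"
    by (rule sum.swap)
  also have "\<dots> = (\<Sum>i\<in>?I. \<Sum>k\<in>?I. \<Sum>\<pi>\<in>Sn n. u i (\<pi> i) * u k (\<pi> k))"
    by (rule sum.cong[OF refl], rule sum.swap)
  also have "\<dots> = (\<Sum>i\<in>?I. fact (n - 1) * (\<Sum>j\<in>?I. (u i j)\<^sup>2)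
      + fact (n - 2) * ((\<Sum>j\<in>?I. u i j) * T - (\<Sum>j\<in>?I. u i j)\<^sup>2
        - (\<Sum>j\<in>?I. u i j * (\<Sum>k\<in>?I. u k j)) + (\<Sum>j\<in>?I. (u i j)\<^sup>2)))"
  proof (rule sum.cong[OF refl])
    fix i assume i: "i \<in> ?I"
    let ?r = "\<lambda>i. \<Sum>j\<in>?I. u i j"
    have "(\<Sum>k\<in>?I. \<Sum>\<pi>\<in>Sn n. u i (\<pi> i) * u k (\<pi> k))
      = (\<Sum>\<pi>\<in>Sn n. u i (\<pi> i) * u i (\<pi> i)) + (\<Sum>k\<in>?I - {i}. \<Sum>\<pi>\<in>Sn n. u i (\<pi> i) * u k (\<pi> k))"
      using i by (intro sum.remove) auto
    also have "(\<Sum>\<pi>\<in>Sn n. u i (\<pi> i) * u i (\<pi> i)) = fact (n - 1) * (\<Sum>j\<in>?I. (u i j)\<^sup>2)"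
      using sum_Sn_one_point[OF i, of "\<lambda>j. u i j * u i j"] by (simp add: power2_eq_square)
    also have "(\<Sum>k\<in>?I - {i}. \<Sum>\<pi>\<in>Sn n. u i (\<pi> i) * u k (\<pi> k))
      = (\<Sum>k\<in>?I - {i}. fact (n - 2) * (?r i * ?r k - (\<Sum>j\<in>?I. u i j * u k j)))"
      using i by (intro sum.cong refl sum_Sn_two_points) auto
    also have "\<dots> = fact (n - 2) * ((\<Sum>k\<in>?I. ?r i * ?r k - (\<Sum>j\<in>?I. u i j * u k j))
        - (?r i * ?r i - (\<Sum>j\<in>?I. u i j * u i j)))"
      using i by (simp add: sum_diff1 flip: sum_distrib_left)
    also have "(\<Sum>k\<in>?I. ?r i * ?r k - (\<Sum>j\<in>?I. u i j * u k j))
      = ?r i * T - (\<Sum>k\<in>?I. \<Sum>j\<in>?I. u i j * u k j)"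
      unfolding T_def sum_distrib_left sum_subtractf ..
    also have "(\<Sum>k\<in>?I. \<Sum>j\<in>?I. u i j * u k j) = (\<Sum>j\<in>?I. \<Sum>k\<in>?I. u i j * u k j)"
      by (rule sum.swap)
    finally show "(\<Sum>k\<in>?I. \<Sum>\<pi>\<in>Sn n. u i (\<pi> i) * u k (\<pi> k)) = fact (n - 1) * (\<Sum>j\<in>?I. (u i j)\<^sup>2)
      + fact (n - 2) * (?r i * T - (?r i)\<^sup>2
        - (\<Sum>j\<in>?I. u i j * (\<Sum>k\<in>?I. u k j)) + (\<Sum>j\<in>?I. (u i j)\<^sup>2))"
      by (simp only: power2_eq_square sum_distrib_left) (simp only: algebra_simps)
  qed
  also have "\<dots> = fact (n - 1) * S + fact (n - 2) * ((\<Sum>i\<in>?I. \<Sum>j\<in>?I. u i j) * T - R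
      - (\<Sum>i\<in>?I. \<Sum>j\<in>?I. u i j * (\<Sum>k\<in>?I. u k j)) + S)"
    unfolding S_def R_def
    by (simp only: sum.distrib sum_distrib_left[symmetric] sum_subtractf sum_distrib_right[symmetric])
  also have "(\<Sum>i\<in>?I. \<Sum>j\<in>?I. u i j * (\<Sum>k\<in>?I. u k j)) = (\<Sum>j\<in>?I. \<Sum>i\<in>?I. u i j * (\<Sum>k\<in>?I. u k j))"
    by (rule sum.swap)
  also have "\<dots> = C"
    unfolding C_def by (simp only: power2_eq_square sum_distrib_right)
  also have "(\<Sum>i\<in>?I. \<Sum>j\<in>?I. u i j) * T = T\<^sup>2"
    by (simp only: T_def power2_eq_square)
  finally show ?thesis .
qed

text \<open>Centring at \<open>T / n\<close> leaves \<open>T\<^sup>2 / n - R\<close>, which is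
  nonpositive by Cauchy-Schwarz, and \<open>- C\<close>, so only \<open>n * S\<close> survives. The
  factor 2 is \<open>n \<le> 2 * (n - 1)\<close>.\<close>

lemma linear_variance_le:
  fixes u :: "nat \<Rightarrow> nat \<Rightarrow> real"
  assumes n2: "2 \<le> n"
  shows "\<exists>\<mu>. (\<Sum>\<pi>\<in>Sn n. ((\<Sum>i\<in>{1..n}. u i (\<pi> i)) - \<mu>)\<^sup>2)
    \<le> fact n * (2 * (\<Sum>i\<in>{1..n}. \<Sum>j\<in>{1..n}. (u i j)\<^sup>2) / n)"
proof -
  define T where "T = (\<Sum>i\<in>{1..n}. \<Sum>j\<in>{1..n}. u i j)"
  define S where "S = (\<Sum>i\<in>{1..n}. \<Sum>j\<in>{1..n}. (u i j)\<^sup>2)"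
  define R where "R = (\<Sum>i\<in>{1..n}. (\<Sum>j\<in>{1..n}. u i j)\<^sup>2)"
  define C where "C = (\<Sum>j\<in>{1..n}. (\<Sum>i\<in>{1..n}. u i j)\<^sup>2)"
  let ?h = "\<lambda>\<pi>. \<Sum>i\<in>{1..n}. u i (\<pi> i)"
  let ?F = "fact (n - 2) :: real"
  obtain q where q: "n = q + 2" using n2 by (metis add.commute le_Suc_ex)
  have F1: "(fact (n - 1) :: real) = real (n - 1) * ?F" by (simp add: q algebra_simps)
  have F0: "(fact n :: real) = real n * real (n - 1) * ?F" by (simp add: q algebra_simps)
  have "S \<ge> 0" "C \<ge> 0" unfolding S_def C_def by (auto intro!: sum_nonneg)
  have CS: "T\<^sup>2 \<le> R * n"
    unfolding T_def R_def using sum_squared_le_sum_of_squares[of "\<lambda>i. \<Sum>j\<in>{1..n}. u i j" "{1..n}"] by simp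
  have sec: "(\<Sum>\<pi>\<in>Sn n. (?h \<pi>)\<^sup>2) = fact (n - 1) * S + ?F * (T\<^sup>2 - R - C + S)"
    unfolding T_def S_def R_def C_def by (rule linear_second_moment)
  have fst: "(\<Sum>\<pi>\<in>Sn n. ?h \<pi>) = fact (n - 1) * T"
  proof -
    have "(\<Sum>\<pi>\<in>Sn n. ?h \<pi>) = (\<Sum>i\<in>{1..n}. \<Sum>\<pi>\<in>Sn n. u i (\<pi> i))" by (rule sum.swap)
    also have "\<dots> = (\<Sum>i\<in>{1..n}. fact (n - 1) * (\<Sum>j\<in>{1..n}. u i j))"
      by (intro sum.cong refl sum_Sn_one_point)
    finally show ?thesis by (simp only: sum_distrib_left T_def)
  qed
  define \<mu> where "\<mu> = T / n"
  have "(\<Sum>\<pi>\<in>Sn n. (?h \<pi> - \<mu>)\<^sup>2) = (\<Sum>\<pi>\<in>Sn n. (?h \<pi>)\<^sup>2 - 2 * \<mu> * ?h \<pi> + \<mu>\<^sup>2)"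
    by (intro sum.cong) (simp_all add: power2_eq_square algebra_simps)
  also have "\<dots> = (\<Sum>\<pi>\<in>Sn n. (?h \<pi>)\<^sup>2) - 2 * \<mu> * (\<Sum>\<pi>\<in>Sn n. ?h \<pi>) + fact n * \<mu>\<^sup>2"
    by (simp add: sum.distrib sum_subtractf sum_distrib_left)
  also have "\<dots> = ?F * (real n * S + (T\<^sup>2 / n - R) - C)"
  proof -
    have n0: "real n \<noteq> 0" using n2 by simp
    define k where "k = real (n - 1)"
    define y where "y = T\<^sup>2 / n"
    have rn: "real n = k + 1" using n2 by (simp add: k_def)
    have "2 * \<mu> * (fact (n - 1) * T) = ?F * (2 * k * y)"
      unfolding \<mu>_def F1 k_def y_def by (simp add: power2_eq_square)
    moreover have "fact n * \<mu>\<^sup>2 = ?F * (k * y)"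
      unfolding \<mu>_def F0 k_def y_def using n0 by (simp add: power2_eq_square)
    moreover have "fact (n - 1) * S = ?F * (k * S)"
      unfolding F1 k_def by simp
    moreover have "T\<^sup>2 = (k + 1) * y"
      unfolding rn[symmetric] y_def using n0 by simp
    ultimately have "fact (n - 1) * S + ?F * (T\<^sup>2 - R - C + S) - 2 * \<mu> * (fact (n - 1) * T) + fact n * \<mu>\<^sup>2
      = ?F * (k * S) + ?F * ((k + 1) * y - R - C + S) - ?F * (2 * k * y) + ?F * (k * y)"
      by (simp only:)
    also have "\<dots> = ?F * ((k + 1) * S + (y - R) - C)"
      by (simp add: algebra_simps)
    finally show ?thesis unfolding sec fst rn[symmetric] y_def .
  qed
  also have "\<dots> \<le> ?F * (real n * S)"
  proof (intro mult_left_mono)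
    have "T\<^sup>2 / n \<le> R" using CS n2 by (simp add: field_simps)
    then show "real n * S + (T\<^sup>2 / n - R) - C \<le> real n * S" using \<open>C \<ge> 0\<close> by linarith
  qed simp
  also have "\<dots> \<le> fact n * (2 * S / n)"
  proof -
    have "?F * (real n * S) \<le> ?F * ((2 * real (n - 1)) * S)"
      using n2 \<open>S \<ge> 0\<close> by (intro mult_left_mono mult_right_mono) auto
    then show ?thesis unfolding F0 using n2 by (simp add: algebra_simps)
  qed
  finally show ?thesis unfolding S_def by blast
qed

text \<open>Both bad sets have less than half the size of the index set.\<close>
lemma exists_below_twice_average:
  fixes A B :: "'i \<Rightarrow> real" and U V :: real
  assumes "finite J" "J \<noteq> {}" and A0: "\<And>i. i \<in> J \<Longrightarrow> A i \<ge> 0" and B0: "\<And>i. i \<in> J \<Longrightarrow> B i \<ge> 0"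
    and A: "(\<Sum>i\<in>J. A i) \<le> card J * U" and B: "(\<Sum>i\<in>J. B i) \<le> card J * V"
  obtains i where "i \<in> J" "A i \<le> 2 * U" "B i \<le> 2 * V"
proof -
  have half: "2 * card {i \<in> J. D i > 2 * X} < card J"
    if D0: "\<And>i. i \<in> J \<Longrightarrow> D i \<ge> 0" and D: "(\<Sum>i\<in>J. D i) \<le> card J * X" for D :: "'i \<Rightarrow> real" and X :: real
  proof (cases "{i \<in> J. D i > 2 * X} = {}")
    case True
    have "2 * card ({} :: 'i set) < card J" using assms(1,2) by (simp add: card_gt_0_iff)
    then show ?thesis unfolding True .
  next
    case False
    have "0 \<le> card J * X" using D D0 by (meson order_trans sum_nonneg)
    then have X: "X \<ge> 0" using assms(1,2) by (simp add: zero_le_mult_iff card_gt_0_iff)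
    have "real (card {i \<in> J. D i > 2 * X}) * (2 * X) = (\<Sum>i\<in>{i \<in> J. D i > 2 * X}. 2 * X)" by simp
    also have "\<dots> < (\<Sum>i\<in>{i \<in> J. D i > 2 * X}. D i)"
      using False assms(1) by (intro sum_strict_mono) auto
    also have "\<dots> \<le> (\<Sum>i\<in>J. D i)" using assms(1) D0 by (intro sum_mono2) auto
    also have "\<dots> \<le> card J * X" by (rule D)
    finally have "(2 * real (card {i \<in> J. D i > 2 * X})) * X < real (card J) * X" by (simp add: mult_ac)
    then have "2 * real (card {i \<in> J. D i > 2 * X}) < real (card J)"
      using X by (rule mult_right_less_imp_less)
    then show ?thesis by linarith
  qed
  have "card ({i \<in> J. A i > 2 * U} \<union> {i \<in> J. B i > 2 * V})
      \<le> card {i \<in> J. A i > 2 * U} + card {i \<in> J. B i > 2 * V}" by (rule card_Un_le)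
  also have "\<dots> < card J" using half[OF A0 A] half[OF B0 B] by linarith
  finally have "{i \<in> J. A i > 2 * U} \<union> {i \<in> J. B i > 2 * V} \<noteq> J" by auto
  then obtain i where "i \<in> J" "\<not> A i > 2 * U" "\<not> B i > 2 * V" by auto
  then show ?thesis by (intro that) auto
qed

context near_linear
begin

text \<open>Row \<open>i0\<close> and column \<open>j0\<close> are subtracted from \<open>c\<close>
  so that both become zero, and the rest is rounded. The base is chosen later, in
  \<open>good_base\<close>.\<close>

definition entry :: "nat \<Rightarrow> nat \<Rightarrow> nat \<Rightarrow> nat \<Rightarrow> int" where
  "entry i0 j0 i j = nearest (mixed_diff c i i0 j j0)"

text \<open>Subtracting the base row and column shifts the linear form by the constant
  \<open>\<kappa>\<close> on all of \<open>Sn n\<close>. What remains apart from the integer form is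
  the linear form of the rounding errors, which has small variance; hence \<open>f\<close> minus the
  integer form is close in mean square to one real number \<open>\<nu>\<close>. This difference is
  an integer, so it equals \<open>round \<nu>\<close> or is at distance at least \<open>1/2\<close>
  from \<open>\<nu>\<close>. Chebyshev's inequality supplies the factor 4.\<close>

lemma rounding:
  assumes ij0: "i0 \<in> {1..n}" "j0 \<in> {1..n}"
    and V: "(\<Sum>i\<in>{1..n}. \<Sum>j\<in>{1..n}. rerr c (i, i0) (j, j0)) \<le> V"
  obtains b :: int where
    "real (card {\<pi> \<in> Sn n. f \<pi> \<noteq> of_int (b + (\<Sum>i\<in>{1..n}. entry i0 j0 i (\<pi> i)))})
      \<le> (8 * \<epsilon> + 16 * V / n) * fact n"
proof -
  define u where "u i j = mixed_diff c i i0 j j0 - of_int (entry i0 j0 i j)" for i j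
  define H where "H \<pi> = (\<Sum>i\<in>{1..n}. entry i0 j0 i (\<pi> i))" for \<pi>
  define \<kappa> where "\<kappa> = real n * c i0 j0 - (\<Sum>j\<in>{1..n}. c i0 j) - (\<Sum>i\<in>{1..n}. c i j0)"
  obtain \<mu> where \<mu>: "(\<Sum>\<pi>\<in>Sn n. ((\<Sum>i\<in>{1..n}. u i (\<pi> i)) - \<mu>)\<^sup>2)
    \<le> fact n * (2 * (\<Sum>i\<in>{1..n}. \<Sum>j\<in>{1..n}. (u i j)\<^sup>2) / n)"
    using linear_variance_le[OF n2, of u] by blast
  have u2: "(\<Sum>i\<in>{1..n}. \<Sum>j\<in>{1..n}. (u i j)\<^sup>2) \<le> V"
    using V by (simp add: u_def entry_def rerr_def Let_def)
  have "2 * (\<Sum>i\<in>{1..n}. \<Sum>j\<in>{1..n}. (u i j)\<^sup>2) / n \<le> 2 * V / n"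
    using u2 by (intro divide_right_mono) auto
  then have var: "(\<Sum>\<pi>\<in>Sn n. ((\<Sum>i\<in>{1..n}. u i (\<pi> i)) - \<mu>)\<^sup>2) \<le> fact n * (2 * V / n)"
    by (intro order_trans[OF \<mu>] mult_left_mono) auto
  define \<nu> where "\<nu> = \<mu> - \<kappa>"
  have split: "f \<pi> - of_int (H \<pi>) - \<nu>
      = (f \<pi> - (\<Sum>i\<in>{1..n}. c i (\<pi> i))) + ((\<Sum>i\<in>{1..n}. u i (\<pi> i)) - \<mu>)" if "\<pi> \<in> Sn n" for \<pi>
  proof -
    have "(\<Sum>i\<in>{1..n}. c i0 (\<pi> i)) = (\<Sum>j\<in>{1..n}. c i0 j)"
      using sum.permute[of \<pi> "{1..n}" "c i0"] that by (simp add: comp_def)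
    then have "(\<Sum>i\<in>{1..n}. mixed_diff c i i0 (\<pi> i) j0) = (\<Sum>i\<in>{1..n}. c i (\<pi> i)) + \<kappa>"
      by (simp add: mixed_diff_def sum.distrib sum_subtractf \<kappa>_def)
    then have "(\<Sum>i\<in>{1..n}. u i (\<pi> i)) = (\<Sum>i\<in>{1..n}. c i (\<pi> i)) + \<kappa> - of_int (H \<pi>)"
      by (simp add: u_def sum_subtractf H_def)
    then show ?thesis by (simp add: \<nu>_def)
  qed
  have sq: "(x + y)\<^sup>2 \<le> 2 * x\<^sup>2 + 2 * y\<^sup>2" for x y :: real
    using zero_le_power2[of "x - y"] by (simp add: power2_sum power2_diff)
  have "(\<Sum>\<pi>\<in>Sn n. (f \<pi> - of_int (H \<pi>) - \<nu>)\<^sup>2)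
      \<le> (\<Sum>\<pi>\<in>Sn n. 2 * (f \<pi> - (\<Sum>i\<in>{1..n}. c i (\<pi> i)))\<^sup>2 + 2 * ((\<Sum>i\<in>{1..n}. u i (\<pi> i)) - \<mu>)\<^sup>2)"
    using sq by (intro sum_mono) (simp only: split)
  also have "\<dots> = 2 * (\<Sum>\<pi>\<in>Sn n. (f \<pi> - (\<Sum>i\<in>{1..n}. c i (\<pi> i)))\<^sup>2)
      + 2 * (\<Sum>\<pi>\<in>Sn n. ((\<Sum>i\<in>{1..n}. u i (\<pi> i)) - \<mu>)\<^sup>2)"
    by (simp only: sum.distrib sum_distrib_left)
  also have "\<dots> \<le> 2 * (\<epsilon> * fact n) + 2 * (fact n * (2 * V / n))"
    using err var by (intro add_mono mult_left_mono) auto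
  finally have tot: "(\<Sum>\<pi>\<in>Sn n. (f \<pi> - of_int (H \<pi>) - \<nu>)\<^sup>2) \<le> (2 * \<epsilon> + 4 * V / n) * fact n"
    by (simp add: algebra_simps)
  define b where "b = round \<nu>"
  let ?bad = "{\<pi> \<in> Sn n. f \<pi> \<noteq> of_int (b + H \<pi>)}"
  have far: "1 / 4 \<le> (f \<pi> - of_int (H \<pi>) - \<nu>)\<^sup>2" if "\<pi> \<in> ?bad" for \<pi>
  proof -
    have "f \<pi> = of_int 0 \<or> f \<pi> = of_int 1" using boolean[of \<pi>] that by simp
    then obtain k :: int where k: "f \<pi> = of_int k" by blast
    then have "k - H \<pi> \<noteq> b" using that by auto
    then have "\<bar>real_of_int (k - H \<pi>) - of_int b\<bar> \<ge> 1"
      by (metis of_int_diff of_int_abs of_int_1_le_iff right_minus_eq zero_less_abs_iff int_one_le_iff_zero_less)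
    moreover have "\<bar>of_int b - \<nu>\<bar> \<le> 1 / 2" unfolding b_def by (rule of_int_round_abs_le)
    ultimately have "\<bar>f \<pi> - of_int (H \<pi>) - \<nu>\<bar> \<ge> 1 / 2" unfolding k of_int_diff by linarith
    then have "\<bar>f \<pi> - of_int (H \<pi>) - \<nu>\<bar>\<^sup>2 \<ge> (1 / 2)\<^sup>2" by (intro power_mono) auto
    then show ?thesis by (simp add: power2_eq_square)
  qed
  have "real (card ?bad) * (1 / 4) = (\<Sum>\<pi>\<in>?bad. 1 / 4)" by simp
  also have "\<dots> \<le> (\<Sum>\<pi>\<in>?bad. (f \<pi> - of_int (H \<pi>) - \<nu>)\<^sup>2)" by (intro sum_mono far)
  also have "\<dots> \<le> (\<Sum>\<pi>\<in>Sn n. (f \<pi> - of_int (H \<pi>) - \<nu>)\<^sup>2)" by (intro sum_mono2) auto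
  also note tot
  finally have "real (card ?bad) \<le> (8 * \<epsilon> + 16 * V / n) * fact n" by (simp add: algebra_simps)
  then show ?thesis unfolding H_def by (rule that)
qed

text \<open>Inversion of permutations exchanges rows and columns, so every result about a row also
  yields one about a column.\<close>

lemma transposed: "near_linear n (\<lambda>\<pi>. f (inv \<pi>)) (\<lambda>i j. c j i) \<epsilon>"
proof
  show "f (inv \<pi>) \<in> {0, 1}" if "\<pi> \<in> Sn n" for \<pi>
    using that by (intro boolean) (auto intro: permutes_inv)
  have "(\<Sum>\<pi>\<in>Sn n. (f (inv \<pi>) - (\<Sum>i\<in>{1..n}. c (\<pi> i) i))\<^sup>2)
      = (\<Sum>\<pi>\<in>Sn n. (f (inv \<pi>) - (\<Sum>i\<in>{1..n}. c i (inv \<pi> i)))\<^sup>2)"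
  proof (intro sum.cong refl)
    fix \<pi> assume "\<pi> \<in> Sn n"
    then have \<pi>: "\<pi> permutes {1..n}" by simp
    have "(\<Sum>i\<in>{1..n}. c (\<pi> i) i) = (\<Sum>i\<in>{1..n}. c i (inv \<pi> i))"
      using sum_Sn_relabel[OF \<pi>, of c id] by simp
    then show "(f (inv \<pi>) - (\<Sum>i\<in>{1..n}. c (\<pi> i) i))\<^sup>2 = (f (inv \<pi>) - (\<Sum>i\<in>{1..n}. c i (inv \<pi> i)))\<^sup>2"
      by simp
  qed
  also have "\<dots> = (\<Sum>\<pi>\<in>Sn n. (f \<pi> - (\<Sum>i\<in>{1..n}. c i (\<pi> i)))\<^sup>2)"
    using sum_permutations_inverse[of "\<lambda>\<pi>. (f \<pi> - (\<Sum>i\<in>{1..n}. c i (\<pi> i)))\<^sup>2" "{1..n}"] by simp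
  finally show "(\<Sum>\<pi>\<in>Sn n. (f (inv \<pi>) - (\<Sum>i\<in>{1..n}. c (\<pi> i) i))\<^sup>2) \<le> \<epsilon> * fact n"
    using err by simp
qed (rule n2)

text \<open>If every line carried less than \<open>n ^ 3 / 1280\<close>, then in
  \<open>total_act_sq_le\<close> the lines would contribute at most \<open>n ^ 3 / 160\<close> times
  the total activity, and pairs lying apart at most half of its square. Together this forces the
  activity down to \<open>n ^ 3 / 80\<close>.\<close>

lemma influential_line:
  assumes n10: "n \<ge> 10" and small: "\<epsilon> \<le> 1 / 10 ^ 20"
    and large: "total_act n c > real n ^ 3 / 80"
  obtains r where "r \<in> {1..n}" "row_act n c r \<ge> real n ^ 3 / 1280"
  | s where "s \<in> {1..n}" "row_act n (\<lambda>i j. c j i) s \<ge> real n ^ 3 / 1280"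
proof -
  let ?N = "total_act n c"
  define x where "x = real n ^ 3"
  have x0: "x > 0" using n10 by (simp add: x_def)
  have large': "?N > x / 80" using large by (simp add: x_def)
  have "\<exists>r\<in>{1..n}. row_act n c r \<ge> x / 1280 \<or> row_act n (\<lambda>i j. c j i) r \<ge> x / 1280"
  proof (rule ccontr)
    assume no: "\<not> ?thesis"
    have 1: "?N\<^sup>2 \<le> apart_act n c (\<lambda>_. 1) + 8 * (x / 1280) * ?N"
      using no by (intro total_act_sq_le) force+
    \<comment> \<open>The choice \<open>M = 10 ^ 9\<close> makes \<open>432 / M\<close> negligible,
      and the bound on \<open>\<epsilon>\<close> then takes care of the other term. The target is
      \<open>1 / 204800 = 1 / (2 * 16 * 80\<^sup>2)\<close>.\<close>
    have W: "apart_act n c (\<lambda>_. 1) \<le> 16 * real n ^ 6 * (3100 * \<epsilon> * (1000000000 + 2) + 432 / 1000000000)"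
      using small by (intro apart_act_le n10) auto
    have "3100 * \<epsilon> * (1000000000 + 2) + 432 / 1000000000 \<le> 1 / 204800" using small by simp
    then have "16 * real n ^ 6 * (3100 * \<epsilon> * (1000000000 + 2) + 432 / 1000000000) \<le> 16 * real n ^ 6 * (1 / 204800)"
      by (intro mult_left_mono) auto
    also have "\<dots> = (x / 80)\<^sup>2 / 2" by (simp add: x_def power2_eq_square flip: power_add)
    also have "(x / 80)\<^sup>2 \<le> ?N\<^sup>2" using large' x0 by (intro power_mono) auto
    finally have "?N\<^sup>2 \<le> ?N\<^sup>2 / 2 + x / 160 * ?N" using 1 W by simp
    then have "?N * ?N \<le> (x / 80) * ?N" by (simp add: power2_eq_square field_simps)
    then have "?N \<le> x / 80" using large' x0 by (simp add: mult_le_cancel_right)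
    then show False using large' by simp
  qed
  then show ?thesis using that unfolding x_def by blast
qed

end

subsection \<open>Hits of cosets and the two cases for large degree\<close>

definition hit :: "nat \<times> nat \<Rightarrow> (nat \<Rightarrow> nat) \<Rightarrow> real" where
  "hit a \<pi> = of_bool (\<pi> (fst a) = snd a)"

lemma sum_of_bool_eq_card:
  "finite A \<Longrightarrow> (\<Sum>x\<in>A. of_bool (P x) :: real) = real (card {x \<in> A. P x})"
  by (simp add: of_bool_def sum.If_cases Int_def)

lemma hit_cases: "hit a \<pi> = 0 \<or> hit a \<pi> = 1"
  by (simp add: hit_def)

lemma hit_nonneg [simp]: "hit a \<pi> \<ge> 0" and hit_square [simp]: "hit a \<pi> * hit a \<pi> = hit a \<pi>"
  by (auto simp: hit_def)

lemma sum_hit_eq_card: "finite T \<Longrightarrow> (\<Sum>a\<in>T. hit a \<pi>) = real (card {a \<in> T. \<pi> (fst a) = snd a})"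
  by (simp add: hit_def of_bool_def sum.If_cases Int_def)

lemma Sn_app: "\<pi> \<in> Sn n \<Longrightarrow> i \<in> {1..n} \<Longrightarrow> \<pi> i \<in> {1..n}"
  using permutes_in_image[of \<pi> "{1..n}" i] by simp

lemma Sn_eq_iff: "\<pi> \<in> Sn n \<Longrightarrow> \<pi> i = \<pi> j \<longleftrightarrow> i = j"
  using inj_eq[of \<pi> i j] permutes_inj[of \<pi> "{1..n}"] by simp

lemma hit_clash:
  assumes "\<pi> \<in> Sn n" "a \<noteq> b" "\<not> (fst a \<noteq> fst b \<and> snd a \<noteq> snd b)"
  shows "hit a \<pi> * hit b \<pi> = 0"
proof -
  have "\<not> (\<pi> (fst a) = snd a \<and> \<pi> (fst b) = snd b)"
    using assms(2,3) Sn_eq_iff[OF assms(1), of "fst a" "fst b"] by (metis prod_eq_iff)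
  then show ?thesis by (auto simp: hit_def)
qed

text \<open>Equality fails when two labels of \<open>T\<close> contradict each other, for then no
  permutation satisfies them all.\<close>

lemma card_prescribed_le:
  assumes "T \<subseteq> grid n"
  shows "card {\<pi> \<in> Sn n. \<forall>a\<in>T. \<pi> (fst a) = snd a} \<le> fact (n - card T)"
proof (cases "{\<pi> \<in> Sn n. \<forall>a\<in>T. \<pi> (fst a) = snd a} = {}")
  case False
  then obtain \<rho> where \<rho>: "\<rho> permutes {1..n}" "\<And>a. a \<in> T \<Longrightarrow> \<rho> (fst a) = snd a" by auto
  have inj: "inj_on fst T" using \<rho>(2) by (auto simp: inj_on_def prod_eq_iff) metis
  have "{\<pi> \<in> Sn n. \<forall>a\<in>T. \<pi> (fst a) = snd a} = {\<pi> \<in> Sn n. \<forall>i\<in>fst ` T. \<pi> i = \<rho> i}"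
    using \<rho>(2) by auto
  also have "card \<dots> = fact (n - card (fst ` T))"
  proof (rule card_permutes_prescribed)
    show "fst ` T \<subseteq> {1..n}" using assms by auto
    then show "\<rho> ` fst ` T \<subseteq> {1..n}" using permutes_image[OF \<rho>(1)] by blast
    show "inj_on \<rho> (fst ` T)" using permutes_inj[OF \<rho>(1)] inj_on_subset by blast
  qed
  finally show ?thesis using card_image[OF inj] by simp
qed (simp only: card.empty)

lemma sum_hit_one:
  assumes "a \<in> grid n"
  shows "(\<Sum>\<pi>\<in>Sn n. hit a \<pi>) = fact (n - 1)"
proof -
  have "card {\<pi> \<in> Sn n. \<forall>i\<in>{fst a}. \<pi> i = snd a} = fact (n - card {fst a})"
    using assms by (intro card_permutes_prescribed) auto
  then show ?thesis by (simp add: hit_def of_bool_def sum.If_cases Int_def)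
qed

lemma sum_hit_two:
  assumes "a \<in> grid n" "b \<in> grid n" "fst a \<noteq> fst b" "snd a \<noteq> snd b"
  shows "(\<Sum>\<pi>\<in>Sn n. hit a \<pi> * hit b \<pi>) = fact (n - 2)"
proof -
  let ?h = "\<lambda>i. if i = fst a then snd a else snd b"
  have "card {\<pi> \<in> Sn n. \<forall>i\<in>{fst a, fst b}. \<pi> i = ?h i} = fact (n - card {fst a, fst b})"
    using assms by (intro card_permutes_prescribed) (auto simp: inj_on_def)
  moreover have "{\<pi> \<in> Sn n. \<forall>i\<in>{fst a, fst b}. \<pi> i = ?h i} = {\<pi> \<in> Sn n. \<pi> (fst a) = snd a \<and> \<pi> (fst b) = snd b}"
    using assms(3) by auto
  moreover have "(\<Sum>\<pi>\<in>Sn n. hit a \<pi> * hit b \<pi>) = real (card {\<pi> \<in> Sn n. \<pi> (fst a) = snd a \<and> \<pi> (fst b) = snd b})"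
  proof -
    have "hit a \<pi> * hit b \<pi> = of_bool (\<pi> (fst a) = snd a \<and> \<pi> (fst b) = snd b)" for \<pi>
      by (simp add: hit_def)
    then show ?thesis by (simp only: sum_of_bool_eq_card[OF finite_Sn] mem_Collect_eq)
  qed
  ultimately show ?thesis using assms(3) by (simp add: numeral_2_eq_2)
qed

lemma sum_hit_two_le:
  assumes "a \<in> grid n" "b \<in> grid n" "a \<noteq> b"
  shows "(\<Sum>\<pi>\<in>Sn n. hit a \<pi> * hit b \<pi>) \<le> fact (n - 2)"
proof (cases "fst a \<noteq> fst b \<and> snd a \<noteq> snd b")
  case True
  then show ?thesis using sum_hit_two assms by simp
next
  case False
  then have "(\<Sum>\<pi>\<in>Sn n. hit a \<pi> * hit b \<pi>) = 0"
    using hit_clash assms(3) by (intro sum.neutral) blast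
  then show ?thesis by simp
qed

lemma sum_hit_three_le:
  assumes "a \<in> grid n" "b \<in> grid n" "c \<in> grid n" "a \<noteq> b" "a \<noteq> c" "b \<noteq> c"
  shows "(\<Sum>\<pi>\<in>Sn n. hit a \<pi> * hit b \<pi> * hit c \<pi>) \<le> fact (n - 3)"
proof -
  have "card {\<pi> \<in> Sn n. \<forall>x\<in>{a, b, c}. \<pi> (fst x) = snd x} \<le> fact (n - card {a, b, c})"
    using assms by (intro card_prescribed_le) auto
  then have "card {\<pi> \<in> Sn n. \<pi> (fst a) = snd a \<and> \<pi> (fst b) = snd b \<and> \<pi> (fst c) = snd c} \<le> fact (n - 3)"
    using assms(4-6) by (simp add: numeral_3_eq_3)
  then have "real (card {\<pi> \<in> Sn n. \<pi> (fst a) = snd a \<and> \<pi> (fst b) = snd b \<and> \<pi> (fst c) = snd c}) \<le> real (fact (n - 3))"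
    by (simp only: of_nat_le_iff)
  moreover have "(\<Sum>\<pi>\<in>Sn n. hit a \<pi> * hit b \<pi> * hit c \<pi>)
    = real (card {\<pi> \<in> Sn n. \<pi> (fst a) = snd a \<and> \<pi> (fst b) = snd b \<and> \<pi> (fst c) = snd c})"
  proof -
    have "hit a \<pi> * hit b \<pi> * hit c \<pi> = of_bool (\<pi> (fst a) = snd a \<and> \<pi> (fst b) = snd b \<and> \<pi> (fst c) = snd c)" for \<pi>
      by (simp add: hit_def)
    then show ?thesis by (simp only: sum_of_bool_eq_card[OF finite_Sn] mem_Collect_eq)
  qed
  ultimately show ?thesis by (simp only: of_nat_fact)
qed

lemma card_hit_Un_le:
  assumes "S \<subseteq> grid n"
  shows "real (card {\<pi> \<in> Sn n. \<exists>a\<in>S. \<pi> (fst a) = snd a}) \<le> real (card S) * fact (n - 1)"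
proof -
  have fin: "finite S" using assms finite_subset by blast
  have "real (card {\<pi> \<in> Sn n. \<exists>a\<in>S. \<pi> (fst a) = snd a}) = (\<Sum>\<pi>\<in>Sn n. of_bool (\<exists>a\<in>S. \<pi> (fst a) = snd a))"
    by (simp add: of_bool_def sum.If_cases Int_def)
  also have "\<dots> \<le> (\<Sum>\<pi>\<in>Sn n. \<Sum>a\<in>S. hit a \<pi>)"
  proof (rule sum_mono)
    fix \<pi>
    show "of_bool (\<exists>a\<in>S. \<pi> (fst a) = snd a) \<le> (\<Sum>a\<in>S. hit a \<pi>)"
    proof (cases "\<exists>a\<in>S. \<pi> (fst a) = snd a")
      case True
      then obtain a where "a \<in> S" "hit a \<pi> = 1" by (auto simp: hit_def)
      then have "1 \<le> (\<Sum>a\<in>S. hit a \<pi>)" using fin member_le_sum[of a S "\<lambda>a. hit a \<pi>"] by simp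
      then show ?thesis by simp
    qed (simp add: sum_nonneg)
  qed
  also have "\<dots> = (\<Sum>a\<in>S. \<Sum>\<pi>\<in>Sn n. hit a \<pi>)" by (rule sum.swap)
  also have "\<dots> = (\<Sum>a\<in>S. fact (n - 1))" using assms by (intro sum.cong refl sum_hit_one) auto
  finally show ?thesis by simp
qed

lemma coset_max_eq:
  assumes "finite C"
  shows "coset_max C \<pi> = of_bool (\<exists>a\<in>C. \<pi> (fst a) = snd a)"
proof (cases "C = {}")
  case False
  have "Max ((\<lambda>(i, j). x_ind i j \<pi>) ` C) = of_bool (\<exists>a\<in>C. \<pi> (fst a) = snd a)"
  proof (rule Max_eqI)
    show "finite ((\<lambda>(i, j). x_ind i j \<pi>) ` C)" using assms by simp
    show "y \<le> of_bool (\<exists>a\<in>C. \<pi> (fst a) = snd a)" if "y \<in> (\<lambda>(i, j). x_ind i j \<pi>) ` C" for y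
      using that by (auto simp: x_ind_def split: if_splits)
    show "of_bool (\<exists>a\<in>C. \<pi> (fst a) = snd a) \<in> (\<lambda>(i, j). x_ind i j \<pi>) ` C"
    proof (cases "\<exists>a\<in>C. \<pi> (fst a) = snd a")
      case True
      then obtain a where "a \<in> C" "\<pi> (fst a) = snd a" by blast
      then show ?thesis using True by (intro image_eqI[of _ _ a]) (auto simp: x_ind_def case_prod_beta)
    next
      case no: False
      obtain a where "a \<in> C" using False by blast
      then show ?thesis using no by (intro image_eqI[of _ _ a]) (auto simp: x_ind_def case_prod_beta)
    qed
  qed
  then show ?thesis using False by (simp add: coset_max_def)
qed (simp add: coset_max_def)

section \<open>Ordered crossing pairs and unordered non-disjoint pairs of cosets\<close>

definition crossing_pairs :: "(nat \<times> nat) set \<Rightarrow> ((nat \<times> nat) \<times> nat \<times> nat) set" where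
  "crossing_pairs C = {(a, b). a \<in> C \<and> b \<in> C \<and> fst a \<noteq> fst b \<and> snd a \<noteq> snd b}"

lemma finite_crossing_pairs: "finite C \<Longrightarrow> finite (crossing_pairs C)"
  by (rule finite_subset[of _ "C \<times> C"]) (auto simp: crossing_pairs_def)

lemma nondisjoint_pairs_eq:
  assumes "C \<subseteq> grid n"
  shows "nondisjoint_pairs n C = (\<lambda>(a, b). {a, b}) ` crossing_pairs C"
proof -
  have *: "perm_coset n a \<inter> perm_coset n b \<noteq> {} \<longleftrightarrow> fst a \<noteq> fst b \<and> snd a \<noteq> snd b"
    if "a \<in> C" "b \<in> C" "a \<noteq> b" for a b
  proof -
    have "perm_coset n (fst a, snd a) \<inter> perm_coset n (fst b, snd b) \<noteq> {} \<longleftrightarrow> fst a \<noteq> fst b \<and> snd a \<noteq> snd b"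
      using that assms by (intro perm_coset_nondisjoint_iff) (auto simp: prod_eq_iff)
    then show ?thesis by simp
  qed
  show ?thesis
  proof (intro equalityI subsetI)
    fix x assume "x \<in> nondisjoint_pairs n C"
    then obtain a b where ab: "x = {a, b}" "a \<in> C" "b \<in> C" "a \<noteq> b" "perm_coset n a \<inter> perm_coset n b \<noteq> {}"
      unfolding nondisjoint_pairs_def by blast
    then have "(a, b) \<in> crossing_pairs C" using * by (simp add: crossing_pairs_def)
    then show "x \<in> (\<lambda>(a, b). {a, b}) ` crossing_pairs C"
      using ab(1) by (intro image_eqI[of _ _ "(a, b)"]) simp_all
  next
    fix x assume "x \<in> (\<lambda>(a, b). {a, b}) ` crossing_pairs C"
    then obtain a b where ab: "x = {a, b}" "a \<in> C" "b \<in> C" "fst a \<noteq> fst b" "snd a \<noteq> snd b"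
      unfolding crossing_pairs_def by auto
    then have "a \<noteq> b" by blast
    with ab *[of a b] have "perm_coset n a \<inter> perm_coset n b \<noteq> {}" by blast
    with ab \<open>a \<noteq> b\<close> show "x \<in> nondisjoint_pairs n C"
      unfolding nondisjoint_pairs_def by blast
  qed
qed

lemma card_nondisjoint_pairs_le:
  assumes "C \<subseteq> grid n"
  shows "card (nondisjoint_pairs n C) \<le> card (crossing_pairs C)"
  unfolding nondisjoint_pairs_eq[OF assms]
  using assms finite_subset by (intro card_image_le finite_crossing_pairs) blast

text \<open>Different labels that share a row or a column are never hit together, so the crossing
  pairs already account for the whole second factorial moment of the number of hits.\<close>

lemma sum_crossing_pairs_hits:
  assumes "\<pi> \<in> Sn n" "finite C"
  shows "(\<Sum>(a, c)\<in>crossing_pairs C. hit a \<pi> * hit c \<pi>)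
    = (\<Sum>a\<in>C. hit a \<pi>) * ((\<Sum>a\<in>C. hit a \<pi>) - 1)"
proof -
  have "(\<Sum>(a, c)\<in>crossing_pairs C. hit a \<pi> * hit c \<pi>) = (\<Sum>(a, c)\<in>Sigma C (\<lambda>a. C - {a}). hit a \<pi> * hit c \<pi>)"
  proof (rule sum.mono_neutral_left)
    show "\<forall>i\<in>Sigma C (\<lambda>a. C - {a}) - crossing_pairs C. (case i of (a, c) \<Rightarrow> hit a \<pi> * hit c \<pi>) = 0"
    proof
      fix x assume x: "x \<in> Sigma C (\<lambda>a. C - {a}) - crossing_pairs C"
      obtain a c where ac: "x = (a, c)" by (cases x)
      have "a \<noteq> c" "\<not> (fst a \<noteq> fst c \<and> snd a \<noteq> snd c)"
        using x unfolding ac crossing_pairs_def by blast+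
      then show "(case x of (a, c) \<Rightarrow> hit a \<pi> * hit c \<pi>) = 0"
        unfolding ac prod.case by (rule hit_clash[OF assms(1)])
    qed
  qed (use assms(2) in \<open>auto simp: crossing_pairs_def\<close>)
  also have "\<dots> = (\<Sum>a\<in>C. \<Sum>c\<in>C - {a}. hit a \<pi> * hit c \<pi>)"
    using assms(2) by (simp add: sum.Sigma)
  also have "\<dots> = (\<Sum>a\<in>C. hit a \<pi>) * ((\<Sum>a\<in>C. hit a \<pi>) - 1)"
    by (rule indicator_pair_sum(1)[OF assms(2) hit_cases])
  finally show ?thesis .
qed

text \<open>Here \<open>p\<close> and \<open>q\<close> are the numbers of entries 1 and -1 that are
  hit. The left sides are positive only for \<open>p = 0\<close>, \<open>q = 1\<close> and for
  \<open>p = 2\<close>, \<open>q = 0\<close>, where \<open>p - q\<close> is -1 or 2 and cannot be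
  Boolean. They are polynomials in the hits, so their means are accessible through moments, unlike
  the indicators of these events.\<close>

lemma small_support_pointwise:
  fixes p q :: real
  assumes p: "p = real p'" and q: "q = real q'" and fv: "fv = 0 \<or> fv = 1"
  shows "q * (2 - (p + q)) \<le> of_bool (fv \<noteq> p - q)"
    and "p * (p - 1) * (3 - (p + q)) \<le> 2 * of_bool (fv \<noteq> p - q)"
proof -
  consider "q' = 0" | "q' = 1" "p' = 0" | "q' \<ge> 1" "p' + q' \<ge> 2" by linarith
  then show "q * (2 - (p + q)) \<le> of_bool (fv \<noteq> p - q)"
  proof cases
    case 2
    then show ?thesis using fv by (auto simp: p q)
  next
    case 3
    then have "q * (2 - (p + q)) \<le> 0" by (intro mult_nonneg_nonpos) (auto simp: p q)
    also have "0 \<le> (of_bool (fv \<noteq> p - q) :: real)" by simp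
    finally show ?thesis .
  qed (auto simp: p q)
  consider "p' = 0 \<or> p' = 1" | "p' = 2" "q' = 0" | "p' \<ge> 2" "p' + q' \<ge> 3" by linarith
  then show "p * (p - 1) * (3 - (p + q)) \<le> 2 * of_bool (fv \<noteq> p - q)"
  proof cases
    case 2
    then show ?thesis using fv by (auto simp: p q)
  next
    case 3
    then have "p * (p - 1) * (3 - (p + q)) \<le> 0" by (intro mult_nonneg_nonpos) (auto simp: p q)
    also have "0 \<le> (2 * of_bool (fv \<noteq> p - q) :: real)" by simp
    finally show ?thesis .
  qed (auto simp: p q)
qed

lemma sum_int_entries_eq_hits:
  fixes d :: "nat \<Rightarrow> nat \<Rightarrow> int"
  assumes "\<pi> \<in> Sn n" and d: "\<And>i j. d i j \<in> {-1, 0, 1}"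
  shows "real_of_int (\<Sum>i\<in>{1..n}. d i (\<pi> i))
    = (\<Sum>a\<in>{a \<in> grid n. d (fst a) (snd a) = 1}. hit a \<pi>)
      - (\<Sum>a\<in>{a \<in> grid n. d (fst a) (snd a) = -1}. hit a \<pi>)"
proof -
  have "real_of_int (d i (\<pi> i)) = (\<Sum>j\<in>{1..n}. of_int (d i j) * hit (i, j) \<pi>)" if "i \<in> {1..n}" for i
  proof -
    have "\<pi> i \<in> {1..n}" using Sn_app[OF assms(1) that] .
    then show ?thesis by (simp add: hit_def of_bool_def if_distrib cong: if_cong)
  qed
  then have "real_of_int (\<Sum>i\<in>{1..n}. d i (\<pi> i)) = (\<Sum>a\<in>grid n. of_int (d (fst a) (snd a)) * hit a \<pi>)"
    by (simp add: sum_over_pairs)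
  also have "\<dots> = (\<Sum>a\<in>grid n. (if d (fst a) (snd a) = 1 then hit a \<pi> else 0)
      - (if d (fst a) (snd a) = -1 then hit a \<pi> else 0))"
  proof (rule sum.cong[OF refl])
    fix a
    show "of_int (d (fst a) (snd a)) * hit a \<pi> = (if d (fst a) (snd a) = 1 then hit a \<pi> else 0)
      - (if d (fst a) (snd a) = -1 then hit a \<pi> else 0)"
      using d[of "fst a" "snd a"] by auto
  qed
  also have "\<dots> = (\<Sum>a\<in>{a \<in> grid n. d (fst a) (snd a) = 1}. hit a \<pi>)
      - (\<Sum>a\<in>{a \<in> grid n. d (fst a) (snd a) = -1}. hit a \<pi>)"
    unfolding sum_subtractf by (simp only: sum.inter_filter[symmetric] finite_cartesian_product finite_atLeastAtMost)
  finally show ?thesis .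
qed

text \<open>A permutation hits some nonzero entry with probability at most \<open>1/20\<close>.
  Hence \<open>f\<close> equals \<open>b\<close> on at least \<open>1 - 1/4 - 1/20 = 7/10\<close> of
  \<open>Sn n\<close>, which excludes \<open>b = 1\<close> by the mean.\<close>

lemma small_support_const_zero:
  fixes f :: "(nat \<Rightarrow> nat) \<Rightarrow> real" and d :: "nat \<Rightarrow> nat \<Rightarrow> int"
  assumes n3: "3 \<le> n" and f: "\<And>\<pi>. \<pi> \<in> Sn n \<Longrightarrow> f \<pi> \<in> {0, 1}"
    and mean: "(\<Sum>\<pi>\<in>Sn n. f \<pi>) \<le> fact n / 2"
    and \<delta>: "\<delta> \<le> 1 / 4"
    and supp: "real (card {a \<in> grid n. d (fst a) (snd a) \<noteq> 0}) \<le> real n / 20"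
    and bad: "real (card {\<pi> \<in> Sn n. f \<pi> \<noteq> of_int (b + (\<Sum>i\<in>{1..n}. d i (\<pi> i)))}) \<le> \<delta> * fact n"
  shows "b = 0"
proof -
  let ?S = "{a \<in> grid n. d (fst a) (snd a) \<noteq> 0}"
  let ?B = "{\<pi> \<in> Sn n. f \<pi> \<noteq> of_int (b + (\<Sum>i\<in>{1..n}. d i (\<pi> i)))}"
  let ?H = "{\<pi> \<in> Sn n. \<exists>a\<in>?S. \<pi> (fst a) = snd a}"
  have F: "(fact n :: real) = real n * fact (n - 1)" using n3 by (simp add: fact_reduce)
  have "real (card ?H) \<le> real (card ?S) * fact (n - 1)" by (rule card_hit_Un_le) auto
  also have "\<dots> \<le> (real n / 20) * fact (n - 1)" using supp by (intro mult_right_mono) auto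
  finally have H: "real (card ?H) \<le> fact n / 20" by (simp add: F)
  have "real (card (?B \<union> ?H)) \<le> real (card ?B) + real (card ?H)"
    using card_Un_le[of ?B ?H] by linarith
  also have "\<dots> \<le> 1 / 4 * fact n + fact n / 20"
  proof -
    have "\<delta> * fact n \<le> 1 / 4 * (fact n :: real)" using \<delta> by (intro mult_right_mono) auto
    then show ?thesis using bad H by linarith
  qed
  finally have BH: "real (card (?B \<union> ?H)) \<le> 3 / 10 * fact n" by simp
  have val: "f \<pi> = of_int b" if "\<pi> \<in> Sn n - (?B \<union> ?H)" for \<pi>
  proof -
    have "d i (\<pi> i) = 0" if i: "i \<in> {1..n}" for i
    proof (rule ccontr)
      assume "d i (\<pi> i) \<noteq> 0"
      moreover have "\<pi> i \<in> {1..n}"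
        using \<open>\<pi> \<in> Sn n - (?B \<union> ?H)\<close> by (intro Sn_app[OF _ i]) auto
      ultimately have "(i, \<pi> i) \<in> ?S" using i by auto
      then have "\<pi> \<in> ?H" using \<open>\<pi> \<in> Sn n - (?B \<union> ?H)\<close> by force
      then show False using \<open>\<pi> \<in> Sn n - (?B \<union> ?H)\<close> by blast
    qed
    then have "(\<Sum>i\<in>{1..n}. d i (\<pi> i)) = 0" by simp
    moreover have "f \<pi> = of_int (b + (\<Sum>i\<in>{1..n}. d i (\<pi> i)))" using that by blast
    ultimately show ?thesis by presburger
  qed
  have "real (card (Sn n - (?B \<union> ?H))) \<ge> 7 / 10 * fact n"
  proof -
    have "card (Sn n - (?B \<union> ?H)) = card (Sn n) - card (?B \<union> ?H)"
      by (rule card_Diff_subset) (auto intro: finite_subset[OF _ finite_Sn])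
    moreover have "card (?B \<union> ?H) \<le> card (Sn n)" by (rule card_mono) auto
    ultimately have "real (card (Sn n - (?B \<union> ?H))) = fact n - real (card (?B \<union> ?H))"
      by (simp add: of_nat_diff)
    then show ?thesis using BH by linarith
  qed
  then have G: "real (card (Sn n - (?B \<union> ?H))) > fact n / 2"
    using fact_gt_zero[of n, where 'a = real] by linarith
  have "Sn n - (?B \<union> ?H) \<noteq> {}"
  proof
    assume "Sn n - (?B \<union> ?H) = {}"
    then have "real (card (Sn n - (?B \<union> ?H))) = 0" by (simp only: card.empty of_nat_0)
    then show False using G fact_gt_zero[of n, where 'a = real] by linarith
  qed
  then obtain \<pi> where "\<pi> \<in> Sn n - (?B \<union> ?H)" unfolding ex_in_conv[symmetric] by (elim exE)
  then have "f \<pi> = of_int b" "f \<pi> \<in> {0, 1}" using val f DiffD1 by blast+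
  then have "b = 0 \<or> b = 1" by simp
  moreover have "b \<noteq> 1"
  proof
    assume b: "b = 1"
    have "real (card (Sn n - (?B \<union> ?H))) = (\<Sum>\<pi>\<in>Sn n - (?B \<union> ?H). f \<pi>)" using val b by (simp only: of_int_1 sum_constant mult_1_right cong: sum.cong)
    also have "\<dots> \<le> (\<Sum>\<pi>\<in>Sn n. f \<pi>)" using f by (intro sum_mono2) force+
    finally show False using mean G by linarith
  qed
  ultimately show ?thesis by blast
qed

text \<open>Given that a negative entry is hit, or both members of a crossing pair of positive
  entries, at most \<open>1/2\<close> further nonzero entries are hit on average. So
  \<open>2 - s\<close>, respectively \<open>3 - s\<close>, has conditional mean at least
  \<open>1/2\<close>, and \<open>small_support_pointwise\<close> charges each such entry or pair to
  permutations on which the integer form is wrong.\<close>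

lemma small_support:
  fixes f :: "(nat \<Rightarrow> nat) \<Rightarrow> real" and d :: "nat \<Rightarrow> nat \<Rightarrow> int"
  assumes n3: "3 \<le> n" and f: "\<And>\<pi>. \<pi> \<in> Sn n \<Longrightarrow> f \<pi> \<in> {0, 1}"
    and mean: "(\<Sum>\<pi>\<in>Sn n. f \<pi>) \<le> fact n / 2"
    and \<delta>: "\<delta> \<le> 1 / 4" and d: "\<And>i j. d i j \<in> {-1, 0, 1}"
    and supp: "real (card {a \<in> grid n. d (fst a) (snd a) \<noteq> 0}) \<le> real n / 20"
    and bad: "real (card {\<pi> \<in> Sn n. f \<pi> \<noteq> of_int (b + (\<Sum>i\<in>{1..n}. d i (\<pi> i)))}) \<le> \<delta> * fact n"
  defines "C \<equiv> {a \<in> grid n. d (fst a) (snd a) = 1}"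
  shows "real (card {\<pi> \<in> Sn n. f \<pi> \<noteq> coset_max C \<pi>}) \<le> 3 * \<delta> * fact n"
    and "real (card (nondisjoint_pairs n C)) \<le> 4 * \<delta> * (real n)\<^sup>2"
proof -
  let ?S = "{a \<in> grid n. d (fst a) (snd a) \<noteq> 0}"
  let ?N = "{a \<in> grid n. d (fst a) (snd a) = -1}"
  let ?B = "{\<pi> \<in> Sn n. f \<pi> \<noteq> of_int (b + (\<Sum>i\<in>{1..n}. d i (\<pi> i)))}"
  have b: "b = 0" using small_support_const_zero[OF n3 f mean \<delta> supp bad] .
  define s where "s \<pi> = (\<Sum>a\<in>?S. hit a \<pi>)" for \<pi>
  define p where "p \<pi> = (\<Sum>a\<in>C. hit a \<pi>)" for \<pi>
  define q where "q \<pi> = (\<Sum>a\<in>?N. hit a \<pi>)" for \<pi>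
  have fin: "finite ?S" "finite C" "finite ?N" unfolding C_def by auto
  have SU: "?S = C \<union> ?N"
  proof -
    have "d i j \<noteq> 0 \<longleftrightarrow> d i j = 1 \<or> d i j = -1" for i j using d[of i j] by auto
    then show ?thesis unfolding C_def by auto
  qed
  have s: "s \<pi> = p \<pi> + q \<pi>" for \<pi>
    unfolding s_def p_def q_def SU using fin by (intro sum.union_disjoint) (auto simp: C_def)
  have B: "\<pi> \<in> ?B \<longleftrightarrow> f \<pi> \<noteq> p \<pi> - q \<pi>" if "\<pi> \<in> Sn n" for \<pi>
    using sum_int_entries_eq_hits[of \<pi> n d, OF that d] that b unfolding p_def q_def C_def by auto
  have cardB: "(\<Sum>\<pi>\<in>Sn n. of_bool (f \<pi> \<noteq> p \<pi> - q \<pi>)) \<le> \<delta> * fact n"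
  proof -
    have "(\<Sum>\<pi>\<in>Sn n. of_bool (f \<pi> \<noteq> p \<pi> - q \<pi>)) = real (card ?B)"
    proof -
      have "?B = {\<pi> \<in> Sn n. f \<pi> \<noteq> p \<pi> - q \<pi>}" using B by blast
      then show ?thesis by (simp add: of_bool_def sum.If_cases Int_def)
    qed
    then show ?thesis using bad by simp
  qed
  have nat: "\<exists>p' q'. p \<pi> = real p' \<and> q \<pi> = real q'" for \<pi>
    using sum_hit_eq_card[OF fin(2)] sum_hit_eq_card[OF fin(3)] unfolding p_def q_def by blast
  have pt: "q \<pi> * (2 - s \<pi>) \<le> of_bool (f \<pi> \<noteq> p \<pi> - q \<pi>)"
    "p \<pi> * (p \<pi> - 1) * (3 - s \<pi>) \<le> 2 * of_bool (f \<pi> \<noteq> p \<pi> - q \<pi>)" if "\<pi> \<in> Sn n" for \<pi>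
    using small_support_pointwise[of "p \<pi>" _ "q \<pi>"] nat[of \<pi>] f[OF that] unfolding s by blast+
  obtain k where k: "n = k + 3" using n3 by (metis add.commute le_Suc_ex)
  have F0: "(fact n :: real) = real n * fact (n - 1)" using n3 by (simp add: fact_reduce)
  have F1: "(fact (n - 1) :: real) = real (n - 1) * fact (n - 2)" by (simp add: k algebra_simps)
  have F2: "(fact (n - 2) :: real) = real (n - 2) * fact (n - 3)" by (simp add: k algebra_simps)
  have N_le: "real (card ?N) * (fact (n - 1) / 2) \<le> \<delta> * fact n"
  proof -
    have each: "fact (n - 1) / 2 \<le> (\<Sum>\<pi>\<in>Sn n. hit a \<pi> * (2 - s \<pi>))" if a: "a \<in> ?N" for a
    proof -
      have aS: "a \<in> ?S" using a by auto
      have "(\<Sum>\<pi>\<in>Sn n. hit a \<pi> * s \<pi>) = (\<Sum>x\<in>?S. \<Sum>\<pi>\<in>Sn n. hit a \<pi> * hit x \<pi>)"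
        unfolding s_def sum_distrib_left by (rule sum.swap)
      also have "\<dots> = (\<Sum>\<pi>\<in>Sn n. hit a \<pi>) + (\<Sum>x\<in>?S - {a}. \<Sum>\<pi>\<in>Sn n. hit a \<pi> * hit x \<pi>)"
        using aS fin(1) by (subst sum.remove[of _ a]) auto
      also have "\<dots> \<le> fact (n - 1) + (\<Sum>x\<in>?S - {a}. fact (n - 2))"
        using a by (intro add_mono sum_mono sum_hit_two_le order_eq_refl[OF sum_hit_one]) auto
      also have "\<dots> \<le> fact (n - 1) + real (card ?S) * fact (n - 2)"
        using fin(1) by (auto intro!: mult_right_mono card_mono)
      also have "\<dots> \<le> fact (n - 1) + (real (n - 1) / 2) * fact (n - 2)"
      proof -
        have "real (card ?S) \<le> real (n - 1) / 2" using supp n3 by (simp add: of_nat_diff)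
        then show ?thesis by (intro add_left_mono mult_right_mono) auto
      qed
      finally have "(\<Sum>\<pi>\<in>Sn n. hit a \<pi> * s \<pi>) \<le> 3 / 2 * fact (n - 1)" using F1 by linarith
      moreover have "(\<Sum>\<pi>\<in>Sn n. hit a \<pi> * (2 - s \<pi>)) = 2 * (\<Sum>\<pi>\<in>Sn n. hit a \<pi>) - (\<Sum>\<pi>\<in>Sn n. hit a \<pi> * s \<pi>)"
        by (simp add: right_diff_distrib sum_subtractf sum_distrib_left mult.commute)
      moreover have "(\<Sum>\<pi>\<in>Sn n. hit a \<pi>) = fact (n - 1)" using a by (intro sum_hit_one) auto
      ultimately show ?thesis by linarith
    qed
    have "real (card ?N) * (fact (n - 1) / 2) = (\<Sum>a\<in>?N. fact (n - 1) / 2)" by simp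
    also have "\<dots> \<le> (\<Sum>a\<in>?N. \<Sum>\<pi>\<in>Sn n. hit a \<pi> * (2 - s \<pi>))" by (intro sum_mono each)
    also have "\<dots> = (\<Sum>\<pi>\<in>Sn n. \<Sum>a\<in>?N. hit a \<pi> * (2 - s \<pi>))" by (rule sum.swap)
    also have "\<dots> = (\<Sum>\<pi>\<in>Sn n. q \<pi> * (2 - s \<pi>))" by (simp only: q_def sum_distrib_right)
    also have "\<dots> \<le> (\<Sum>\<pi>\<in>Sn n. of_bool (f \<pi> \<noteq> p \<pi> - q \<pi>))" by (intro sum_mono pt)
    also note cardB
    finally show ?thesis .
  qed
  \<comment> \<open>One \<open>\<delta>\<close> is for the permutations where the integer form is
    wrong, two are for those hitting a negative entry. On all others the number of positive hits
    equals \<open>f\<close> and is therefore 0 or 1.\<close>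
  show "real (card {\<pi> \<in> Sn n. f \<pi> \<noteq> coset_max C \<pi>}) \<le> 3 * \<delta> * fact n"
  proof -
    let ?H = "{\<pi> \<in> Sn n. \<exists>a\<in>?N. \<pi> (fst a) = snd a}"
    have "{\<pi> \<in> Sn n. f \<pi> \<noteq> coset_max C \<pi>} \<subseteq> ?B \<union> ?H"
    proof
      fix \<pi> assume \<pi>: "\<pi> \<in> {\<pi> \<in> Sn n. f \<pi> \<noteq> coset_max C \<pi>}"
      show "\<pi> \<in> ?B \<union> ?H"
      proof (rule ccontr)
        assume no: "\<pi> \<notin> ?B \<union> ?H"
        have "q \<pi> = 0" using no \<pi> unfolding q_def hit_def by (intro sum.neutral) auto
        then have fp: "f \<pi> = p \<pi>" using no B[of \<pi>] \<pi> by auto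
        show False
        proof (cases "\<exists>a\<in>C. \<pi> (fst a) = snd a")
          case True
          then obtain a where "a \<in> C" "hit a \<pi> = 1" by (auto simp: hit_def)
          then have "1 \<le> p \<pi>" unfolding p_def using fin(2) member_le_sum[of a C "\<lambda>a. hit a \<pi>"] by simp
          then have "f \<pi> = 1" using fp f[of \<pi>] \<pi> by auto
          then show False using True \<pi> coset_max_eq[OF fin(2)] by auto
        next
          case False
          then have "p \<pi> = 0" unfolding p_def hit_def by (intro sum.neutral) auto
          then show False using False fp \<pi> coset_max_eq[OF fin(2)] by auto
        qed
      qed
    qed
    then have "card {\<pi> \<in> Sn n. f \<pi> \<noteq> coset_max C \<pi>} \<le> card (?B \<union> ?H)"
      by (intro card_mono finite_UnI) (auto intro: finite_subset[OF _ finite_Sn])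
    also have "\<dots> \<le> card ?B + card ?H" by (rule card_Un_le)
    finally have "real (card {\<pi> \<in> Sn n. f \<pi> \<noteq> coset_max C \<pi>}) \<le> real (card ?B) + real (card ?H)"
      by linarith
    moreover have "real (card ?H) \<le> real (card ?N) * fact (n - 1)" by (rule card_hit_Un_le) auto
    ultimately show ?thesis using bad N_le by linarith
  qed
  have "real (card (crossing_pairs C)) * (fact (n - 2) / 2) \<le> 2 * (\<delta> * fact n)"
  proof -
    have each: "fact (n - 2) / 2 \<le> (\<Sum>\<pi>\<in>Sn n. hit a \<pi> * hit c \<pi> * (3 - s \<pi>))"
      if "(a, c) \<in> crossing_pairs C" for a c
    proof -
      have ac: "a \<in> C" "c \<in> C" "fst a \<noteq> fst c" "snd a \<noteq> snd c" "a \<noteq> c"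
        using that by (auto simp: crossing_pairs_def)
      have acS: "a \<in> ?S" "c \<in> ?S - {a}" using ac by (auto simp: C_def)
      have acP: "a \<in> grid n" "c \<in> grid n" using ac by (auto simp: C_def)
      have two: "(\<Sum>\<pi>\<in>Sn n. hit a \<pi> * hit c \<pi>) = fact (n - 2)"
        by (rule sum_hit_two[OF acP ac(3,4)])
      have "(\<Sum>\<pi>\<in>Sn n. hit a \<pi> * hit c \<pi> * s \<pi>) = (\<Sum>x\<in>?S. \<Sum>\<pi>\<in>Sn n. hit a \<pi> * hit c \<pi> * hit x \<pi>)"
        unfolding s_def sum_distrib_left by (rule sum.swap)
      also have "\<dots> = (\<Sum>\<pi>\<in>Sn n. hit a \<pi> * hit c \<pi> * hit a \<pi>) + ((\<Sum>\<pi>\<in>Sn n. hit a \<pi> * hit c \<pi> * hit c \<pi>)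
          + (\<Sum>x\<in>?S - {a} - {c}. \<Sum>\<pi>\<in>Sn n. hit a \<pi> * hit c \<pi> * hit x \<pi>))"
      proof -
        have "(\<Sum>x\<in>?S. \<Sum>\<pi>\<in>Sn n. hit a \<pi> * hit c \<pi> * hit x \<pi>) = (\<Sum>\<pi>\<in>Sn n. hit a \<pi> * hit c \<pi> * hit a \<pi>)
          + (\<Sum>x\<in>?S - {a}. \<Sum>\<pi>\<in>Sn n. hit a \<pi> * hit c \<pi> * hit x \<pi>)"
          by (rule sum.remove[OF fin(1) acS(1)])
        moreover have "(\<Sum>x\<in>?S - {a}. \<Sum>\<pi>\<in>Sn n. hit a \<pi> * hit c \<pi> * hit x \<pi>)
          = (\<Sum>\<pi>\<in>Sn n. hit a \<pi> * hit c \<pi> * hit c \<pi>)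
          + (\<Sum>x\<in>?S - {a} - {c}. \<Sum>\<pi>\<in>Sn n. hit a \<pi> * hit c \<pi> * hit x \<pi>)"
          by (rule sum.remove[OF _ acS(2)]) (use fin(1) in simp)
        ultimately show ?thesis by simp
      qed
      also have "\<dots> \<le> fact (n - 2) + (fact (n - 2) + (\<Sum>x\<in>?S - {a} - {c}. fact (n - 3)))"
      proof (intro add_mono sum_mono)
        have "hit a \<pi> * hit c \<pi> * hit a \<pi> = hit a \<pi> * hit c \<pi>"
          "hit a \<pi> * hit c \<pi> * hit c \<pi> = hit a \<pi> * hit c \<pi>" for \<pi>
          by (simp_all add: hit_def)
        then show "(\<Sum>\<pi>\<in>Sn n. hit a \<pi> * hit c \<pi> * hit a \<pi>) \<le> fact (n - 2)"
          "(\<Sum>\<pi>\<in>Sn n. hit a \<pi> * hit c \<pi> * hit c \<pi>) \<le> fact (n - 2)"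
          by (simp_all only: two order_refl)
        show "(\<Sum>\<pi>\<in>Sn n. hit a \<pi> * hit c \<pi> * hit x \<pi>) \<le> fact (n - 3)" if "x \<in> ?S - {a} - {c}" for x
          using that ac acP by (intro sum_hit_three_le) auto
      qed
      also have "\<dots> = 2 * fact (n - 2) + real (card (?S - {a} - {c})) * fact (n - 3)" by simp
      also have "\<dots> \<le> 2 * fact (n - 2) + (real (n - 2) / 2) * fact (n - 3)"
      proof -
        have "card (?S - {a} - {c}) \<le> card ?S" using fin(1) by (intro card_mono) auto
        then have "real (card (?S - {a} - {c})) \<le> real n / 20" using supp by linarith
        also have "\<dots> \<le> real (n - 2) / 2" using n3 by (simp add: of_nat_diff)
        finally show ?thesis by (intro add_left_mono mult_right_mono) auto
      qed
      finally have "(\<Sum>\<pi>\<in>Sn n. hit a \<pi> * hit c \<pi> * s \<pi>) \<le> 5 / 2 * fact (n - 2)" using F2 by linarith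
      moreover have "(\<Sum>\<pi>\<in>Sn n. hit a \<pi> * hit c \<pi> * (3 - s \<pi>))
        = 3 * (\<Sum>\<pi>\<in>Sn n. hit a \<pi> * hit c \<pi>) - (\<Sum>\<pi>\<in>Sn n. hit a \<pi> * hit c \<pi> * s \<pi>)"
        by (simp only: right_diff_distrib sum_subtractf mult.commute[of _ 3] sum_distrib_left)
      ultimately show ?thesis using two by linarith
    qed
    have pp: "(\<Sum>(a, c)\<in>crossing_pairs C. hit a \<pi> * hit c \<pi>) = p \<pi> * (p \<pi> - 1)" if "\<pi> \<in> Sn n" for \<pi>
      unfolding p_def using that fin(2) by (rule sum_crossing_pairs_hits)
    have "real (card (crossing_pairs C)) * (fact (n - 2) / 2) = (\<Sum>x\<in>crossing_pairs C. fact (n - 2) / 2)" by simp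
    also have "\<dots> \<le> (\<Sum>(a, c)\<in>crossing_pairs C. \<Sum>\<pi>\<in>Sn n. hit a \<pi> * hit c \<pi> * (3 - s \<pi>))"
      using each by (intro sum_mono) auto
    also have "\<dots> = (\<Sum>x\<in>crossing_pairs C. \<Sum>\<pi>\<in>Sn n. hit (fst x) \<pi> * hit (snd x) \<pi> * (3 - s \<pi>))"
      by (simp add: case_prod_beta)
    also have "\<dots> = (\<Sum>\<pi>\<in>Sn n. \<Sum>x\<in>crossing_pairs C. hit (fst x) \<pi> * hit (snd x) \<pi> * (3 - s \<pi>))"
      by (rule sum.swap)
    also have "\<dots> = (\<Sum>\<pi>\<in>Sn n. p \<pi> * (p \<pi> - 1) * (3 - s \<pi>))"
      by (rule sum.cong[OF refl]) (simp add: case_prod_beta flip: sum_distrib_right pp)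
    also have "\<dots> \<le> (\<Sum>\<pi>\<in>Sn n. 2 * of_bool (f \<pi> \<noteq> p \<pi> - q \<pi>))" by (intro sum_mono pt)
    also have "\<dots> \<le> 2 * (\<delta> * fact n)"
      using cardB by (simp only: sum_distrib_left[symmetric])
    finally show ?thesis .
  qed
  then have "real (card (crossing_pairs C)) \<le> 4 * \<delta> * (real n * real (n - 1))"
    unfolding F0 F1 by simp
  also have "\<dots> \<le> 4 * \<delta> * (real n)\<^sup>2"
  proof -
    have "0 \<le> \<delta> * fact n" using bad by (rule order_trans[rotated]) simp
    then have "\<delta> \<ge> 0" by (metis fact_gt_zero mult_le_cancel_right_pos mult_zero_left)
    then show ?thesis unfolding power2_eq_square by (intro mult_left_mono) auto
  qed
  finally show "real (card (nondisjoint_pairs n C)) \<le> 4 * \<delta> * (real n)\<^sup>2"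
    using card_nondisjoint_pairs_le[of C n] by (auto simp: C_def)
qed

text \<open>As long as no nonzero entry outside row \<open>r\<close> is hit, the form is
  \<open>b + d r (\<pi> r)\<close>, and \<open>J\<close> collects the columns where this is 1. The
  at most \<open>\<sigma> * n\<close> other entries are hit with probability \<open>1 / n\<close>
  each.\<close>

lemma row_support:
  fixes f :: "(nat \<Rightarrow> nat) \<Rightarrow> real" and d :: "nat \<Rightarrow> nat \<Rightarrow> int"
  assumes r: "r \<in> {1..n}" and f: "\<And>\<pi>. \<pi> \<in> Sn n \<Longrightarrow> f \<pi> \<in> {0, 1}"
    and supp: "real (card {a \<in> grid n. fst a \<noteq> r \<and> d (fst a) (snd a) \<noteq> 0}) \<le> \<sigma> * real n"
    and bad: "real (card {\<pi> \<in> Sn n. f \<pi> \<noteq> of_int (b + (\<Sum>i\<in>{1..n}. d i (\<pi> i)))}) \<le> \<delta> * fact n"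
  shows "\<exists>J\<subseteq>{1..n}. real (card {\<pi> \<in> Sn n. f \<pi> \<noteq> of_bool (\<pi> r \<in> J)}) \<le> (\<delta> + \<sigma>) * fact n"
proof (intro exI conjI)
  let ?J = "{j \<in> {1..n}. b + d r j = 1}"
  let ?S = "{a \<in> grid n. fst a \<noteq> r \<and> d (fst a) (snd a) \<noteq> 0}"
  let ?B = "{\<pi> \<in> Sn n. f \<pi> \<noteq> of_int (b + (\<Sum>i\<in>{1..n}. d i (\<pi> i)))}"
  let ?H = "{\<pi> \<in> Sn n. \<exists>a\<in>?S. \<pi> (fst a) = snd a}"
  show "?J \<subseteq> {1..n}" by auto
  have "{\<pi> \<in> Sn n. f \<pi> \<noteq> of_bool (\<pi> r \<in> ?J)} \<subseteq> ?B \<union> ?H"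
  proof
    fix \<pi> assume \<pi>: "\<pi> \<in> {\<pi> \<in> Sn n. f \<pi> \<noteq> of_bool (\<pi> r \<in> ?J)}"
    then have perm: "\<pi> permutes {1..n}" by simp
    show "\<pi> \<in> ?B \<union> ?H"
    proof (rule ccontr)
      assume no: "\<pi> \<notin> ?B \<union> ?H"
      have "d i (\<pi> i) = 0" if "i \<in> {1..n} - {r}" for i
      proof (rule ccontr)
        assume "d i (\<pi> i) \<noteq> 0"
        moreover have "\<pi> i \<in> {1..n}" using that perm by (intro Sn_app[of \<pi> n]) auto
        ultimately have "(i, \<pi> i) \<in> ?S" using that by auto
        then have "\<pi> \<in> ?H" using \<pi> by force
        then show False using no by blast
      qed
      then have "(\<Sum>i\<in>{1..n}. d i (\<pi> i)) = d r (\<pi> r)"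
        using r by (subst sum.remove[of _ r]) auto
      moreover have "f \<pi> = of_int (b + (\<Sum>i\<in>{1..n}. d i (\<pi> i)))" using no \<pi> by blast
      ultimately have "f \<pi> = of_int (b + d r (\<pi> r))" by presburger
      moreover have "f \<pi> = 0 \<or> f \<pi> = 1" using f[of \<pi>] \<pi> by auto
      moreover have "\<pi> r \<in> {1..n}" using r perm by (intro Sn_app[of \<pi> n]) auto
      ultimately have "f \<pi> = of_bool (\<pi> r \<in> ?J)" by auto
      then show False using \<pi> by auto
    qed
  qed
  then have "card {\<pi> \<in> Sn n. f \<pi> \<noteq> of_bool (\<pi> r \<in> ?J)} \<le> card (?B \<union> ?H)"
    by (intro card_mono finite_UnI) (auto intro: finite_subset[OF _ finite_Sn])
  also have "\<dots> \<le> card ?B + card ?H" by (rule card_Un_le)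
  finally have "real (card {\<pi> \<in> Sn n. f \<pi> \<noteq> of_bool (\<pi> r \<in> ?J)}) \<le> real (card ?B) + real (card ?H)"
    by linarith
  also have "real (card ?H) \<le> real (card ?S) * fact (n - 1)" by (rule card_hit_Un_le) auto
  also have "\<dots> \<le> (\<sigma> * real n) * fact (n - 1)" using supp by (intro mult_right_mono) auto
  also have "\<dots> = \<sigma> * fact n" using r by (simp add: fact_reduce[of n])
  finally show "real (card {\<pi> \<in> Sn n. f \<pi> \<noteq> of_bool (\<pi> r \<in> ?J)}) \<le> (\<delta> + \<sigma>) * fact n"
    using bad by (simp add: distrib_right)
qed

section \<open>Choice of the base and the two cases of the dichotomy\<close>

context near_linear
begin

lemma entry_values: "entry i0 j0 i j \<in> {-1, 0, 1}"
  by (auto simp: entry_def nearest_def)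

lemma entry_nonzero: "of_bool (entry i0 j0 i j \<noteq> 0) = act c (i, i0) (j, j0)"
  by (simp add: entry_def act_def)

lemma sum_bases:
  fixes \<phi> :: "nat \<times> nat \<Rightarrow> nat \<times> nat \<Rightarrow> real"
  shows "(\<Sum>z\<in>A \<times> {1..n}. \<Sum>i\<in>B. \<Sum>j\<in>{1..n}. \<phi> (i, fst z) (j, snd z))
    = (\<Sum>p\<in>B \<times> A. \<Sum>q\<in>grid n. \<phi> p q)"
proof -
  have "(\<Sum>z\<in>A \<times> {1..n}. \<Sum>i\<in>B. \<Sum>j\<in>{1..n}. \<phi> (i, fst z) (j, snd z))
    = (\<Sum>i0\<in>A. \<Sum>j0\<in>{1..n}. \<Sum>i\<in>B. \<Sum>j\<in>{1..n}. \<phi> (i, i0) (j, j0))"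
    by (simp add: sum_over_pairs)
  also have "\<dots> = (\<Sum>i0\<in>A. \<Sum>i\<in>B. \<Sum>j0\<in>{1..n}. \<Sum>j\<in>{1..n}. \<phi> (i, i0) (j, j0))"
    by (rule sum.cong[OF refl], rule sum.swap)
  also have "\<dots> = (\<Sum>i\<in>B. \<Sum>i0\<in>A. \<Sum>j0\<in>{1..n}. \<Sum>j\<in>{1..n}. \<phi> (i, i0) (j, j0))"
    by (rule sum.swap)
  also have "\<dots> = (\<Sum>i\<in>B. \<Sum>i0\<in>A. \<Sum>j\<in>{1..n}. \<Sum>j0\<in>{1..n}. \<phi> (i, i0) (j, j0))"
    by (rule sum.cong[OF refl], rule sum.cong[OF refl], rule sum.swap)
  finally show ?thesis by (simp add: sum_over_pairs)
qed

lemma card_entries: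
  assumes "finite B"
  shows "real (card {a \<in> B \<times> {1..n}. entry i0 j0 (fst a) (snd a) \<noteq> 0})
    = (\<Sum>i\<in>B. \<Sum>j\<in>{1..n}. act c (i, i0) (j, j0))"
proof -
  have "real (card {a \<in> B \<times> {1..n}. entry i0 j0 (fst a) (snd a) \<noteq> 0})
    = (\<Sum>a\<in>B \<times> {1..n}. of_bool (entry i0 j0 (fst a) (snd a) \<noteq> 0))"
    using assms by (simp add: of_bool_def sum.If_cases Int_def)
  also have "\<dots> = (\<Sum>i\<in>B. \<Sum>j\<in>{1..n}. act c (i, i0) (j, j0))"
    by (simp only: sum_over_pairs fst_conv snd_conv entry_nonzero)
  finally show ?thesis .
qed

text \<open>One base has to serve two purposes, a small support and a small rounding error. The base
  row is sought in \<open>A\<close>, and the support is counted in the rows \<open>B\<close>; both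
  can thus avoid an influential row. One factor 2 comes from the size of \<open>A\<close>, another
  from \<open>exists_below_twice_average\<close>. The constants are \<open>37200 = 4 * 9300\<close>
  and \<open>595208 = 8 + 16 * 37200\<close>.\<close>

lemma good_base:
  assumes A: "A \<subseteq> {1..n}" "real n / 2 \<le> real (card A)" and B: "B \<subseteq> {1..n}" and U: "U \<ge> 0"
    and act: "(\<Sum>p\<in>B \<times> A. \<Sum>q\<in>grid n. act c p q) \<le> U * real n ^ 3"
  obtains i0 j0 b where
    "real (card {a \<in> B \<times> {1..n}. entry i0 j0 (fst a) (snd a) \<noteq> 0}) \<le> 4 * U * real n"
    "real (card {\<pi> \<in> Sn n. f \<pi> \<noteq> of_int (b + (\<Sum>i\<in>{1..n}. entry i0 j0 i (\<pi> i)))}) \<le> 595208 * \<epsilon> * fact n"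
proof -
  let ?J = "A \<times> {1..n}"
  let ?A = "\<lambda>z. \<Sum>i\<in>B. \<Sum>j\<in>{1..n}. act c (i, fst z) (j, snd z)"
  let ?R = "\<lambda>z. \<Sum>i\<in>{1..n}. \<Sum>j\<in>{1..n}. rerr c (i, fst z) (j, snd z)"
  have fin: "finite A" "finite B" using A(1) B finite_subset by blast+
  have "card A > 0" using A(2) n2 by (intro gr0I) simp
  have scale: "X * real n ^ 3 \<le> real (card ?J) * (2 * X * real n)" if "X \<ge> 0" for X
  proof -
    have "real n / 2 * real n * (2 * X * real n) \<le> real (card A) * real n * (2 * X * real n)"
      using A(2) that by (intro mult_right_mono) auto
    then show ?thesis by (simp add: card_cartesian_product power3_eq_cube algebra_simps)
  qed
  obtain z where z: "z \<in> ?J" "?A z \<le> 2 * (2 * U * real n)" "?R z \<le> 2 * (2 * (9300 * \<epsilon>) * real n)"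
  proof (rule exists_below_twice_average[of ?J ?A ?R "2 * U * real n" "2 * (9300 * \<epsilon>) * real n"])
    show "(\<Sum>z\<in>?J. ?A z) \<le> real (card ?J) * (2 * U * real n)"
      unfolding sum_bases using act scale[OF U] by linarith
    have "(\<Sum>z\<in>?J. ?R z) \<le> (\<Sum>z\<in>grid n. ?R z)"
      using A(1) by (intro sum_mono2) (auto intro!: sum_nonneg)
    also have "\<dots> \<le> 9300 * \<epsilon> * real n ^ 3" unfolding sum_bases by (rule sum_rerr)
    finally show "(\<Sum>z\<in>?J. ?R z) \<le> real (card ?J) * (2 * (9300 * \<epsilon>) * real n)"
      using scale[of "9300 * \<epsilon>"] eps_nonneg by linarith
    show "?J \<noteq> {}" using \<open>card A > 0\<close> n2 by (auto simp: card_gt_0_iff)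
  qed (use fin in \<open>auto intro!: sum_nonneg\<close>)
  obtain i0 j0 where ij: "z = (i0, j0)" by (cases z)
  have ij0: "i0 \<in> {1..n}" "j0 \<in> {1..n}" using z(1) ij A(1) by auto
  have V: "(\<Sum>i\<in>{1..n}. \<Sum>j\<in>{1..n}. rerr c (i, i0) (j, j0)) \<le> 37200 * \<epsilon> * real n"
    using z(3) ij by simp
  obtain b where "real (card {\<pi> \<in> Sn n. f \<pi> \<noteq> of_int (b + (\<Sum>i\<in>{1..n}. entry i0 j0 i (\<pi> i)))})
      \<le> (8 * \<epsilon> + 16 * (37200 * \<epsilon> * real n) / n) * fact n"
    using rounding[OF ij0 V] by blast
  also have "8 * \<epsilon> + 16 * (37200 * \<epsilon> * real n) / n = 595208 * \<epsilon>" using n2 by simp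
  finally show ?thesis
    using z(2) ij card_entries[OF fin(2), of i0 j0] by (intro that) simp_all
qed

lemma few_active:
  assumes n3: "n \<ge> 3" and small: "\<epsilon> \<le> 1 / 10 ^ 20"
    and mean: "(\<Sum>\<pi>\<in>Sn n. f \<pi>) \<le> fact n / 2"
    and few: "total_act n c \<le> real n ^ 3 / 80"
  shows "\<exists>C\<subseteq>grid n. real (card C) \<le> real n
    \<and> real (card (nondisjoint_pairs n C)) \<le> 10 ^ 9 * \<epsilon> * (real n)\<^sup>2
    \<and> real (card {\<pi> \<in> Sn n. f \<pi> \<noteq> coset_max C \<pi>}) \<le> 10 ^ 9 * \<epsilon> * fact n"
proof -
  have act: "(\<Sum>p\<in>grid n. \<Sum>q\<in>grid n. act c p q) \<le> 1 / 80 * real n ^ 3"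
    using few unfolding total_act_def by simp
  have half: "real n / 2 \<le> real (card {1..n})" by simp
  \<comment> \<open>The threshold \<open>1/80\<close> for the activity is a quarter of the density
    \<open>1/20\<close> that \<open>small_support\<close> tolerates.\<close>
  obtain i0 j0 b where supp: "real (card {a \<in> grid n. entry i0 j0 (fst a) (snd a) \<noteq> 0}) \<le> 4 * (1 / 80) * real n"
    and bad: "real (card {\<pi> \<in> Sn n. f \<pi> \<noteq> of_int (b + (\<Sum>i\<in>{1..n}. entry i0 j0 i (\<pi> i)))}) \<le> 595208 * \<epsilon> * fact n"
    by (rule good_base[OF order_refl half order_refl _ act]) simp_all
  have supp': "real (card {a \<in> grid n. entry i0 j0 (fst a) (snd a) \<noteq> 0}) \<le> real n / 20"
    using supp by simp
  have \<delta>: "595208 * \<epsilon> \<le> 1 / 4" using small by simp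
  let ?C = "{a \<in> grid n. entry i0 j0 (fst a) (snd a) = 1}"
  note concl = small_support[OF n3 boolean mean \<delta> entry_values supp' bad]
  have "card ?C \<le> card {a \<in> grid n. entry i0 j0 (fst a) (snd a) \<noteq> 0}"
    by (intro card_mono) auto
  then have "real (card ?C) \<le> real n" using supp' by linarith
  moreover have "4 * (595208 * \<epsilon>) * (real n)\<^sup>2 \<le> 10 ^ 9 * \<epsilon> * (real n)\<^sup>2"
    using eps_nonneg by (intro mult_right_mono) auto
  moreover have "3 * (595208 * \<epsilon>) * fact n \<le> 10 ^ 9 * \<epsilon> * fact n"
    using eps_nonneg by (intro mult_right_mono) auto
  ultimately show ?thesis using concl by (intro exI[of _ ?C] conjI) auto
qed

text \<open>From \<open>n = 15360 = 6 * 2560\<close> on, the correction \<open>6 * n\<^sup>2\<close>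
  takes at most half of the activity of row \<open>r\<close>. Comparing
  \<open>outside_act_le\<close> with \<open>apart_act_row_le\<close> leaves at most
  \<open>2560 * 15500 * \<epsilon> * n ^ 3\<close> active rectangles that avoid \<open>r\<close>. A
  base row different from \<open>r\<close> then gives a support of order
  \<open>\<epsilon> * n\<close> outside row \<open>r\<close>, which \<open>row_support\<close> turns
  into a function of \<open>\<pi> r\<close>.\<close>

lemma influential_row:
  assumes n: "n \<ge> 15360" and r: "r \<in> {1..n}" and large: "row_act n c r \<ge> real n ^ 3 / 1280"
  shows "\<exists>J\<subseteq>{1..n}. real (card {\<pi> \<in> Sn n. f \<pi> \<noteq> of_bool (\<pi> r \<in> J)}) \<le> 10 ^ 9 * \<epsilon> * fact n"
proof -
  define Q where "Q = outside_act n c r"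
  have Q0: "Q \<ge> 0" unfolding Q_def outside_act_def by (intro sum_nonneg) auto
  have "real n ^ 3 / 2560 \<le> row_act n c r - 6 * (real n)\<^sup>2"
  proof -
    have "15360 * (real n)\<^sup>2 \<le> real n * (real n)\<^sup>2" using n by (intro mult_right_mono) auto
    then have "6 * (real n)\<^sup>2 \<le> real n ^ 3 / 2560" by (simp add: power3_eq_cube power2_eq_square)
    then show ?thesis using large by linarith
  qed
  then have "Q * (real n ^ 3 / 2560) \<le> Q * (row_act n c r - 6 * (real n)\<^sup>2)"
    using Q0 by (intro mult_left_mono)
  also have "\<dots> \<le> 15500 * \<epsilon> * real n ^ 6"
    using outside_act_le[OF r, of c] apart_act_row_le[OF _ r] n unfolding Q_def by linarith
  finally have "real n ^ 3 * Q \<le> real n ^ 3 * (39680000 * \<epsilon> * real n ^ 3)"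
    by (simp add: algebra_simps flip: power_add)
  then have QLE: "Q \<le> 39680000 * \<epsilon> * real n ^ 3" using n by simp
  let ?A = "{1..n} - {r}"
  have "(\<Sum>p\<in>?A \<times> ?A. \<Sum>q\<in>grid n. act c p q) = (\<Sum>p\<in>?A \<times> ?A. \<Sum>q\<in>grid n.
      of_bool (fst p \<noteq> r \<and> snd p \<noteq> r) * act c p q)"
    by (intro sum.cong) auto
  also have "\<dots> = Q"
    unfolding Q_def outside_act_def by (intro sum.mono_neutral_left) auto
  also note QLE
  finally have act: "(\<Sum>p\<in>?A \<times> ?A. \<Sum>q\<in>grid n. act c p q) \<le> 39680000 * \<epsilon> * real n ^ 3" .
  have "card ?A = n - 1" using r by simp
  then have half: "real n / 2 \<le> real (card ?A)" using n by simp
  have U: "0 \<le> 39680000 * \<epsilon>" using eps_nonneg by simp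
  obtain i0 j0 b where supp: "real (card {a \<in> ?A \<times> {1..n}. entry i0 j0 (fst a) (snd a) \<noteq> 0})
      \<le> 4 * (39680000 * \<epsilon>) * real n"
    and bad: "real (card {\<pi> \<in> Sn n. f \<pi> \<noteq> of_int (b + (\<Sum>i\<in>{1..n}. entry i0 j0 i (\<pi> i)))}) \<le> 595208 * \<epsilon> * fact n"
    by (rule good_base[OF Diff_subset half Diff_subset U act])
  have eq: "{a \<in> grid n. fst a \<noteq> r \<and> entry i0 j0 (fst a) (snd a) \<noteq> 0}
      = {a \<in> ({1..n} - {r}) \<times> {1..n}. entry i0 j0 (fst a) (snd a) \<noteq> 0}" by auto
  obtain J where J: "J \<subseteq> {1..n}"
    "real (card {\<pi> \<in> Sn n. f \<pi> \<noteq> of_bool (\<pi> r \<in> J)}) \<le> (595208 * \<epsilon> + 4 * (39680000 * \<epsilon>)) * fact n"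
    using row_support[OF r boolean supp[folded eq] bad] by blast
  moreover have "(595208 * \<epsilon> + 4 * (39680000 * \<epsilon>)) * fact n \<le> 10 ^ 9 * \<epsilon> * fact n"
    using eps_nonneg by (intro mult_right_mono) auto
  ultimately show ?thesis by (intro exI[of _ J] conjI) linarith+
qed

end

subsection \<open>Exactly linear functions and the theorem\<close>

lemma rtrancl_imp_distinct_path:
  assumes "(b, a) \<in> E\<^sup>*"
  shows "\<exists>xs. xs \<noteq> [] \<and> distinct xs \<and> hd xs = b \<and> last xs = a
    \<and> (\<forall>k. Suc k < length xs \<longrightarrow> (xs ! k, xs ! Suc k) \<in> E)"
  using assms
proof (induction rule: rtrancl_induct)
  case base
  show ?case by (rule exI[of _ "[b]"]) simp
next
  case (step y z)
  then obtain xs where xs: "xs \<noteq> []" "distinct xs" "hd xs = b" "last xs = y"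
    "\<forall>k. Suc k < length xs \<longrightarrow> (xs ! k, xs ! Suc k) \<in> E" by blast
  show ?case
  proof (cases "z \<in> set xs")
    case True
    then obtain k where k: "k < length xs" "z = xs ! k" by (auto simp: in_set_conv_nth)
    show ?thesis
    proof (intro exI[of _ "take (Suc k) xs"] conjI)
      show "last (take (Suc k) xs) = z" using k xs(1) by (simp add: take_Suc_conv_app_nth)
    qed (use xs k in auto)
  next
    case False
    have "((xs @ [z]) ! k, (xs @ [z]) ! Suc k) \<in> E" if k: "Suc k < length (xs @ [z])" for k
    proof (cases "Suc k < length xs")
      case True
      then show ?thesis using xs(5) by (simp add: nth_append)
    next
      case False
      then have "k = length xs - 1" "Suc k = length xs" using k by simp_all
      then show ?thesis using xs(1,4) step.hyps(2) by (simp add: nth_append last_conv_nth)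
    qed
    then show ?thesis using xs False by (intro exI[of _ "xs @ [z]"]) auto
  qed
qed

text \<open>Isolates the edge that closes the cycle; in the application this is the negative
  one.\<close>

lemma sum_cycle_of_list:
  fixes w :: "'v \<Rightarrow> 'v \<Rightarrow> int"
  assumes "distinct xs" "xs \<noteq> []"
  shows "(\<Sum>i\<in>set xs. w i (cycle_of_list xs i))
    = (\<Sum>k<length xs - 1. w (xs ! k) (xs ! Suc k)) + w (last xs) (hd xs)"
proof -
  have "map (cycle_of_list xs) xs = rotate1 xs"
    using cyclic_rotation[OF assms(1), of 1] by simp
  then have c: "cycle_of_list xs (xs ! k) = rotate1 xs ! k" if "k < length xs" for k
    using that by (metis nth_map)
  have "(\<Sum>i\<in>set xs. w i (cycle_of_list xs i)) = (\<Sum>k<length xs. w (xs ! k) (cycle_of_list xs (xs ! k)))"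
    using assms(1) bij_betw_nth[OF assms(1) refl refl] by (intro sum.reindex_bij_betw[symmetric])
  also have "\<dots> = (\<Sum>k<Suc (length xs - 1). w (xs ! k) (rotate1 xs ! k))"
    using assms(2) c by (intro sum.cong) auto
  also have "\<dots> = (\<Sum>k<length xs - 1. w (xs ! k) (rotate1 xs ! k))
      + w (xs ! (length xs - 1)) (rotate1 xs ! (length xs - 1))"
    by simp
  also have "(\<Sum>k<length xs - 1. w (xs ! k) (rotate1 xs ! k)) = (\<Sum>k<length xs - 1. w (xs ! k) (xs ! Suc k))"
    by (intro sum.cong) (auto simp: nth_rotate1)
  also have "rotate1 xs ! (length xs - 1) = hd xs"
    using assms(2) by (simp add: nth_rotate1 hd_conv_nth)
  finally show ?thesis using assms(2) by (simp add: last_conv_nth)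
qed

text \<open>A potential minimising the total negative part works: a negative entry closes a path of
  nonpositive entries to a negative cycle, or else lowering the potential on the vertices
  reachable from its head reduces the total negative part.\<close>
lemma exists_potential:
  fixes w :: "nat \<Rightarrow> nat \<Rightarrow> int"
  assumes diag: "\<And>i. i \<in> I \<Longrightarrow> w i i = 0" and fin: "finite I"
    and nonneg: "\<And>\<sigma>. \<sigma> permutes I \<Longrightarrow> (\<Sum>i\<in>I. w i (\<sigma> i)) \<ge> 0"
  shows "\<exists>u. \<forall>i\<in>I. \<forall>j\<in>I. w i j + u i - u j \<ge> 0"
proof -
  \<comment> \<open>The sum has values in the natural numbers, so it attains a minimum although the
    potentials are unbounded.\<close>
  define neg where "neg u = (\<Sum>p\<in>I \<times> I. nat (- (w (fst p) (snd p) + u (fst p) - u (snd p))))" for u :: "nat \<Rightarrow> int"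
  obtain u where min: "\<And>v. neg u \<le> neg v"
    using ex_has_least_nat[of "\<lambda>_. True" undefined neg] by auto
  let ?W = "\<lambda>i j. w i j + u i - u j"
  have "?W a b \<ge> 0" if a: "a \<in> I" and b: "b \<in> I" for a b
  proof (rule ccontr)
    assume neg_ab: "\<not> ?W a b \<ge> 0"
    define E where "E = {(i, j). i \<in> I \<and> j \<in> I \<and> ?W i j \<le> 0}"
    show False
    proof (cases "(b, a) \<in> E\<^sup>*")
      case True
      from rtrancl_imp_distinct_path[OF this]
      obtain xs where xs: "xs \<noteq> []" "distinct xs" "hd xs = b" "last xs = a"
        and path: "\<forall>k. Suc k < length xs \<longrightarrow> (xs ! k, xs ! Suc k) \<in> E"
        by (elim exE conjE)
      let ?\<sigma> = "cycle_of_list xs"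
      have sub: "set xs \<subseteq> I"
      proof
        fix x assume "x \<in> set xs"
        then obtain k where k: "k < length xs" "x = xs ! k" by (auto simp: in_set_conv_nth)
        show "x \<in> I"
        proof (cases k)
          case 0
          then show ?thesis using k xs(1,3) b by (simp add: hd_conv_nth)
        next
          case (Suc l)
          then show ?thesis using k path by (auto simp: E_def)
        qed
      qed
      have "?\<sigma> permutes I" using cycle_permutes sub permutes_subset by blast
      then have "0 \<le> (\<Sum>i\<in>I. w i (?\<sigma> i))" by (rule nonneg)
      also have "\<dots> = (\<Sum>i\<in>I. ?W i (?\<sigma> i))"
      proof -
        have "(\<Sum>i\<in>I. u (?\<sigma> i)) = (\<Sum>i\<in>I. u i)"
          using sum.permute[OF \<open>?\<sigma> permutes I\<close>, of u] by (simp add: comp_def)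
        then show ?thesis by (simp add: sum.distrib sum_subtractf)
      qed
      also have "\<dots> = (\<Sum>i\<in>set xs. ?W i (?\<sigma> i))"
      proof (rule sum.mono_neutral_right[OF fin sub])
        show "\<forall>i\<in>I - set xs. ?W i (?\<sigma> i) = 0"
          using diag id_outside_supp[of _ xs] by auto
      qed
      also have "\<dots> = (\<Sum>k<length xs - 1. ?W (xs ! k) (xs ! Suc k)) + ?W (last xs) (hd xs)"
        by (rule sum_cycle_of_list[OF xs(2,1)])
      also have "(\<Sum>k<length xs - 1. ?W (xs ! k) (xs ! Suc k)) \<le> 0"
        using path by (intro sum_nonpos) (auto simp: E_def)
      finally show False using neg_ab xs(3,4) by simp
    next
      case False
      define R where "R = {v. (b, v) \<in> E\<^sup>*}"
      define v where "v i = u i - of_bool (i \<in> R)" for i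
      have "b \<in> R" "a \<notin> R" using False by (auto simp: R_def)
      \<comment> \<open>An entry leading out of \<open>R\<close> is at least 1 by integrality, so it
        stays nonnegative when the potential of its row drops by 1. Entries leading into
        \<open>R\<close>, among them \<open>(a, b)\<close>, increase by 1.\<close>
      have step: "?W i j > 0" if "i \<in> R" "j \<notin> R" "i \<in> I" "j \<in> I" for i j
      proof (rule ccontr)
        assume "\<not> ?W i j > 0"
        then have "(i, j) \<in> E" using that by (simp add: E_def)
        then have "j \<in> R" using that(1) unfolding R_def by (auto intro: rtrancl_into_rtrancl)
        then show False using that by blast
      qed
      have "neg v < neg u"
        unfolding neg_def
      proof (rule sum_strict_mono_ex1)
        show "\<forall>p\<in>I \<times> I. nat (- (w (fst p) (snd p) + v (fst p) - v (snd p)))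
            \<le> nat (- (w (fst p) (snd p) + u (fst p) - u (snd p)))"
        proof
          fix p assume p: "p \<in> I \<times> I"
          then show "nat (- (w (fst p) (snd p) + v (fst p) - v (snd p)))
            \<le> nat (- (w (fst p) (snd p) + u (fst p) - u (snd p)))"
            using step[of "fst p" "snd p"] by (cases "fst p \<in> R"; cases "snd p \<in> R") (auto simp: v_def)
        qed
        show "\<exists>p\<in>I \<times> I. nat (- (w (fst p) (snd p) + v (fst p) - v (snd p)))
            < nat (- (w (fst p) (snd p) + u (fst p) - u (snd p)))"
          using a b neg_ab \<open>b \<in> R\<close> \<open>a \<notin> R\<close> by (intro bexI[of _ "(a, b)"]) (auto simp: v_def)
      qed (use fin in simp)
      then show False using min[of v] by simp
    qed
  qed
  then show ?thesis by blast
qed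

text \<open>Composing with a zero \<open>\<rho>\<close> of \<open>f\<close> turns the form into one
  with zero diagonal, and \<open>f \<ge> 0\<close> says that no permutation has negative weight. As
  in the duality for assignment problems, a potential makes every entry nonnegative without changing
  the form. Then \<open>f\<close> is 0 exactly when no positive entry is hit, and two positive
  entries hit together would give the value 2.\<close>

lemma integral_boolean_is_coset_union:
  fixes f :: "(nat \<Rightarrow> nat) \<Rightarrow> real" and d :: "nat \<Rightarrow> nat \<Rightarrow> int"
  assumes f: "\<And>\<pi>. \<pi> \<in> Sn n \<Longrightarrow> f \<pi> \<in> {0, 1}"
    and eq: "\<And>\<pi>. \<pi> \<in> Sn n \<Longrightarrow> f \<pi> = of_int (b + (\<Sum>i\<in>{1..n}. d i (\<pi> i)))"
    and \<rho>: "\<rho> \<in> Sn n" "f \<rho> = 0"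
  shows "\<exists>C\<subseteq>grid n. nondisjoint_pairs n C = {} \<and> (\<forall>\<pi>\<in>Sn n. f \<pi> = coset_max C \<pi>)"
proof -
  let ?I = "{1..n}"
  have \<rho>p: "\<rho> permutes ?I" using \<rho>(1) by simp
  define w where "w i j = d i (\<rho> j) - d j (\<rho> j)" for i j
  have val: "f (\<rho> \<circ> \<sigma>) = of_int (\<Sum>i\<in>?I. w i (\<sigma> i))" if \<sigma>: "\<sigma> permutes ?I" for \<sigma>
  proof -
    have "(\<Sum>i\<in>?I. d (\<sigma> i) (\<rho> (\<sigma> i))) = (\<Sum>i\<in>?I. d i (\<rho> i))"
      using sum.permute[OF \<sigma>, of "\<lambda>i. d i (\<rho> i)"] by (simp add: comp_def)
    moreover have "\<rho> \<circ> \<sigma> \<in> Sn n" using permutes_compose[OF \<sigma> \<rho>p] by simp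
    ultimately show ?thesis
      using eq[of "\<rho> \<circ> \<sigma>"] eq[OF \<rho>(1)] \<rho>(2) by (simp add: w_def sum_subtractf)
  qed
  have nonneg: "(\<Sum>i\<in>?I. w i (\<sigma> i)) \<ge> 0" if \<sigma>: "\<sigma> permutes ?I" for \<sigma>
  proof -
    have "\<rho> \<circ> \<sigma> \<in> Sn n" using permutes_compose[OF \<sigma> \<rho>p] by simp
    then have "f (\<rho> \<circ> \<sigma>) \<ge> 0" using f by fastforce
    then show ?thesis unfolding val[OF \<sigma>] by (simp only: of_int_0_le_iff)
  qed
  have "\<exists>u. \<forall>i\<in>?I. \<forall>j\<in>?I. w i j + u i - u j \<ge> 0"
    by (rule exists_potential) (use nonneg in \<open>simp_all add: w_def\<close>)
  then obtain u where u: "\<forall>i\<in>?I. \<forall>j\<in>?I. w i j + u i - u j \<ge> 0" by (elim exE)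
  define W where "W i j = w i j + u i - u j" for i j
  have W0: "W i j \<ge> 0" if "i \<in> ?I" "j \<in> ?I" for i j using u that unfolding W_def by blast
  have valW: "f \<pi> = of_int (\<Sum>i\<in>?I. W i (inv \<rho> (\<pi> i)))" if \<pi>: "\<pi> \<in> Sn n" for \<pi>
  proof -
    have \<sigma>: "inv \<rho> \<circ> \<pi> permutes ?I" using \<pi> \<rho>p by (auto intro: permutes_compose permutes_inv)
    have "(\<Sum>i\<in>?I. u ((inv \<rho> \<circ> \<pi>) i)) = (\<Sum>i\<in>?I. u i)"
      using sum.permute[OF \<sigma>, of u] by (simp add: comp_def)
    moreover have "\<rho> \<circ> (inv \<rho> \<circ> \<pi>) = \<pi>" using permutes_inverses(1)[OF \<rho>p] by (auto simp: fun_eq_iff)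
    ultimately show ?thesis
      using val[OF \<sigma>] by (simp add: W_def sum.distrib sum_subtractf)
  qed
  have inI: "inv \<rho> (\<pi> i) \<in> ?I" if "\<pi> \<in> Sn n" "i \<in> ?I" for \<pi> i
    using that Sn_app[of "inv \<rho>" n] Sn_app[of \<pi> n i] permutes_inv[OF \<rho>p] by blast
  define C where "C = {a \<in> grid n. W (fst a) (inv \<rho> (snd a)) \<ge> 1}"
  have "C \<subseteq> grid n" by (auto simp: C_def)
  moreover have "nondisjoint_pairs n C = {}"
  proof (rule ccontr)
    assume "nondisjoint_pairs n C \<noteq> {}"
    then obtain a a' \<pi> where a: "a \<in> C" "a' \<in> C" "a \<noteq> a'" "\<pi> \<in> perm_coset n a" "\<pi> \<in> perm_coset n a'"
      unfolding nondisjoint_pairs_def by blast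
    then have \<pi>: "\<pi> \<in> Sn n" "\<pi> (fst a) = snd a" "\<pi> (fst a') = snd a'"
      by (auto simp: perm_coset_def)
    then have ne: "fst a \<noteq> fst a'" using a(3) by (auto simp: prod_eq_iff)
    have "2 \<le> (\<Sum>i\<in>{fst a, fst a'}. W i (inv \<rho> (\<pi> i)))"
      using a(1,2) \<pi>(2,3) ne by (auto simp: C_def)
    also have "\<dots> \<le> (\<Sum>i\<in>?I. W i (inv \<rho> (\<pi> i)))"
      using a(1,2) W0 inI[OF \<pi>(1)] by (intro sum_mono2) (auto simp: C_def)
    finally have "f \<pi> \<ge> 2" unfolding valW[OF \<pi>(1)] by linarith
    then show False using f[OF \<pi>(1)] by auto
  qed
  moreover have "f \<pi> = coset_max C \<pi>" if \<pi>: "\<pi> \<in> Sn n" for \<pi>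
  proof -
    have finC: "finite C" by (simp add: C_def)
    show ?thesis
    proof (cases "\<exists>a\<in>C. \<pi> (fst a) = snd a")
      case True
      then obtain a where a: "a \<in> C" "\<pi> (fst a) = snd a" by blast
      have "1 \<le> (\<Sum>i\<in>{fst a}. W i (inv \<rho> (\<pi> i)))" using a by (auto simp: C_def)
      also have "\<dots> \<le> (\<Sum>i\<in>?I. W i (inv \<rho> (\<pi> i)))"
        using a(1) W0 inI[OF \<pi>] by (intro sum_mono2) (auto simp: C_def)
      finally have "f \<pi> \<ge> 1" unfolding valW[OF \<pi>] by linarith
      then have "f \<pi> = 1" using f[OF \<pi>] by auto
      then show ?thesis using True coset_max_eq[OF finC] by simp
    next
      case False
      have "W i (inv \<rho> (\<pi> i)) \<le> 0" if i: "i \<in> ?I" for i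
      proof -
        have "(i, \<pi> i) \<notin> C" using False by force
        then show ?thesis using i Sn_app[OF \<pi> i] by (auto simp: C_def)
      qed
      then have "f \<pi> \<le> 0" unfolding valW[OF \<pi>] by (simp only: of_int_le_0_iff sum_nonpos)
      then have "f \<pi> = 0" using f[OF \<pi>] by auto
      then show ?thesis using False coset_max_eq[OF finC] by simp
    qed
  qed
  ultimately show ?thesis by blast
qed

lemma nondisjoint_pairs_line_empty:
  assumes "C \<subseteq> grid n" "\<And>a b. a \<in> C \<Longrightarrow> b \<in> C \<Longrightarrow> fst a = fst b \<or> snd a = snd b"
  shows "nondisjoint_pairs n C = {}"
  unfolding nondisjoint_pairs_eq[OF assms(1)] crossing_pairs_def using assms(2) by blast

context near_linear
begin

text \<open>The number of permutations where the rounded form fails is an integer below 1. With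
  \<open>B = {}\<close> and \<open>U = 0\<close>, \<open>good_base\<close> only has to provide a
  small rounding error.\<close>

lemma exact_of_small_error:
  assumes small: "595208 * \<epsilon> * fact n < 1" and mean: "(\<Sum>\<pi>\<in>Sn n. f \<pi>) \<le> fact n / 2"
  shows "\<exists>C\<subseteq>grid n. nondisjoint_pairs n C = {} \<and> (\<forall>\<pi>\<in>Sn n. f \<pi> = coset_max C \<pi>)"
proof -
  have act: "(\<Sum>p\<in>{} \<times> {1..n}. \<Sum>q\<in>grid n. act c p q) \<le> 0 * real n ^ 3" by simp
  have half: "real n / 2 \<le> real (card {1..n})" by simp
  obtain i0 j0 b where
    "real (card {\<pi> \<in> Sn n. f \<pi> \<noteq> of_int (b + (\<Sum>i\<in>{1..n}. entry i0 j0 i (\<pi> i)))}) \<le> 595208 * \<epsilon> * fact n"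
    by (rule good_base[OF order_refl half empty_subsetI order_refl act])
  also note small
  finally have "card {\<pi> \<in> Sn n. f \<pi> \<noteq> of_int (b + (\<Sum>i\<in>{1..n}. entry i0 j0 i (\<pi> i)))} = 0" by linarith
  moreover have "finite {\<pi> \<in> Sn n. f \<pi> \<noteq> of_int (b + (\<Sum>i\<in>{1..n}. entry i0 j0 i (\<pi> i)))}"
    by (rule finite_subset[OF _ finite_Sn]) auto
  ultimately have "{\<pi> \<in> Sn n. f \<pi> \<noteq> of_int (b + (\<Sum>i\<in>{1..n}. entry i0 j0 i (\<pi> i)))} = {}"
    by (simp only: card_0_eq)
  then have eq: "f \<pi> = of_int (b + (\<Sum>i\<in>{1..n}. entry i0 j0 i (\<pi> i)))" if "\<pi> \<in> Sn n" for \<pi>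
    using that by blast
  \<comment> \<open>The mean bound excludes the constant 1, and this supplies the zero around which
    the potential argument is centred.\<close>
  have "\<exists>\<rho>\<in>Sn n. f \<rho> = 0"
  proof (rule ccontr)
    assume no: "\<not> (\<exists>\<rho>\<in>Sn n. f \<rho> = 0)"
    have "(\<Sum>\<pi>\<in>Sn n. f \<pi>) = (\<Sum>\<pi>\<in>Sn n. 1)"
    proof (rule sum.cong[OF refl])
      fix \<pi> assume "\<pi> \<in> Sn n"
      then show "f \<pi> = 1" using boolean[of \<pi>] no by blast
    qed
    then show False using mean fact_gt_zero[of n, where 'a = real] by simp
  qed
  then obtain \<rho> where \<rho>: "\<rho> \<in> Sn n" "f \<rho> = 0" by (elim bexE)
  show ?thesis
    by (rule integral_boolean_is_coset_union[of n f b "entry i0 j0", OF boolean eq \<rho>])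
qed

text \<open>An influential line yields labels in that line only, so there are at most
  \<open>n\<close> of them and no two cross. The column case is the row case for the inverse
  permutation, with the row and column of each label exchanged.\<close>

lemma coset_approximation:
  assumes n: "n \<ge> 15360" and small: "\<epsilon> \<le> 1 / 10 ^ 20"
    and mean: "(\<Sum>\<pi>\<in>Sn n. f \<pi>) \<le> fact n / 2"
  shows "\<exists>C\<subseteq>grid n. real (card C) \<le> real n
    \<and> real (card (nondisjoint_pairs n C)) \<le> 10 ^ 9 * \<epsilon> * (real n)\<^sup>2
    \<and> real (card {\<pi> \<in> Sn n. f \<pi> \<noteq> coset_max C \<pi>}) \<le> 10 ^ 9 * \<epsilon> * fact n"
proof (cases "total_act n c \<le> real n ^ 3 / 80")
  case True
  then show ?thesis using few_active[OF _ small mean] n by simp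
next
  case False
  then have large: "total_act n c > real n ^ 3 / 80" by simp
  have n10: "n \<ge> 10" using n by simp
  show ?thesis
  proof (rule influential_line[OF n10 small large])
    fix r assume r: "r \<in> {1..n}" "row_act n c r \<ge> real n ^ 3 / 1280"
    obtain J where J: "J \<subseteq> {1..n}"
      "real (card {\<pi> \<in> Sn n. f \<pi> \<noteq> of_bool (\<pi> r \<in> J)}) \<le> 10 ^ 9 * \<epsilon> * fact n"
      using influential_row[OF n r] by blast
    let ?C = "{r} \<times> J"
    have sub: "?C \<subseteq> grid n" using J(1) r(1) by blast
    have finC: "finite ?C" using sub finite_subset by blast
    have "card ?C \<le> n" using J(1) card_mono[of "{1..n}" J] by (simp add: card_cartesian_product)
    moreover have "nondisjoint_pairs n ?C = {}" using sub by (rule nondisjoint_pairs_line_empty) auto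
    moreover have "coset_max ?C \<pi> = of_bool (\<pi> r \<in> J)" for \<pi>
      unfolding coset_max_eq[OF finC] by (intro arg_cong[where f = of_bool]) auto
    ultimately show ?thesis using sub J(2) eps_nonneg by (intro exI[of _ ?C] conjI) auto
  next
    fix s assume s: "s \<in> {1..n}" "row_act n (\<lambda>i j. c j i) s \<ge> real n ^ 3 / 1280"
    interpret T: near_linear n "\<lambda>\<pi>. f (inv \<pi>)" "\<lambda>i j. c j i" \<epsilon> by (rule transposed)
    obtain J where J: "J \<subseteq> {1..n}"
      "real (card {\<pi> \<in> Sn n. f (inv \<pi>) \<noteq> of_bool (\<pi> s \<in> J)}) \<le> 10 ^ 9 * \<epsilon> * fact n"
      using T.influential_row[OF n s] by blast
    let ?C = "J \<times> {s}"
    have sub: "?C \<subseteq> grid n" using J(1) s(1) by blast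
    have finC: "finite ?C" using sub finite_subset by blast
    have "card ?C \<le> n" using J(1) card_mono[of "{1..n}" J] by (simp add: card_cartesian_product)
    moreover have "nondisjoint_pairs n ?C = {}" using sub by (rule nondisjoint_pairs_line_empty) auto
    moreover have "coset_max ?C \<pi> = of_bool (inv \<pi> s \<in> J)" if "\<pi> \<in> Sn n" for \<pi>
    proof -
      have "\<pi> permutes {1..n}" using that by simp
      then have "(\<exists>a\<in>?C. \<pi> (fst a) = snd a) \<longleftrightarrow> inv \<pi> s \<in> J"
        using permutes_inverses[of \<pi> "{1..n}"] by (auto intro!: bexI[of _ "inv \<pi> s"])
      then show ?thesis unfolding coset_max_eq[OF finC] by (rule arg_cong[where f = of_bool])
    qed
    then have "{\<pi> \<in> Sn n. f \<pi> \<noteq> coset_max ?C \<pi>} = {\<pi> \<in> Sn n. f \<pi> \<noteq> of_bool (inv \<pi> s \<in> J)}"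
      by auto
    moreover have "card {\<pi> \<in> Sn n. f \<pi> \<noteq> of_bool (inv \<pi> s \<in> J)} = card {\<pi> \<in> Sn n. f (inv \<pi>) \<noteq> of_bool (\<pi> s \<in> J)}"
    proof (rule bij_betw_same_card[of inv])
      show "bij_betw inv {\<pi> \<in> Sn n. f \<pi> \<noteq> of_bool (inv \<pi> s \<in> J)} {\<pi> \<in> Sn n. f (inv \<pi>) \<noteq> of_bool (\<pi> s \<in> J)}"
        by (rule bij_betw_byWitness[where f' = inv]) (auto simp: permutes_inv_inv permutes_inv)
    qed
    ultimately show ?thesis using sub J(2) eps_nonneg by (intro exI[of _ ?C] conjI) auto
  qed
qed

end

section \<open>Expectations, probabilities and linear functions as finite sums\<close>

lemma expect_Sn_eq: "expect_Sn n h = (\<Sum>\<pi>\<in>Sn n. h \<pi>) / fact n"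
  by (subst integral_pmf_of_set[OF Sn_nonempty finite_Sn]) simp

lemma prob_Sn_eq: "prob_Sn n {\<pi>. P \<pi>} = real (card {\<pi> \<in> Sn n. P \<pi>}) / fact n"
  by (subst measure_pmf_of_set[OF Sn_nonempty finite_Sn]) (simp add: Int_def)

lemma linear_on_Sn_iff:
  "linear_on_Sn n l \<longleftrightarrow> (\<exists>c. \<forall>\<pi>\<in>Sn n. l \<pi> = (\<Sum>i\<in>{1..n}. c i (\<pi> i)))"
proof -
  have eq: "(\<Sum>i\<in>{1..n}. \<Sum>j\<in>{1..n}. c i j * x_ind i j \<pi>) = (\<Sum>i\<in>{1..n}. c i (\<pi> i))"
    if "\<pi> \<in> Sn n" for c :: "nat \<Rightarrow> nat \<Rightarrow> real" and \<pi>
  proof (rule sum.cong[OF refl])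
    fix i assume "i \<in> {1..n}"
    then show "(\<Sum>j\<in>{1..n}. c i j * x_ind i j \<pi>) = c i (\<pi> i)"
      using Sn_app[OF that] by (simp add: x_ind_def if_distrib cong: if_cong)
  qed
  have "(\<forall>\<pi>\<in>Sn n. l \<pi> = (\<Sum>i\<in>{1..n}. \<Sum>j\<in>{1..n}. c i j * x_ind i j \<pi>))
      \<longleftrightarrow> (\<forall>\<pi>\<in>Sn n. l \<pi> = (\<Sum>i\<in>{1..n}. c i (\<pi> i)))" for c
    by (rule ball_cong[OF refl]) (simp only: eq)
  then show ?thesis unfolding linear_on_Sn_def by (rule ex_cong1)
qed

lemma nondisjoint_pairs_empty [simp]: "nondisjoint_pairs n {} = {}"
  by (simp add: nondisjoint_pairs_def)

lemma coset_max_empty [simp]: "coset_max {} \<pi> = 0"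
  by (simp add: coset_max_def)

text \<open>For \<open>n < N\<close> the bound on \<open>\<epsilon>\<close> makes \<open>f\<close>
  an exact union of cosets, and \<open>card C \<le> n\<^sup>2 \<le> N * n\<close> explains the
  factor \<open>N\<close>. The number \<open>N\<close> has a name because \<open>fact N\<close>
  enters only through monotonicity and \<open>1 \<le> fact N\<close>, never through its
  value.\<close>

lemma near_linear_coset_approximation:
  fixes N :: nat
  assumes N: "N = 15360" and n: "n \<ge> 1" and \<epsilon>: "\<epsilon> \<ge> 0"
    and f: "\<forall>\<pi>\<in>Sn n. f \<pi> \<in> {0, 1}"
    and lin: "\<exists>l. linear_on_Sn n l \<and> expect_Sn n (\<lambda>\<pi>. (f \<pi> - l \<pi>)\<^sup>2) \<le> \<epsilon>"
    and mean: "expect_Sn n f \<le> 1 / 2"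
    and small: "\<epsilon> * (10 ^ 20 * fact N) \<le> 1"
  shows "\<exists>C\<subseteq>grid n. real (card C) \<le> real N * real n
    \<and> real (card (nondisjoint_pairs n C)) \<le> 10 ^ 9 * \<epsilon> * (real n)\<^sup>2
    \<and> real (card {\<pi> \<in> Sn n. f \<pi> \<noteq> coset_max C \<pi>}) \<le> 10 ^ 9 * \<epsilon> * fact n"
proof -
  have mean': "(\<Sum>\<pi>\<in>Sn n. f \<pi>) \<le> fact n / 2"
    using mean unfolding expect_Sn_eq by (simp add: field_simps)
  have N1: "(1 :: real) \<le> fact N" by (rule fact_ge_1)
  have small': "\<epsilon> \<le> 1 / 10 ^ 20"
  proof -
    have "\<epsilon> * (10 ^ 20 * 1) \<le> \<epsilon> * (10 ^ 20 * fact N)" using \<epsilon> N1 by (intro mult_left_mono) auto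
    then show ?thesis using small by simp
  qed
  consider "n = 1" | "n \<ge> 2" using n by linarith
  then show ?thesis
  proof cases
    \<comment> \<open>There is no pair of positions to swap when \<open>n = 1\<close>. A Boolean
      function on one permutation with mean at most \<open>1/2\<close> is 0, so the empty set is
      exact.\<close>
    case 1
    have S1: "Sn n = {id}" using 1 by (auto simp: permutes_sing)
    then have "f id \<le> 1 / 2" using mean' 1 by simp
    then have "f id = 0" using f S1 by auto
    then have "{\<pi> \<in> Sn n. f \<pi> \<noteq> coset_max {} \<pi>} = {}" using S1 by auto
    then have "real (card {\<pi> \<in> Sn n. f \<pi> \<noteq> coset_max {} \<pi>}) = 0" by (simp only: card.empty of_nat_0)
    then have "real (card {\<pi> \<in> Sn n. f \<pi> \<noteq> coset_max {} \<pi>}) \<le> 10 ^ 9 * \<epsilon> * fact n"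
      using \<epsilon> by (simp only:) simp
    then show ?thesis using \<epsilon> by (intro exI[of _ "{}"] conjI) simp_all
  next
    case 2
    obtain l c where l: "expect_Sn n (\<lambda>\<pi>. (f \<pi> - l \<pi>)\<^sup>2) \<le> \<epsilon>"
      and c: "\<forall>\<pi>\<in>Sn n. l \<pi> = (\<Sum>i\<in>{1..n}. c i (\<pi> i))"
      using lin unfolding linear_on_Sn_iff by blast
    interpret near_linear n f c \<epsilon>
    proof
      have "(\<Sum>\<pi>\<in>Sn n. (f \<pi> - (\<Sum>i\<in>{1..n}. c i (\<pi> i)))\<^sup>2) = (\<Sum>\<pi>\<in>Sn n. (f \<pi> - l \<pi>)\<^sup>2)"
        using c by (intro sum.cong) auto
      then show "(\<Sum>\<pi>\<in>Sn n. (f \<pi> - (\<Sum>i\<in>{1..n}. c i (\<pi> i)))\<^sup>2) \<le> \<epsilon> * fact n"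
        using l unfolding expect_Sn_eq by (simp add: field_simps)
    qed (use f 2 in auto)
    show ?thesis
    proof (cases "n \<ge> N")
      case True
      then obtain C where C: "C \<subseteq> grid n" "real (card C) \<le> real n"
        "real (card (nondisjoint_pairs n C)) \<le> 10 ^ 9 * \<epsilon> * (real n)\<^sup>2"
        "real (card {\<pi> \<in> Sn n. f \<pi> \<noteq> coset_max C \<pi>}) \<le> 10 ^ 9 * \<epsilon> * fact n"
        using coset_approximation[OF _ small' mean'] N by blast
      have "real n \<le> real N * real n" using N by simp
      then show ?thesis using C by (intro exI[of _ C] conjI) linarith+
    next
      case False
      then have nN: "n \<le> N" by simp
      have "595208 * \<epsilon> * fact n \<le> 595208 * \<epsilon> * fact N"
        using \<epsilon> nN by (intro mult_left_mono fact_mono) auto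
      also have "\<dots> < 1"
      proof -
        have "10 ^ 20 * (\<epsilon> * fact N) \<le> 1" using small by (simp only: mult.left_commute)
        then have "595208 * (\<epsilon> * fact N) < 1" by simp
        then show ?thesis by (simp only: mult.assoc)
      qed
      finally obtain C where C: "C \<subseteq> grid n" "nondisjoint_pairs n C = {}" "\<forall>\<pi>\<in>Sn n. f \<pi> = coset_max C \<pi>"
        using exact_of_small_error[OF _ mean'] by blast
      have "card C \<le> n * n" using card_mono[OF _ C(1)] by simp
      also have "\<dots> \<le> N * n" using nN by simp
      finally have "real (card C) \<le> real N * real n" by (metis of_nat_le_iff of_nat_mult)
      moreover have "{\<pi> \<in> Sn n. f \<pi> \<noteq> coset_max C \<pi>} = {}" using C(3) by blast
      then have "real (card {\<pi> \<in> Sn n. f \<pi> \<noteq> coset_max C \<pi>}) = 0" by (simp only: card.empty of_nat_0)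
      then have "real (card {\<pi> \<in> Sn n. f \<pi> \<noteq> coset_max C \<pi>}) \<le> 10 ^ 9 * \<epsilon> * fact n"
        using \<epsilon> by (simp only:) simp
      ultimately show ?thesis using C(1,2) \<epsilon> by (intro exI[of _ C] conjI) simp_all
    qed
  qed
qed

section \<open>The converse direction\<close>

lemma card_crossing_pairs_le:
  assumes "C \<subseteq> grid n"
  shows "card (crossing_pairs C) \<le> 2 * card (nondisjoint_pairs n C)"
proof -
  let ?g = "\<lambda>(a, b). {a, b}"
  have fin: "finite (crossing_pairs C)"
    using assms finite_subset by (intro finite_crossing_pairs) blast
  have "card (crossing_pairs C) = (\<Sum>y\<in>?g ` crossing_pairs C. \<Sum>x\<in>{x \<in> crossing_pairs C. ?g x = y}. 1)"
    unfolding card_eq_sum by (rule sum.image_gen[OF fin])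
  also have "\<dots> \<le> (\<Sum>y\<in>?g ` crossing_pairs C. 2)"
  proof (rule sum_mono)
    fix y assume "y \<in> ?g ` crossing_pairs C"
    then obtain a b where y: "y = {a, b}" by auto
    have "{x \<in> crossing_pairs C. ?g x = y} \<subseteq> {(a, b), (b, a)}"
    proof
      fix x assume "x \<in> {x \<in> crossing_pairs C. ?g x = y}"
      then have "{fst x, snd x} = {a, b}" unfolding y by (simp add: case_prod_beta)
      then show "x \<in> {(a, b), (b, a)}" unfolding doubleton_eq_iff by (cases x) simp
    qed
    then have "card {x \<in> crossing_pairs C. ?g x = y} \<le> card {(a, b), (b, a)}"
      by (rule card_mono[rotated]) simp
    also have "\<dots> \<le> 2" by (rule card_insert_le_m1) simp_all
    finally show "(\<Sum>x\<in>{x \<in> crossing_pairs C. ?g x = y}. 1) \<le> (2 :: nat)"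
      unfolding card_eq_sum .
  qed
  also have "\<dots> = 2 * card (nondisjoint_pairs n C)" by (simp add: nondisjoint_pairs_eq[OF assms])
  finally show ?thesis .
qed

text \<open>The linear function is the number \<open>k\<close> of labels hit. For
  \<open>k \<ge> 1\<close> the square error is \<open>(k - 1)\<^sup>2 \<le> k * (k - 1)\<close>, the
  number of ordered crossing pairs hit, and each such pair is hit with probability
  \<open>1 / (n * (n - 1))\<close>. The factor 4 is 2 for the order within a pair times 2 from
  \<open>n \<le> 2 * (n - 1)\<close>.\<close>

lemma coset_max_near_linear:
  assumes n: "n \<ge> 1" and C: "C \<subseteq> grid n"
    and pairs: "real (card (nondisjoint_pairs n C)) \<le> A * \<epsilon> * (real n)\<^sup>2"
  shows "\<exists>l. linear_on_Sn n l \<and> expect_Sn n (\<lambda>\<pi>. (coset_max C \<pi> - l \<pi>)\<^sup>2) \<le> 4 * A * \<epsilon>"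
proof -
  have fin: "finite C" using C finite_subset by blast
  define l where "l \<pi> = (\<Sum>a\<in>C. hit a \<pi>)" for \<pi>
  have "linear_on_Sn n l"
    unfolding linear_on_Sn_def
  proof (intro exI ballI)
    fix \<pi>
    have "(\<Sum>i\<in>{1..n}. \<Sum>j\<in>{1..n}. of_bool ((i, j) \<in> C) * x_ind i j \<pi>)
      = (\<Sum>a\<in>grid n. if a \<in> C then hit a \<pi> else 0)"
      unfolding sum_over_pairs by (intro sum.cong refl) (auto simp: x_ind_def hit_def)
    also have "\<dots> = l \<pi>"
      unfolding l_def using C by (simp add: sum.If_cases Int_absorb1)
    finally show "l \<pi> = (\<Sum>i\<in>{1..n}. \<Sum>j\<in>{1..n}. of_bool ((i, j) \<in> C) * x_ind i j \<pi>)" ..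
  qed
  moreover have "expect_Sn n (\<lambda>\<pi>. (coset_max C \<pi> - l \<pi>)\<^sup>2) \<le> 4 * A * \<epsilon>"
  proof -
    have pt: "(coset_max C \<pi> - l \<pi>)\<^sup>2 \<le> (\<Sum>x\<in>crossing_pairs C. hit (fst x) \<pi> * hit (snd x) \<pi>)"
      if "\<pi> \<in> Sn n" for \<pi>
    proof -
      define k where "k = card {a \<in> C. \<pi> (fst a) = snd a}"
      have lk: "l \<pi> = real k" unfolding l_def k_def by (rule sum_hit_eq_card[OF fin])
      have "k = 0 \<longleftrightarrow> \<not> (\<exists>a\<in>C. \<pi> (fst a) = snd a)" unfolding k_def using fin by auto
      then have g: "coset_max C \<pi> = of_bool (k \<noteq> 0)" unfolding coset_max_eq[OF fin] by simp
      have "(of_bool (k \<noteq> 0) - real k)\<^sup>2 \<le> real k * (real k - 1)"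
        by (cases k) (auto simp: power2_eq_square algebra_simps)
      then show ?thesis
        using sum_crossing_pairs_hits[OF that fin] unfolding g lk l_def[symmetric] by (simp add: case_prod_beta)
    qed
    have "(\<Sum>\<pi>\<in>Sn n. (coset_max C \<pi> - l \<pi>)\<^sup>2)
        \<le> (\<Sum>\<pi>\<in>Sn n. \<Sum>x\<in>crossing_pairs C. hit (fst x) \<pi> * hit (snd x) \<pi>)"
      by (intro sum_mono pt)
    also have "\<dots> = (\<Sum>x\<in>crossing_pairs C. \<Sum>\<pi>\<in>Sn n. hit (fst x) \<pi> * hit (snd x) \<pi>)" by (rule sum.swap)
    also have "\<dots> = (\<Sum>x\<in>crossing_pairs C. fact (n - 2))"
      using C by (intro sum.cong refl sum_hit_two) (auto simp: crossing_pairs_def)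
    also have "\<dots> = real (card (crossing_pairs C)) * fact (n - 2)" by simp
    also have "\<dots> \<le> 4 * A * \<epsilon> * fact n"
    proof (cases "n = 1")
      case True
      then have "crossing_pairs C = {}" using C by (auto simp: crossing_pairs_def)
      moreover have "0 \<le> A * \<epsilon> * (real n)\<^sup>2" using pairs by (rule order_trans[rotated]) simp
      ultimately show ?thesis using True by simp
    next
      case False
      then obtain k where k: "n = k + 2" using n by (metis One_nat_def Suc_1 add.commute le_Suc_ex le_neq_implies_less less_eq_Suc_le)
      have F: "(fact n :: real) = real n * (real n - 1) * fact (n - 2)" by (simp add: k algebra_simps)
      have pos: "0 \<le> A * \<epsilon>"
      proof -
        have "0 \<le> A * \<epsilon> * (real n)\<^sup>2" using pairs by (rule order_trans[rotated]) simp
        then show ?thesis using n by (simp add: zero_le_mult_iff)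
      qed
      have "real (card (crossing_pairs C)) \<le> 2 * real (card (nondisjoint_pairs n C))"
        using card_crossing_pairs_le[OF C] by linarith
      also have "\<dots> \<le> 2 * (A * \<epsilon>) * (real n * real n)" using pairs by (simp add: power2_eq_square)
      also have "\<dots> \<le> 2 * (A * \<epsilon>) * (real n * (2 * (real n - 1)))"
        using pos k by (intro mult_left_mono) auto
      finally have "real (card (crossing_pairs C)) * fact (n - 2)
          \<le> 2 * (A * \<epsilon>) * (real n * (2 * (real n - 1))) * fact (n - 2)"
        by (intro mult_right_mono) auto
      then show ?thesis unfolding F by (simp add: mult_ac)
    qed
    finally show ?thesis unfolding expect_Sn_eq by (simp add: field_simps)
  qed
  ultimately show ?thesis by blast
qed

theorem theorem1p1:
  shows "(\<exists>K::real. K > 0 \<and>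
      (\<forall>(n::nat) (\<epsilon>::real) (f :: (nat \<Rightarrow> nat) \<Rightarrow> real).
         n \<ge> 1 \<longrightarrow> \<epsilon> \<ge> 0 \<longrightarrow>
         (\<forall>\<pi>\<in>Sn n. f \<pi> \<in> {0, 1}) \<longrightarrow>
         (\<exists>l. linear_on_Sn n l \<and> expect_Sn n (\<lambda>\<pi>. (f \<pi> - l \<pi>)\<^sup>2) \<le> \<epsilon>) \<longrightarrow>
         expect_Sn n f \<le> 1 / 2 \<longrightarrow>
         (\<exists>C \<subseteq> {1..n} \<times> {1..n}.
            real (card C) \<le> K * real n \<and>
            real (card (nondisjoint_pairs n C)) \<le> K * \<epsilon> * (real n)\<^sup>2 \<and>
            prob_Sn n {\<pi>. f \<pi> \<noteq> coset_max C \<pi>} \<le> K * \<epsilon>)))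
    \<and>
    (\<forall>A::real. A > 0 \<longrightarrow> (\<exists>B::real. B > 0 \<and>
      (\<forall>(n::nat) (\<epsilon>::real) C.
         n \<ge> 1 \<longrightarrow> \<epsilon> \<ge> 0 \<longrightarrow>
         C \<subseteq> {1..n} \<times> {1..n} \<longrightarrow>
         real (card C) \<le> A * real n \<longrightarrow>
         real (card (nondisjoint_pairs n C)) \<le> A * \<epsilon> * (real n)\<^sup>2 \<longrightarrow>
         (\<exists>l. linear_on_Sn n l \<and>
            expect_Sn n (\<lambda>\<pi>. (coset_max C \<pi> - l \<pi>)\<^sup>2) \<le> B * \<epsilon>))))"
proof (rule conjI, goal_cases)
  case 1
  obtain N :: nat where N: "N = 15360" by blast
  \<comment> \<open>The power of ten gives the smallness used for large \<open>n\<close>, the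
    factorial gives exactness for \<open>n < N\<close>. When \<open>\<epsilon> * K\<close> exceeds
    1, the probability bound is trivial and the empty set will do.\<close>
  define K :: real where "K = 10 ^ 20 * fact N"
  have K: "K > 0" "10 ^ 9 \<le> K" "real N \<le> K"
  proof -
    have 1: "(1 :: real) \<le> fact N" by (rule fact_ge_1)
    have "(10 :: real) ^ 20 * 1 \<le> K" unfolding K_def by (intro mult_left_mono 1) auto
    then show "K > 0" "10 ^ 9 \<le> K" "real N \<le> K" using N by simp_all
  qed
  show ?case
  proof (intro exI[of _ K] conjI K allI impI, goal_cases)
    case (1 n \<epsilon> f)
    note n = 1(1) and \<epsilon> = 1(2) and f = 1(3) and lin = 1(4) and mean = 1(5)
    show ?case
    proof (cases "\<epsilon> * K \<le> 1")
      case True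
      then obtain C where C: "C \<subseteq> grid n" "real (card C) \<le> real N * real n"
        "real (card (nondisjoint_pairs n C)) \<le> 10 ^ 9 * \<epsilon> * (real n)\<^sup>2"
        "real (card {\<pi> \<in> Sn n. f \<pi> \<noteq> coset_max C \<pi>}) \<le> 10 ^ 9 * \<epsilon> * fact n"
        using near_linear_coset_approximation[OF N n \<epsilon> f lin mean] unfolding K_def by blast
      have "real N * real n \<le> K * real n" using K by (intro mult_right_mono) auto
      moreover have "10 ^ 9 * \<epsilon> * (real n)\<^sup>2 \<le> K * \<epsilon> * (real n)\<^sup>2"
        using K \<epsilon> by (intro mult_right_mono) auto
      moreover have "prob_Sn n {\<pi>. f \<pi> \<noteq> coset_max C \<pi>} \<le> K * \<epsilon>"
      proof -
        have "prob_Sn n {\<pi>. f \<pi> \<noteq> coset_max C \<pi>} \<le> 10 ^ 9 * \<epsilon>"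
          unfolding prob_Sn_eq using C(4) by (simp add: field_simps)
        also have "\<dots> \<le> K * \<epsilon>" using K \<epsilon> by (intro mult_right_mono) auto
        finally show ?thesis .
      qed
      ultimately show ?thesis using C by (intro exI[of _ C] conjI) linarith+
    next
      case False
      have "prob_Sn n {\<pi>. f \<pi> \<noteq> coset_max {} \<pi>} \<le> 1" by (rule measure_pmf.prob_le_1)
      also have "\<dots> \<le> K * \<epsilon>" using False by (simp add: mult.commute)
      finally show ?thesis using K \<epsilon> by (intro exI[of _ "{}"]) simp
    qed
  qed
next
  case 2
  show ?case
  proof (intro allI impI, goal_cases)
    case (1 A)
    then show ?case
      using coset_max_near_linear by (intro exI[of _ "4 * A"] conjI allI impI) auto
  qed
qed

end
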